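(* Let $k\ge 2$, let $T:\widetilde{\mathcal W}_k\to\mathbb R$ be bounded and continuous on $(\widetilde{\mathcal W}_k,\delta_\square)$, and let $$\widetilde{\mathcal S}_T:=\operatorname*{arg\,max}_{\widetilde{\mathbf W}\in\widetilde{\mathcal W}_k}\Big\{T(\widetilde{\mathbf W})-\tfrac12\mathcal I(\widetilde{\mathbf W})\Big\}.$$ For each $n\ge1$ let $\mathscr X_n$ be a random element of $\mathcal C_n^k$ with law $\mathbb P_n$, where $\mathbb P_n(\mathscr X)$ is proportional to $\exp\{n^2T(\widetilde{\mathbf W}^{\mathscr X})\}$. Then for every $\delta>0$ there exists $C=C(\delta)>0$ such that for all sufficiently large $n$, $$\mathbb P_n\Big(\delta_\square(\widetilde{\mathbf W}^{\mathscr X_n},\widetilde{\mathcal S}_T)>\delta\Big)\le e^{-Cn^2}.$$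
   Context: Let $[k]=\{1,\dots,k\}$ and $\Delta_k=\{\mu\in[0,1]^k:\sum_a\mu_a=1\}$. A $k$-colored probability graphon is a measurable symmetric map $\mathbf W=(W_1,\dots,W_k):[0,1]^2\to\Delta_k$; $\mathcal W_k$ is the set of these. For a bounded measurable $U:[0,1]^2\to\mathbb R$, $\|U\|_\square=\sup_{S,T\subset[0,1]}|\int_{S\times T}U|$ (measurable $S,T$); for vector-valued $\mathbf U$, $\|\mathbf U\|_\square=\sum_a\|U_a\|_\square$. Cut distance: $\delta_\square(\mathbf U,\mathbf W)=\inf_\phi\|\mathbf U-\mathbf W^\phi\|_\square$ over measure-preserving bijections $\phi$ of $[0,1]$, where $\mathbf W^\phi(x,y)=\mathbf W(\phi(x),\phi(y))$. $\widetilde{\mathcal W}_k$ is the quotient of $\mathcal W_k$ by $\delta_\square=0$, with the induced metric; $\widetilde{\mathbf W}$ is the class of $\mathbf W$. For a set $A\subseteq\widetilde{\mathcal W}_k$, $\delta_\square(\widetilde{\mathbf W},A)=\inf_{\widetilde{\mathbf U}\in A}\delta_\square(\widetilde{\mathbf W},\widetilde{\mathbf U})$. $\mathcal C_n^k$ is the set of all maps $\mathscr X$ from the edge set of the complete graph $K_n$ on $\{1,\dots,n\}$ to $[k]$. The empirical graphon $\mathbf W^{\mathscr X}\in\mathcal W_k$ has $W^{\mathscr X}_a(x,y)=\mathbf 1\{\mathscr X(\{u,v\})=a\}$ for $(x,y)\in(\frac{u-1}n,\frac un]\times(\frac{v-1}n,\frac vn]$, $u\ne v$, and $\mathbf W^{\mathscr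 X}=(\frac1k,\dots,\frac1k)$ on the diagonal blocks $u=v$. $\mathcal I(\mathbf W)=\sum_{a=1}^k\int_{[0,1]^2}W_a\log W_a\,dx\,dy$ (with $0\log0=0$); it depends only on the class $\widetilde{\mathbf W}$. *)

theory Defs
  imports "HOL-Probability.Probability"
begin

section \<open>Probability graphons\<close>

text \<open>A \<open>k\<close>-coloured graphon is a family \<open>W a (x, y)\<close> indexed by colours \<open>a \<in> {1..k}\<close>. Its values at
  other colours or outside the unit square are irrelevant: no notion below depends on them.\<close>

type_synonym graphon = "nat \<Rightarrow> real \<times> real \<Rightarrow> real"

abbreviation unit_interval :: "real measure" where
  "unit_interval \<equiv> restrict_space lborel {0..1}"

abbreviation unit_square :: "(real \<times> real) measure" where
  "unit_square \<equiv> unit_interval \<Otimes>\<^sub>M unit_interval"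

definition prob_simplex :: "nat \<Rightarrow> (nat \<Rightarrow> real) set" where
  "prob_simplex k = {\<mu>. (\<forall>a\<in>{1..k}. \<mu> a \<in> {0..1}) \<and> (\<Sum>a=1..k. \<mu> a) = 1}"

definition prob_graphons :: "nat \<Rightarrow> graphon set" where
  "prob_graphons k = {W.
     (\<forall>a\<in>{1..k}. W a \<in> borel_measurable unit_square) \<and>
     (\<forall>x\<in>{0..1}. \<forall>y\<in>{0..1}. (\<lambda>a. W a (x, y)) \<in> prob_simplex k) \<and>
     (\<forall>a\<in>{1..k}. \<forall>x\<in>{0..1}. \<forall>y\<in>{0..1}. W a (x, y) = W a (y, x))}"


section \<open>Cut norm and cut distance\<close>

definition cut_norm :: "(real \<times> real \<Rightarrow> real) \<Rightarrow> real" where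
  "cut_norm U = (SUP (S, T) \<in> sets unit_interval \<times> sets unit_interval.
     \<bar>LINT p:S \<times> T|unit_square. U p\<bar>)"

definition vec_cut_norm :: "nat \<Rightarrow> graphon \<Rightarrow> real" where
  "vec_cut_norm k U = (\<Sum>a=1..k. cut_norm (U a))"

text \<open>The inverse of a Borel bijection of \<open>[0,1]\<close> is automatically Borel (Lusin--Souslin), so requiring
  its measurability is no restriction; it is stated explicitly because that theorem is not in the
  library.\<close>

definition mp_bijections :: "(real \<Rightarrow> real) set" where
  "mp_bijections = {\<phi>. bij_betw \<phi> {0..1} {0..1} \<and>
     \<phi> \<in> unit_interval \<rightarrow>\<^sub>M unit_interval \<and>
     inv_into {0..1} \<phi> \<in> unit_interval \<rightarrow>\<^sub>M unit_interval \<and>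
     distr unit_interval unit_interval \<phi> = unit_interval}"

definition pullback :: "(real \<Rightarrow> real) \<Rightarrow> graphon \<Rightarrow> graphon" where
  "pullback \<phi> W = (\<lambda>a (x, y). W a (\<phi> x, \<phi> y))"

definition cut_dist :: "nat \<Rightarrow> graphon \<Rightarrow> graphon \<Rightarrow> real" where
  "cut_dist k U W =
     (INF \<phi>\<in>mp_bijections. vec_cut_norm k (\<lambda>a p. U a p - pullback \<phi> W a p))"


section \<open>The quotient space\<close>

definition cut_rel :: "nat \<Rightarrow> (graphon \<times> graphon) set" where
  "cut_rel k = {(U, W) \<in> prob_graphons k \<times> prob_graphons k. cut_dist k U W = 0}"

definition graphon_space :: "nat \<Rightarrow> graphon set set" where
  "graphon_space k = prob_graphons k // cut_rel k"

definition graphon_class :: "nat \<Rightarrow> graphon \<Rightarrow> graphon set" where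
  "graphon_class k W = cut_rel k `` {W}"

definition graphon_rep :: "graphon set \<Rightarrow> graphon" where
  "graphon_rep A = (SOME W. W \<in> A)"

text \<open>The value \<open>0\<close> off the quotient space only serves the locale \<open>Metric_space\<close>, which asks for
  nonnegativity and symmetry at all arguments.\<close>

definition class_dist :: "nat \<Rightarrow> graphon set \<Rightarrow> graphon set \<Rightarrow> real" where
  "class_dist k A B = (if A \<in> graphon_space k \<and> B \<in> graphon_space k
     then cut_dist k (graphon_rep A) (graphon_rep B) else 0)"

definition class_dist_set :: "nat \<Rightarrow> graphon set \<Rightarrow> graphon set set \<Rightarrow> real" where
  "class_dist_set k A \<B> = (INF B\<in>\<B>. class_dist k A B)"


section \<open>Entropy and maximisers\<close>

definition graphon_entropy :: "nat \<Rightarrow> graphon \<Rightarrow> real" where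
  "graphon_entropy k W = (\<Sum>a=1..k. LINT p|unit_square. W a p * ln (W a p))"

text \<open>The entropy is constant on every class, so the choice of representative is immaterial.\<close>

definition class_entropy :: "nat \<Rightarrow> graphon set \<Rightarrow> real" where
  "class_entropy k A = graphon_entropy k (graphon_rep A)"

definition maximizers :: "nat \<Rightarrow> (graphon set \<Rightarrow> real) \<Rightarrow> graphon set set" where
  "maximizers k T =
     {A. is_arg_max (\<lambda>A. T A - 1/2 * class_entropy k A) (\<lambda>A. A \<in> graphon_space k) A}"


section \<open>Edge colourings and their empirical graphons\<close>

definition complete_edges :: "nat \<Rightarrow> nat set set" where
  "complete_edges n = {e. e \<subseteq> {1..n} \<and> card e = 2}"

definition colorings :: "nat \<Rightarrow> nat \<Rightarrow> (nat set \<Rightarrow> nat) set" where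
  "colorings n k = complete_edges n \<rightarrow>\<^sub>E {1..k}"

text \<open>For \<open>1 \<le> u \<le> n\<close>, \<open>nat \<lceil>n x\<rceil> = u\<close> holds iff \<open>x\<close> lies in the interval from \<open>(u - 1)/n\<close>, excluded,
  to \<open>u/n\<close>, included; see \<open>empirical_graphon_block\<close>. On the null set \<open>x = 0\<close> or \<open>y = 0\<close>, which
  lies in no block, the value is \<open>1/k\<close> as on the diagonal blocks.\<close>

definition empirical_graphon :: "nat \<Rightarrow> nat \<Rightarrow> (nat set \<Rightarrow> nat) \<Rightarrow> graphon" where
  "empirical_graphon n k c = (\<lambda>a (x, y).
     let u = nat \<lceil>real n * x\<rceil>; v = nat \<lceil>real n * y\<rceil> in
     if u \<in> {1..n} \<and> v \<in> {1..n} \<and> u \<noteq> v then of_bool (c {u, v} = a) else 1 / real k)"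

definition empirical_class :: "nat \<Rightarrow> nat \<Rightarrow> (nat set \<Rightarrow> nat) \<Rightarrow> graphon set" where
  "empirical_class n k c = graphon_class k (empirical_graphon n k c)"

definition gibbs_weight :: "nat \<Rightarrow> (graphon set \<Rightarrow> real) \<Rightarrow> nat \<Rightarrow> (nat set \<Rightarrow> nat) \<Rightarrow> real" where
  "gibbs_weight k T n c = exp (real n ^ 2 * T (empirical_class n k c))"

definition gibbs_law :: "nat \<Rightarrow> (graphon set \<Rightarrow> real) \<Rightarrow> nat \<Rightarrow> (nat set \<Rightarrow> nat) measure" where
  "gibbs_law k T n = point_measure (colorings n k)
     (\<lambda>c. ennreal (gibbs_weight k T n c / (\<Sum>c'\<in>colorings n k. gibbs_weight k T n c')))"

lemma empirical_graphon_block: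
  assumes "u \<in> {1..n}" "v \<in> {1..n}"
    and x: "x \<in> {(real u - 1) / real n <.. real u / real n}"
    and y: "y \<in> {(real v - 1) / real n <.. real v / real n}"
  shows "empirical_graphon n k c a (x, y) =
    (if u \<noteq> v then of_bool (c {u, v} = a) else 1 / real k)"
proof -
  have ceil: "nat \<lceil>real n * z\<rceil> = w"
    if "w \<in> {1..n}" "z \<in> {(real w - 1) / real n <.. real w / real n}" for z w
  proof -
    have n: "real n > 0" using that(1) by auto
    have "real w - 1 < real n * z" "real n * z \<le> real w"
      using that(2) n by (auto simp: field_simps)
    then have "\<lceil>real n * z\<rceil> = int w"
      by (intro ceiling_unique) auto
    then show ?thesis by simp
  qed
  show ?thesis
    unfolding empirical_graphon_def Let_def prod.case ceil[OF assms(1) x] ceil[OF assms(2) y]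
    using assms(1,2) by simp
qed


section \<open>The quotient is a metric space\<close>

lemma space_unit_interval [simp]: "space unit_interval = {0..1}"
  by (simp add: space_restrict_space)

lemma prob_space_unit_interval: "prob_space unit_interval"
  by (rule prob_spaceI) (simp add: emeasure_restrict_space space_restrict_space)

lemma prob_space_unit_square: "prob_space unit_square"
proof -
  interpret prob_space unit_interval by (rule prob_space_unit_interval)
  interpret P: pair_prob_space unit_interval unit_interval ..
  show ?thesis by (rule P.prob_space_axioms)
qed

definition bdd_fun :: "(real \<times> real \<Rightarrow> real) \<Rightarrow> bool" where
  "bdd_fun F \<longleftrightarrow> F \<in> borel_measurable unit_square \<and>
     (\<exists>B. \<forall>p\<in>{0..1}\<times>{0..1}. \<bar>F p\<bar> \<le> B)"

lemma space_unit_square: "space unit_square = {0..1} \<times> {0..1}"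
  by (simp add: space_pair_measure)

lemma bdd_fun_integrable:
  assumes "bdd_fun F" shows "integrable unit_square F"
proof -
  interpret prob_space unit_square by (rule prob_space_unit_square)
  obtain B where "\<forall>p\<in>{0..1}\<times>{0..1}. \<bar>F p\<bar> \<le> B"
    using assms by (auto simp: bdd_fun_def)
  then show ?thesis
    using assms by (intro integrable_const_bound[where B=B] AE_I2)
      (auto simp: bdd_fun_def space_unit_square)
qed

lemma bdd_fun_set_integrable:
  assumes "bdd_fun F" "S \<in> sets unit_interval" "T \<in> sets unit_interval"
  shows "set_integrable unit_square (S \<times> T) F"
  unfolding set_integrable_def
  using assms by (intro integrable_mult_indicator bdd_fun_integrable) auto

lemma bdd_fun_diff:
  assumes "bdd_fun F" "bdd_fun G" shows "bdd_fun (\<lambda>p. F p - G p)"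
proof -
  obtain A B where AB: "\<forall>p\<in>{0..1}\<times>{0..1}. \<bar>F p\<bar> \<le> A" "\<forall>p\<in>{0..1}\<times>{0..1}. \<bar>G p\<bar> \<le> B"
    using assms unfolding bdd_fun_def by blast
  have "\<bar>F p - G p\<bar> \<le> A + B" if "p \<in> {0..1}\<times>{0..1}" for p
    using bspec[OF AB(1) that] bspec[OF AB(2) that] by linarith
  moreover have "(\<lambda>p. F p - G p) \<in> borel_measurable unit_square"
    using assms by (intro borel_measurable_diff) (simp_all add: bdd_fun_def)
  ultimately show ?thesis unfolding bdd_fun_def by blast
qed

lemma cut_norm_upper:
  assumes F: "bdd_fun F" and S: "S \<in> sets unit_interval" and T: "T \<in> sets unit_interval"
  shows "\<bar>LINT p:S\<times>T|unit_square. F p\<bar> \<le> cut_norm F"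
proof -
  have "\<bar>LINT p:S\<times>T|unit_square. F p\<bar> \<le> (LINT p|unit_square. \<bar>F p\<bar>)"
    if "S \<in> sets unit_interval" "T \<in> sets unit_interval" for S T
  proof -
    have "\<bar>LINT p:S\<times>T|unit_square. F p\<bar> \<le> (LINT p|unit_square. \<bar>indicator (S\<times>T) p *\<^sub>R F p\<bar>)"
      unfolding set_lebesgue_integral_def by (rule integral_abs_bound)
    also have "\<dots> \<le> (LINT p|unit_square. \<bar>F p\<bar>)"
      using bdd_fun_set_integrable[OF F that] bdd_fun_integrable[OF F]
      by (intro integral_mono) (auto simp: set_integrable_def indicator_def)
    finally show ?thesis .
  qed
  then have "bdd_above ((\<lambda>(S, T). \<bar>LINT p:S\<times>T|unit_square. F p\<bar>)
      ` (sets unit_interval \<times> sets unit_interval))"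
    by (intro bdd_aboveI[where M="LINT p|unit_square. \<bar>F p\<bar>"]) auto
  then show ?thesis
    unfolding cut_norm_def using S T
    by (intro cSUP_upper2[where x="(S, T)"]) auto
qed

lemma cut_norm_least:
  assumes "\<And>S T. S \<in> sets unit_interval \<Longrightarrow> T \<in> sets unit_interval \<Longrightarrow>
    \<bar>LINT p:S\<times>T|unit_square. F p\<bar> \<le> c"
  shows "cut_norm F \<le> c"
  unfolding cut_norm_def using assms
  by (intro cSUP_least) (use sets.empty_sets in blast, auto)

lemma cut_norm_nonneg: "bdd_fun F \<Longrightarrow> 0 \<le> cut_norm F"
  using cut_norm_upper[of F "{}" "{}"] by (simp add: set_lebesgue_integral_def)

lemma cut_norm_zero: "cut_norm (\<lambda>p. 0) = 0"
proof -
  have "cut_norm (\<lambda>p. 0) \<le> 0" by (rule cut_norm_least) simp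
  moreover have "0 \<le> cut_norm (\<lambda>p. 0)" by (rule cut_norm_nonneg) (auto simp: bdd_fun_def)
  ultimately show ?thesis by simp
qed

lemma cut_norm_minus_commute: "cut_norm (\<lambda>p. F p - G p) = cut_norm (\<lambda>p. G p - F p)"
proof -
  have "(LINT p:A|unit_square. F p - G p) = - (LINT p:A|unit_square. G p - F p)" for A
    unfolding set_lebesgue_integral_def integral_minus[symmetric]
    by (rule Bochner_Integration.integral_cong) (auto simp: algebra_simps)
  then show ?thesis by (simp add: cut_norm_def)
qed

lemma cut_norm_triangle:
  assumes F: "bdd_fun F" and G: "bdd_fun G" and H: "bdd_fun H"
  shows "cut_norm (\<lambda>p. F p - H p) \<le> cut_norm (\<lambda>p. F p - G p) + cut_norm (\<lambda>p. G p - H p)"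
proof (rule cut_norm_least)
  fix S T assume ST: "S \<in> sets unit_interval" "T \<in> sets unit_interval"
  have FG: "bdd_fun (\<lambda>p. F p - G p)" and GH: "bdd_fun (\<lambda>p. G p - H p)"
    using assms by (auto intro: bdd_fun_diff)
  have "(LINT p:S\<times>T|unit_square. F p - H p) =
      (LINT p:S\<times>T|unit_square. (F p - G p) + (G p - H p))"
    by simp
  also have "\<dots> = (LINT p:S\<times>T|unit_square. F p - G p) + (LINT p:S\<times>T|unit_square. G p - H p)"
    by (intro set_integral_add bdd_fun_set_integrable FG GH ST)
  finally show "\<bar>LINT p:S\<times>T|unit_square. F p - H p\<bar> \<le>
      cut_norm (\<lambda>p. F p - G p) + cut_norm (\<lambda>p. G p - H p)"
    using cut_norm_upper[OF FG ST] cut_norm_upper[OF GH ST] by linarith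
qed

lemma mp_bijectionsD:
  assumes "\<phi> \<in> mp_bijections"
  shows "bij_betw \<phi> {0..1} {0..1}" "\<phi> \<in> unit_interval \<rightarrow>\<^sub>M unit_interval"
    "inv_into {0..1} \<phi> \<in> unit_interval \<rightarrow>\<^sub>M unit_interval"
    "distr unit_interval unit_interval \<phi> = unit_interval"
  using assms by (auto simp: mp_bijections_def)

lemma mp_square:
  assumes "\<phi> \<in> mp_bijections"
  shows "(\<lambda>(x, y). (\<phi> x, \<phi> y)) \<in> unit_square \<rightarrow>\<^sub>M unit_square"
    "distr unit_square unit_square (\<lambda>(x, y). (\<phi> x, \<phi> y)) = unit_square"
proof -
  note [measurable] = mp_bijectionsD(2)[OF assms]
  show "(\<lambda>(x, y). (\<phi> x, \<phi> y)) \<in> unit_square \<rightarrow>\<^sub>M unit_square" by measurable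
  interpret prob_space unit_interval by (rule prob_space_unit_interval)
  show "distr unit_square unit_square (\<lambda>(x, y). (\<phi> x, \<phi> y)) = unit_square"
    using pair_measure_distr[OF mp_bijectionsD(2)[OF assms] mp_bijectionsD(2)[OF assms]]
    by (simp add: mp_bijectionsD(4)[OF assms] sigma_finite_measure_axioms)
qed

lemma bdd_fun_comp:
  assumes "bdd_fun F" "\<phi> \<in> mp_bijections"
  shows "bdd_fun (\<lambda>(x, y). F (\<phi> x, \<phi> y))"
proof -
  have meas: "(\<lambda>p. F ((\<lambda>(x, y). (\<phi> x, \<phi> y)) p)) \<in> borel_measurable unit_square"
    using assms(1) by (intro measurable_compose[OF mp_square(1)[OF assms(2)]]) (simp add: bdd_fun_def)
  have "\<phi> x \<in> {0..1}" if "x \<in> {0..1}" for x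
    using bij_betwE[OF mp_bijectionsD(1)[OF assms(2)]] that by blast
  moreover obtain B where "\<forall>p\<in>{0..1}\<times>{0..1}. \<bar>F p\<bar> \<le> B"
    using assms(1) unfolding bdd_fun_def by blast
  ultimately have "\<forall>p\<in>{0..1}\<times>{0..1}. \<bar>F ((\<lambda>(x, y). (\<phi> x, \<phi> y)) p)\<bar> \<le> B"
    by (auto simp del: atLeastAtMost_iff)
  then show ?thesis
    using meas by (auto simp: bdd_fun_def case_prod_beta simp del: atLeastAtMost_iff)
qed

lemma cut_norm_comp_le:
  assumes F: "bdd_fun F" and \<phi>: "\<phi> \<in> mp_bijections"
  shows "cut_norm (\<lambda>(x, y). F (\<phi> x, \<phi> y)) \<le> cut_norm F"
proof (rule cut_norm_least)
  fix S T assume ST: "S \<in> sets unit_interval" "T \<in> sets unit_interval"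
  define \<psi> where "\<psi> = inv_into {0..1} \<phi>"
  define im where "im A = \<psi> -` A \<inter> {0..1}" for A
  have im: "im A \<in> sets unit_interval" if "A \<in> sets unit_interval" for A
    using measurable_sets[OF mp_bijectionsD(3)[OF \<phi>] that] by (simp add: im_def \<psi>_def)
  have iff: "\<phi> x \<in> im A \<longleftrightarrow> x \<in> A" if "x \<in> {0..1}" for x A
    using mp_bijectionsD(1)[OF \<phi>] that
    by (auto simp: im_def \<psi>_def bij_betw_def simp del: atLeastAtMost_iff)
  have meas: "(\<lambda>p. indicator (im S \<times> im T) p *\<^sub>R F p) \<in> borel_measurable unit_square"
    using F im[OF ST(1)] im[OF ST(2)]
    by (intro borel_measurable_scaleR borel_measurable_indicator) (auto simp: bdd_fun_def)
  have "(LINT p:im S \<times> im T|unit_square. F p) =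
      (LINT p:im S \<times> im T|distr unit_square unit_square (\<lambda>(x, y). (\<phi> x, \<phi> y)). F p)"
    by (simp add: mp_square(2)[OF \<phi>])
  also have "\<dots> = (LINT p|unit_square. indicator (im S \<times> im T) ((\<lambda>(x, y). (\<phi> x, \<phi> y)) p) *\<^sub>R
      F ((\<lambda>(x, y). (\<phi> x, \<phi> y)) p))"
    unfolding set_lebesgue_integral_def by (rule integral_distr[OF mp_square(1)[OF \<phi>] meas])
  also have "\<dots> = (LINT p:S\<times>T|unit_square. (\<lambda>(x, y). F (\<phi> x, \<phi> y)) p)"
    unfolding set_lebesgue_integral_def
    by (rule Bochner_Integration.integral_cong)
      (auto simp: space_unit_square indicator_def iff simp del: atLeastAtMost_iff)
  finally show "\<bar>LINT p:S\<times>T|unit_square. (\<lambda>(x, y). F (\<phi> x, \<phi> y)) p\<bar> \<le> cut_norm F"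
    using cut_norm_upper[OF F im[OF ST(1)] im[OF ST(2)]] by simp
qed

lemma id_mp: "(\<lambda>x. x) \<in> mp_bijections"
proof -
  have "inv_into {0..1} (\<lambda>x. x) \<in> unit_interval \<rightarrow>\<^sub>M unit_interval
      \<longleftrightarrow> (\<lambda>x. x) \<in> unit_interval \<rightarrow>\<^sub>M unit_interval"
    by (rule measurable_cong) (simp add: inv_into_f_eq)
  then show ?thesis
    by (simp add: mp_bijections_def bij_betw_def distr_id2)
qed

lemma inv_mp:
  assumes "\<phi> \<in> mp_bijections" shows "inv_into {0..1} \<phi> \<in> mp_bijections"
proof -
  note D = mp_bijectionsD[OF assms]
  let ?\<psi> = "inv_into {0..1} \<phi>"
  have bij: "bij_betw ?\<psi> {0..1} {0..1}" using D(1) by (rule bij_betw_inv_into)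
  have "inv_into {0..1} ?\<psi> \<in> unit_interval \<rightarrow>\<^sub>M unit_interval
      \<longleftrightarrow> \<phi> \<in> unit_interval \<rightarrow>\<^sub>M unit_interval"
    by (rule measurable_cong)
      (use inv_into_inv_into_eq[OF D(1)] in \<open>simp del: atLeastAtMost_iff\<close>)
  moreover have "distr unit_interval unit_interval ?\<psi> = unit_interval"
  proof -
    have "distr unit_interval unit_interval ?\<psi> =
        distr (distr unit_interval unit_interval \<phi>) unit_interval ?\<psi>"
      by (simp add: D(4))
    also have "\<dots> = distr unit_interval unit_interval (?\<psi> \<circ> \<phi>)"
      by (rule distr_distr[OF D(3) D(2)])
    also have "\<dots> = distr unit_interval unit_interval (\<lambda>x. x)"
      using D(1) by (intro distr_cong) (auto simp: bij_betw_def simp del: atLeastAtMost_iff)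
    finally show ?thesis by (simp add: distr_id2)
  qed
  ultimately show ?thesis
    using D bij by (simp add: mp_bijections_def)
qed

lemma comp_mp:
  assumes "\<phi> \<in> mp_bijections" "\<psi> \<in> mp_bijections"
  shows "(\<lambda>x. \<psi> (\<phi> x)) \<in> mp_bijections"
proof -
  note D = mp_bijectionsD[OF assms(1)] and E = mp_bijectionsD[OF assms(2)]
  have bij: "bij_betw (\<psi> \<circ> \<phi>) {0..1} {0..1}" using D(1) E(1) by (rule bij_betw_trans)
  have meas: "\<psi> \<circ> \<phi> \<in> unit_interval \<rightarrow>\<^sub>M unit_interval"
    by (rule measurable_comp[OF D(2) E(2)])
  have "inv_into {0..1} (\<psi> \<circ> \<phi>) \<in> unit_interval \<rightarrow>\<^sub>M unit_interval
      \<longleftrightarrow> inv_into {0..1} \<phi> \<circ> inv_into {0..1} \<psi> \<in> unit_interval \<rightarrow>\<^sub>M unit_interval"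
  proof (rule measurable_cong)
    fix z assume z: "z \<in> space unit_interval"
    then show "inv_into {0..1} (\<psi> \<circ> \<phi>) z = (inv_into {0..1} \<phi> \<circ> inv_into {0..1} \<psi>) z"
      using inv_into_comp[of \<psi> \<phi> "{0..1}" z] D(1) E(1)
      by (auto simp: bij_betw_def simp del: atLeastAtMost_iff)
  qed
  moreover have "distr unit_interval unit_interval (\<psi> \<circ> \<phi>) = unit_interval"
    using distr_distr[OF E(2) D(2)] D(4) E(4) by simp
  ultimately have "\<psi> \<circ> \<phi> \<in> mp_bijections"
    using bij meas measurable_comp[OF E(3) D(3)] by (simp add: mp_bijections_def)
  then show ?thesis by (simp add: comp_def)
qed

lemma prob_graphons_bdd:
  assumes "W \<in> prob_graphons k" "a \<in> {1..k}" shows "bdd_fun (W a)"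
proof -
  have "\<bar>W a (x, y)\<bar> \<le> 1" if "x \<in> {0..1}" "y \<in> {0..1}" for x y
  proof -
    have "(\<lambda>a. W a (x, y)) \<in> prob_simplex k" using assms(1) that by (simp add: prob_graphons_def)
    then have "W a (x, y) \<in> {0..1}" using assms(2) unfolding prob_simplex_def by blast
    then show ?thesis by simp
  qed
  then have "\<forall>p\<in>{0..1}\<times>{0..1}. \<bar>W a p\<bar> \<le> 1" by auto
  then show ?thesis using assms unfolding bdd_fun_def prob_graphons_def by blast
qed

lemma pullback_bdd:
  assumes "W \<in> prob_graphons k" "a \<in> {1..k}" "\<phi> \<in> mp_bijections"
  shows "bdd_fun (pullback \<phi> W a)"
  unfolding pullback_def by (intro bdd_fun_comp prob_graphons_bdd[OF assms(1,2)] assms(3))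

lemma vec_cut_norm_nonneg:
  assumes "U \<in> prob_graphons k" "W \<in> prob_graphons k" "\<phi> \<in> mp_bijections"
  shows "0 \<le> vec_cut_norm k (\<lambda>a p. U a p - pullback \<phi> W a p)"
  unfolding vec_cut_norm_def
  by (intro sum_nonneg cut_norm_nonneg bdd_fun_diff prob_graphons_bdd[OF assms(1)]
      pullback_bdd[OF assms(2)] assms(3))

lemma cut_dist_lower:
  assumes "U \<in> prob_graphons k" "W \<in> prob_graphons k" "\<phi> \<in> mp_bijections"
  shows "cut_dist k U W \<le> vec_cut_norm k (\<lambda>a p. U a p - pullback \<phi> W a p)"
  unfolding cut_dist_def using assms vec_cut_norm_nonneg[OF assms(1,2)]
  by (intro cINF_lower bdd_belowI[where m=0]) auto

lemma cut_dist_greatest: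
  assumes "\<And>\<phi>. \<phi> \<in> mp_bijections \<Longrightarrow> c \<le> vec_cut_norm k (\<lambda>a p. U a p - pullback \<phi> W a p)"
  shows "c \<le> cut_dist k U W"
  unfolding cut_dist_def using assms id_mp by (intro cINF_greatest) auto

lemma cut_dist_nonneg:
  "U \<in> prob_graphons k \<Longrightarrow> W \<in> prob_graphons k \<Longrightarrow> 0 \<le> cut_dist k U W"
  by (intro cut_dist_greatest vec_cut_norm_nonneg)

lemma cut_dist_refl:
  assumes "U \<in> prob_graphons k" shows "cut_dist k U U = 0"
  using cut_dist_lower[OF assms assms id_mp] cut_dist_nonneg[OF assms assms]
  by (simp add: pullback_def vec_cut_norm_def cut_norm_zero)

lemma cut_dist_sym_le:
  assumes "U \<in> prob_graphons k" "W \<in> prob_graphons k"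
  shows "cut_dist k W U \<le> cut_dist k U W"
proof (rule cut_dist_greatest)
  fix \<phi> assume \<phi>: "\<phi> \<in> mp_bijections"
  define \<psi> where "\<psi> = inv_into {0..1} \<phi>"
  have \<psi>: "\<psi> \<in> mp_bijections" unfolding \<psi>_def by (rule inv_mp[OF \<phi>])
  have inv: "\<phi> (\<psi> x) = x" if "x \<in> {0..1}" for x
    using mp_bijectionsD(1)[OF \<phi>] that by (simp add: \<psi>_def bij_betw_inv_into_right del: atLeastAtMost_iff)
  have "cut_norm (\<lambda>p. W a p - pullback \<psi> U a p) \<le> cut_norm (\<lambda>p. U a p - pullback \<phi> W a p)"
    if a: "a \<in> {1..k}" for a
  proof -
    have "cut_norm (\<lambda>p. W a p - pullback \<psi> U a p) = cut_norm (\<lambda>p. pullback \<psi> U a p - W a p)"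
      by (rule cut_norm_minus_commute)
    also have "\<dots> = cut_norm (\<lambda>(x, y). (\<lambda>p. U a p - pullback \<phi> W a p) (\<psi> x, \<psi> y))"
    proof -
      have "(LINT p:A|unit_square. pullback \<psi> U a p - W a p) =
          (LINT p:A|unit_square. (\<lambda>(x, y). (\<lambda>p. U a p - pullback \<phi> W a p) (\<psi> x, \<psi> y)) p)" for A
        unfolding set_lebesgue_integral_def
        by (rule Bochner_Integration.integral_cong)
          (auto simp: space_unit_square pullback_def inv simp del: atLeastAtMost_iff)
      then show ?thesis by (simp add: cut_norm_def)
    qed
    also have "\<dots> \<le> cut_norm (\<lambda>p. U a p - pullback \<phi> W a p)"
      using assms a \<phi> \<psi>
      by (intro cut_norm_comp_le bdd_fun_diff) (auto intro: prob_graphons_bdd pullback_bdd)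
    finally show ?thesis .
  qed
  then have "vec_cut_norm k (\<lambda>a p. W a p - pullback \<psi> U a p) \<le>
      vec_cut_norm k (\<lambda>a p. U a p - pullback \<phi> W a p)"
    unfolding vec_cut_norm_def by (rule sum_mono)
  then show "cut_dist k W U \<le> vec_cut_norm k (\<lambda>a p. U a p - pullback \<phi> W a p)"
    using cut_dist_lower[OF assms(2,1) \<psi>] by linarith
qed

lemma cut_dist_commute:
  "U \<in> prob_graphons k \<Longrightarrow> W \<in> prob_graphons k \<Longrightarrow> cut_dist k U W = cut_dist k W U"
  by (intro antisym cut_dist_sym_le)

lemma cut_dist_triangle:
  assumes "U \<in> prob_graphons k" "V \<in> prob_graphons k" "W \<in> prob_graphons k"
  shows "cut_dist k U W \<le> cut_dist k U V + cut_dist k V W"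
proof -
  have le: "cut_dist k U W \<le> vec_cut_norm k (\<lambda>a p. U a p - pullback \<phi> V a p) +
      vec_cut_norm k (\<lambda>a p. V a p - pullback \<psi> W a p)"
    if \<phi>: "\<phi> \<in> mp_bijections" and \<psi>: "\<psi> \<in> mp_bijections" for \<phi> \<psi>
  proof -
    have c: "(\<lambda>x. \<psi> (\<phi> x)) \<in> mp_bijections" by (rule comp_mp[OF \<phi> \<psi>])
    have "cut_norm (\<lambda>p. U a p - pullback (\<lambda>x. \<psi> (\<phi> x)) W a p) \<le>
        cut_norm (\<lambda>p. U a p - pullback \<phi> V a p) + cut_norm (\<lambda>p. V a p - pullback \<psi> W a p)"
      if a: "a \<in> {1..k}" for a
    proof -
      have "cut_norm (\<lambda>p. U a p - pullback (\<lambda>x. \<psi> (\<phi> x)) W a p) \<le>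
          cut_norm (\<lambda>p. U a p - pullback \<phi> V a p) +
          cut_norm (\<lambda>p. pullback \<phi> V a p - pullback (\<lambda>x. \<psi> (\<phi> x)) W a p)"
        by (intro cut_norm_triangle prob_graphons_bdd[OF assms(1) a]
            pullback_bdd[OF assms(2) a \<phi>] pullback_bdd[OF assms(3) a c])
      also have "(\<lambda>p. pullback \<phi> V a p - pullback (\<lambda>x. \<psi> (\<phi> x)) W a p) =
          (\<lambda>(x, y). (\<lambda>p. V a p - pullback \<psi> W a p) (\<phi> x, \<phi> y))"
        by (auto simp: pullback_def)
      also have "cut_norm \<dots> \<le> cut_norm (\<lambda>p. V a p - pullback \<psi> W a p)"
        by (intro cut_norm_comp_le bdd_fun_diff \<phi> prob_graphons_bdd[OF assms(2) a]
            pullback_bdd[OF assms(3) a \<psi>])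
      finally show ?thesis by simp
    qed
    then have "vec_cut_norm k (\<lambda>a p. U a p - pullback (\<lambda>x. \<psi> (\<phi> x)) W a p) \<le>
        vec_cut_norm k (\<lambda>a p. U a p - pullback \<phi> V a p) +
        vec_cut_norm k (\<lambda>a p. V a p - pullback \<psi> W a p)"
      unfolding vec_cut_norm_def sum.distrib[symmetric] by (rule sum_mono)
    then show ?thesis using cut_dist_lower[OF assms(1,3) c] by linarith
  qed
  have "cut_dist k U W - cut_dist k V W \<le> cut_dist k U V"
  proof (rule cut_dist_greatest)
    fix \<phi> assume \<phi>: "\<phi> \<in> mp_bijections"
    have "cut_dist k U W - vec_cut_norm k (\<lambda>a p. U a p - pullback \<phi> V a p) \<le> cut_dist k V W"
    proof (rule cut_dist_greatest)
      fix \<psi> assume \<psi>: "\<psi> \<in> mp_bijections"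
      show "cut_dist k U W - vec_cut_norm k (\<lambda>a p. U a p - pullback \<phi> V a p) \<le>
          vec_cut_norm k (\<lambda>a p. V a p - pullback \<psi> W a p)"
        using le[OF \<phi> \<psi>] by linarith
    qed
    then show "cut_dist k U W - cut_dist k V W \<le>
        vec_cut_norm k (\<lambda>a p. U a p - pullback \<phi> V a p)" by linarith
  qed
  then show ?thesis by linarith
qed

lemma equiv_cut_rel: "equiv (prob_graphons k) (cut_rel k)"
proof (rule equivI)
  show "cut_rel k \<subseteq> prob_graphons k \<times> prob_graphons k" by (auto simp: cut_rel_def)
  show "refl_on (prob_graphons k) (cut_rel k)"
    by (auto simp: refl_on_def cut_rel_def cut_dist_refl)
  show "sym (cut_rel k)" by (auto simp: sym_def cut_rel_def cut_dist_commute)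
  show "trans (cut_rel k)"
  proof (rule transI)
    fix U V W assume "(U, V) \<in> cut_rel k" "(V, W) \<in> cut_rel k"
    then show "(U, W) \<in> cut_rel k"
      using cut_dist_triangle[of U k V W] cut_dist_nonneg[of U k W] by (auto simp: cut_rel_def)
  qed
qed

lemma graphon_rep:
  assumes "A \<in> graphon_space k"
  shows "graphon_rep A \<in> A" "graphon_rep A \<in> prob_graphons k"
proof -
  have "\<exists>W. W \<in> A"
    using assms in_quotient_imp_non_empty[OF equiv_cut_rel] unfolding graphon_space_def by blast
  then show "graphon_rep A \<in> A" unfolding graphon_rep_def by (rule someI_ex)
  then show "graphon_rep A \<in> prob_graphons k"
    using assms in_quotient_imp_subset[OF equiv_cut_rel] unfolding graphon_space_def by blast
qed

lemma class_dist_eq: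
  assumes "U \<in> prob_graphons k" "W \<in> prob_graphons k"
  shows "class_dist k (graphon_class k U) (graphon_class k W) = cut_dist k U W"
proof -
  have mem: "graphon_class k V \<in> graphon_space k" if "V \<in> prob_graphons k" for V
    using that by (auto simp: graphon_class_def graphon_space_def intro: quotientI)
  have rel: "cut_dist k V (graphon_rep (graphon_class k V)) = 0"
    "cut_dist k (graphon_rep (graphon_class k V)) V = 0"
    "graphon_rep (graphon_class k V) \<in> prob_graphons k" if "V \<in> prob_graphons k" for V
    using graphon_rep[OF mem[OF that]] cut_dist_commute[of V k "graphon_rep (graphon_class k V)"] that
    by (auto simp: graphon_class_def cut_rel_def)
  let ?U = "graphon_rep (graphon_class k U)" and ?W = "graphon_rep (graphon_class k W)"
  have "cut_dist k ?U ?W \<le> cut_dist k U W"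
    using cut_dist_triangle[of ?U k U ?W] cut_dist_triangle[of U k W ?W] assms rel by force
  moreover have "cut_dist k U W \<le> cut_dist k ?U ?W"
    using cut_dist_triangle[of U k ?U W] cut_dist_triangle[of ?U k ?W W] assms rel by force
  ultimately show ?thesis using mem assms by (simp add: class_dist_def)
qed

lemma Metric_space_graphon_space: "Metric_space (graphon_space k) (class_dist k)"
proof
  fix A B show "0 \<le> class_dist k A B" "class_dist k A B = class_dist k B A"
    by (auto simp: class_dist_def graphon_rep intro: cut_dist_nonneg cut_dist_commute)
next
  fix A B assume AB: "A \<in> graphon_space k" "B \<in> graphon_space k"
  have "class_dist k A B = 0 \<longleftrightarrow> (graphon_rep A, graphon_rep B) \<in> cut_rel k"
    using AB by (auto simp: class_dist_def cut_rel_def graphon_rep)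
  also have "\<dots> \<longleftrightarrow> A = B"
    using AB graphon_rep(1) quotient_eq_iff[OF equiv_cut_rel] unfolding graphon_space_def
    by (metis graphon_rep(1) graphon_space_def)
  finally show "class_dist k A B = 0 \<longleftrightarrow> A = B" .
next
  fix A B C assume "A \<in> graphon_space k" "B \<in> graphon_space k" "C \<in> graphon_space k"
  then show "class_dist k A C \<le> class_dist k A B + class_dist k B C"
    by (auto simp: class_dist_def graphon_rep intro: cut_dist_triangle)
qed

lemma empirical_graphon_in:
  assumes "k \<ge> 1" "c \<in> colorings n k"
  shows "empirical_graphon n k c \<in> prob_graphons k"
proof -
  have col: "c {u, v} \<in> {1..k}" if "u \<in> {1..n}" "v \<in> {1..n}" "u \<noteq> v" for u v
    using assms(2) that by (auto simp: colorings_def complete_edges_def PiE_iff)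
  have "(\<lambda>a. empirical_graphon n k c a (x, y)) \<in> prob_simplex k" for x y
  proof (cases "nat \<lceil>real n * x\<rceil> \<in> {1..n} \<and> nat \<lceil>real n * y\<rceil> \<in> {1..n} \<and>
      nat \<lceil>real n * x\<rceil> \<noteq> nat \<lceil>real n * y\<rceil>")
    case True
    then have "c {nat \<lceil>real n * x\<rceil>, nat \<lceil>real n * y\<rceil>} \<in> {1..k}" using col by blast
    then show ?thesis
      using True by (simp add: prob_simplex_def empirical_graphon_def Let_def of_bool_def)
  next
    case False
    then have "(\<lambda>a. empirical_graphon n k c a (x, y)) = (\<lambda>a. 1 / real k)"
      by (auto simp: empirical_graphon_def Let_def)
    then show ?thesis using assms(1) by (simp add: prob_simplex_def)
  qed
  moreover have "empirical_graphon n k c a (x, y) = empirical_graphon n k c a (y, x)" for a x y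
    by (auto simp: empirical_graphon_def Let_def insert_commute)
  moreover have "empirical_graphon n k c a \<in> borel_measurable unit_square" for a
  proof -
    define b where "b x = nat \<lceil>real n * x\<rceil>" for x :: real
    define g where "g = (\<lambda>(u, v). if u \<in> {1..n} \<and> v \<in> {1..n} \<and> u \<noteq> v
      then of_bool (c {u, v} = a) else 1 / real k)"
    have b: "b \<in> unit_interval \<rightarrow>\<^sub>M count_space UNIV"
      unfolding b_def by (rule measurable_restrict_space1) simp
    have "(\<lambda>p. (b (fst p), b (snd p))) \<in> unit_square \<rightarrow>\<^sub>M count_space UNIV \<Otimes>\<^sub>M count_space UNIV"
      by (intro measurable_Pair measurable_compose[OF measurable_fst b]
          measurable_compose[OF measurable_snd b])
    then have "(\<lambda>p. (b (fst p), b (snd p))) \<in> unit_square \<rightarrow>\<^sub>M count_space (UNIV \<times> UNIV)"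
      by (simp only: pair_measure_countable countableI_type)
    then have "(\<lambda>p. g (b (fst p), b (snd p))) \<in> borel_measurable unit_square"
      by (rule measurable_compose) simp
    moreover have "(\<lambda>p. g (b (fst p), b (snd p))) = empirical_graphon n k c a"
      by (rule ext) (simp only: g_def b_def empirical_graphon_def Let_def split_beta fst_conv snd_conv)
    ultimately show ?thesis by (simp only:)
  qed
  ultimately show ?thesis by (simp add: prob_graphons_def)
qed

end

theory Submission
  imports Defs
begin

text \<open>By compactness of the graphon space it suffices to control the Gibbs weight of small balls.
  For the upper bound, the number of colourings near \<open>W\<close> is at most \<open>exp (n\<^sup>2 (\<epsilon> - I W / 2))\<close>: pairing
  the empirical graphon with a step function close to \<open>ln W\<close>, pulled back along the aligning
  bijection, gives exponential weights whose sum over all colourings is at most one, and on a fixed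
  grid the bijections matter only through \<open>exp (o (n\<^sup>2))\<close> overlap matrices. For the lower bound on the
  partition function, the Gibbs variational principle is applied to independent edge colours with
  laws the block averages of \<open>W\<close>: their entropy is large by concavity, and their empirical graphon is
  close to \<open>W\<close> by an exponential moment bound over all pairs of vertex sets. Comparing both bounds on a
  finite cover by balls yields a maximiser as well as the exponential decay away from the maximisers.

  Compactness is total boundedness, from a greedy cut decomposition and sorting the blocks by their
  labels, together with completeness, where the densities of weak limits come from Radon--Nikodym.\<close>

section \<open>Label functions and step functions\<close>

text \<open>The obstacle is the infimum over bijections in the cut distance: a ball around
  \<open>W\<close> is a union over uncountably many rearrangements, each with its own exponential
  weights. A rearrangement enters these weights only through the masses that a rearranged grid of
  \<open>q\<close> blocks puts into the \<open>n\<close> vertex blocks, and \<open>q\<close> is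
  fixed before \<open>n\<close> grows; once the masses are rounded, the union costs a factor
  \<open>exp (O (n))\<close>. The logarithm of \<open>W\<close> has to give way to a bounded step
  function because the cut norm controls rectangle integrals only: a step function on
  \<open>q\<close> blocks bounded by \<open>G\<close> feels a cut-norm error with the factor
  \<open>(q + 1)^2 * G\<close>. The radius of the ball is therefore chosen after \<open>q\<close>
  and \<open>G\<close> and depends on \<open>W\<close>; compactness supplies the missing uniformity.
  The factor 1/2 before the entropy arises because the unit square sees each edge twice, once per
  orientation, while the \<open>n\<close> diagonal blocks among \<open>n^2\<close> are negligible.
  In the lower bound the \<open>4 ^ n\<close> pairs of vertex sets lose against deviation
  probabilities of order \<open>exp (- c * n^2)\<close>.\<close>

abbreviation leb :: "real set \<Rightarrow> real" where
  "leb \<equiv> measure unit_interval"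

definition block :: "nat \<Rightarrow> real \<Rightarrow> nat" where
  "block n x = nat \<lceil>real n * x\<rceil>"

text \<open>The point \<open>0\<close> is a block of its own, with index \<open>0\<close> and measure zero; the blocks of
  length \<open>1/n\<close> are those of index \<open>1\<close> to \<open>n\<close>.\<close>

definition cell :: "(real \<Rightarrow> nat) \<Rightarrow> nat \<Rightarrow> real set" where
  "cell b i = {x\<in>{0..1}. b x = i}"

definition labelling :: "nat \<Rightarrow> (real \<Rightarrow> nat) \<Rightarrow> bool" where
  "labelling n b \<longleftrightarrow> b \<in> unit_interval \<rightarrow>\<^sub>M count_space UNIV \<and> (\<forall>x\<in>{0..1}. b x \<le> n)"

definition step :: "(real \<Rightarrow> nat) \<Rightarrow> (nat \<Rightarrow> nat \<Rightarrow> real) \<Rightarrow> real \<times> real \<Rightarrow> real" where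
  "step b A = (\<lambda>(x, y). A (b x) (b y))"

interpretation unit_interval: prob_space unit_interval
  by (rule prob_space_unit_interval)

interpretation unit_square: prob_space unit_square
  by (rule prob_space_unit_square)

interpretation unit_pair: pair_prob_space unit_interval unit_interval ..

section \<open>Bounded measurable functions and step functions on the square\<close>

lemma bdd_funI:
  assumes "F \<in> borel_measurable unit_square" "\<And>x y. x \<in> {0..1} \<Longrightarrow> y \<in> {0..1} \<Longrightarrow> \<bar>F (x, y)\<bar> \<le> B"
  shows "bdd_fun F"
  using assms unfolding bdd_fun_def by blast

lemma bdd_funE:
  assumes "bdd_fun F"
  obtains B where "B \<ge> 0" "\<And>x y. x \<in> {0..1} \<Longrightarrow> y \<in> {0..1} \<Longrightarrow> \<bar>F (x, y)\<bar> \<le> B"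
proof -
  obtain B where B: "\<forall>p\<in>{0..1}\<times>{0..1}. \<bar>F p\<bar> \<le> B"
    using assms unfolding bdd_fun_def by blast
  then have "\<bar>F (0, 0)\<bar> \<le> B" by (rule bspec) auto
  then have "B \<ge> 0" by linarith
  then show ?thesis using B by (intro that[of B]) auto
qed

lemma bdd_fun_measurable [measurable_dest]: "bdd_fun F \<Longrightarrow> F \<in> borel_measurable unit_square"
  by (simp add: bdd_fun_def)

lemma bdd_fun_mult:
  assumes F: "bdd_fun F" and G: "bdd_fun G" shows "bdd_fun (\<lambda>p. F p * G p)"
proof -
  obtain A where A: "A \<ge> 0" "\<And>x y. x \<in> {0..1} \<Longrightarrow> y \<in> {0..1} \<Longrightarrow> \<bar>F (x, y)\<bar> \<le> A"
    using bdd_funE[OF F] by blast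
  obtain B where B: "B \<ge> 0" "\<And>x y. x \<in> {0..1} \<Longrightarrow> y \<in> {0..1} \<Longrightarrow> \<bar>G (x, y)\<bar> \<le> B"
    using bdd_funE[OF G] by blast
  have "(\<lambda>p. F p * G p) \<in> borel_measurable unit_square"
    using F G unfolding bdd_fun_def by (intro borel_measurable_times) auto
  then show ?thesis
    by (rule bdd_funI[where B="A * B"]) (unfold abs_mult, intro mult_mono A B, auto simp: A)
qed

lemma bdd_fun_const: "bdd_fun (\<lambda>_. c)"
  by (rule bdd_funI[where B="\<bar>c\<bar>"]) auto

lemma bdd_fun_cmult: "bdd_fun F \<Longrightarrow> bdd_fun (\<lambda>p. c * F p)"
  by (rule bdd_fun_mult[OF bdd_fun_const])

lemma bdd_fun_add: "bdd_fun F \<Longrightarrow> bdd_fun G \<Longrightarrow> bdd_fun (\<lambda>p. F p + G p)"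
  using bdd_fun_diff[of F "\<lambda>p. - 1 * G p"] bdd_fun_cmult[of G "-1"] by simp

lemma bdd_fun_sum: "(\<And>i. i \<in> I \<Longrightarrow> bdd_fun (F i)) \<Longrightarrow> bdd_fun (\<lambda>p. \<Sum>i\<in>I. F i p)"
proof (induction I rule: infinite_finite_induct)
  case (insert x I)
  then show ?case by (auto intro!: bdd_fun_add)
qed (simp_all add: bdd_fun_const)

lemma bdd_fun_abs: "bdd_fun F \<Longrightarrow> bdd_fun (\<lambda>p. \<bar>F p\<bar>)"
  unfolding bdd_fun_def by auto

lemma bdd_fun_indicator:
  "E \<in> sets unit_square \<Longrightarrow> bdd_fun (indicator E)"
  by (rule bdd_funI[where B=1]) (auto simp: indicator_def)

lemma cell_sets: "labelling n b \<Longrightarrow> cell b i \<in> sets unit_interval"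
proof -
  assume "labelling n b"
  then have "b -` {i} \<inter> space unit_interval \<in> sets unit_interval"
    unfolding labelling_def by (intro measurable_sets[where A="count_space UNIV"]) auto
  moreover have "b -` {i} \<inter> space unit_interval = cell b i" by (auto simp: cell_def)
  ultimately show ?thesis by simp
qed

lemma rect_sets:
  "S \<in> sets unit_interval \<Longrightarrow> T \<in> sets unit_interval \<Longrightarrow> S \<times> T \<in> sets unit_square"
  by (rule pair_measureI)

lemma sets_unit_intervalD: "S \<in> sets unit_interval \<Longrightarrow> S \<subseteq> {0..1}"
  using sets.sets_into_space[of S unit_interval] by simp

lemma step_eq_sum:
  assumes b: "labelling n b" and p: "p \<in> {0..1} \<times> {0..1}"
  shows "step b A p = (\<Sum>i\<le>n. \<Sum>j\<le>n. A i j * indicator (cell b i \<times> cell b j) p)"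
proof -
  obtain x y where xy: "p = (x, y)" "x \<in> {0..1}" "y \<in> {0..1}" using p by auto
  have le: "b x \<le> n" "b y \<le> n" using b xy by (auto simp: labelling_def)
  have ind: "indicator (cell b i \<times> cell b j) p = of_bool (i = b x) * (of_bool (j = b y) :: real)"
      for i j
    using xy by (auto simp: cell_def indicator_def)
  have inner: "(\<Sum>j\<le>n. A i j * indicator (cell b i \<times> cell b j) p) = of_bool (i = b x) * A i (b y)"
      for i
  proof -
    have "(\<Sum>j\<le>n. A i j * indicator (cell b i \<times> cell b j) p) =
        (\<Sum>j\<le>n. if j = b y then of_bool (i = b x) * A i j else 0)"
      unfolding ind by (intro sum.cong) auto
    then show ?thesis using le by simp
  qed
  have "(\<Sum>i\<le>n. \<Sum>j\<le>n. A i j * indicator (cell b i \<times> cell b j) p) =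
      (\<Sum>i\<le>n. if i = b x then A i (b y) else 0)"
    unfolding inner by (intro sum.cong) auto
  also have "\<dots> = A (b x) (b y)" using le by simp
  finally show ?thesis by (simp add: step_def xy)
qed

lemma bdd_fun_step: assumes b: "labelling n b" shows "bdd_fun (step b A)"
proof -
  have m: "bdd_fun (\<lambda>p. \<Sum>i\<le>n. \<Sum>j\<le>n. A i j * indicator (cell b i \<times> cell b j) p)"
    by (intro bdd_fun_sum bdd_fun_cmult bdd_fun_indicator rect_sets cell_sets[OF b])
  have eq: "(\<Sum>i\<le>n. \<Sum>j\<le>n. A i j * indicator (cell b i \<times> cell b j) p) = step b A p"
    if "p \<in> space unit_square" for p
    using step_eq_sum[OF b, of p A] that unfolding space_unit_square by simp
  obtain B where B: "\<forall>p\<in>{0..1}\<times>{0..1}. \<bar>\<Sum>i\<le>n. \<Sum>j\<le>n. A i j * indicator (cell b i \<times> cell b j) p\<bar> \<le> B"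
    using m unfolding bdd_fun_def by blast
  have "step b A \<in> borel_measurable unit_square"
    by (subst measurable_cong[OF eq[symmetric]]) (use m in \<open>auto simp: bdd_fun_def\<close>)
  moreover have "\<bar>step b A p\<bar> \<le> B" if "p \<in> {0..1}\<times>{0..1}" for p
    using bspec[OF B that] eq[of p] that unfolding space_unit_square by simp
  ultimately show ?thesis unfolding bdd_fun_def by blast
qed

lemma set_integral_indicator: "(LINT p:E|M. f p) = (LINT p|M. f p * indicator E p)"
    for f :: "_ \<Rightarrow> real"
  by (simp add: set_lebesgue_integral_def mult.commute)

text \<open>This is how the cut norm gets a grip on pairings: only finitely many rectangle integrals
  of \<open>f\<close> enter, with the step values as coefficients.\<close>

lemma integral_mult_step:
  assumes f: "bdd_fun f" and b: "labelling n b"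
  shows "(LINT p|unit_square. f p * step b A p) =
    (\<Sum>i\<le>n. \<Sum>j\<le>n. A i j * (LINT p:cell b i \<times> cell b j|unit_square. f p))"
proof -
  have int: "integrable unit_square (\<lambda>p. A i j * (f p * indicator (cell b i \<times> cell b j) p))" for i j
    by (intro bdd_fun_integrable bdd_fun_cmult bdd_fun_mult f bdd_fun_indicator rect_sets
        cell_sets[OF b])
  have "(LINT p|unit_square. f p * step b A p) =
    (LINT p|unit_square. (\<Sum>i\<le>n. \<Sum>j\<le>n. A i j * (f p * indicator (cell b i \<times> cell b j) p)))"
    by (intro Bochner_Integration.integral_cong refl)
      (simp only: step_eq_sum[OF b] space_unit_square sum_distrib_left mult_ac)
  also have "\<dots> = (\<Sum>i\<le>n. \<Sum>j\<le>n. LINT p|unit_square.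
      A i j * (f p * indicator (cell b i \<times> cell b j) p))"
    by (subst Bochner_Integration.integral_sum; (intro Bochner_Integration.integrable_sum int)?)
      (intro sum.cong refl Bochner_Integration.integral_sum int)
  finally show ?thesis by (simp add: set_integral_indicator)
qed

lemma measure_rect:
  assumes "S \<in> sets unit_interval" "T \<in> sets unit_interval"
  shows "measure unit_square (S \<times> T) = leb S * leb T"
proof -
  have "emeasure unit_square (S \<times> T) = emeasure unit_interval S * emeasure unit_interval T"
    using assms by (rule unit_interval.emeasure_pair_measure_Times)
  then show ?thesis by (simp add: measure_def enn2real_mult)
qed

lemma integral_indicator_sq: "E \<in> sets unit_square \<Longrightarrow>
    (LINT p|unit_square. indicator E p) = measure unit_square E"
  by (subst Bochner_Integration.integral_indicator)
      (auto simp: Int_absorb2 dest: sets.sets_into_space)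

lemma set_integral_step:
  assumes b: "labelling n b" and S: "S \<in> sets unit_interval" and T: "T \<in> sets unit_interval"
  shows "(LINT p:S\<times>T|unit_square. step b A p) =
    (\<Sum>i\<le>n. \<Sum>j\<le>n. A i j * (leb (S \<inter> cell b i) * leb (T \<inter> cell b j)))"
proof -
  have rect: "(LINT p:cell b i \<times> cell b j|unit_square. indicator (S\<times>T) p) =
      leb (S \<inter> cell b i) * leb (T \<inter> cell b j)" for i j
  proof -
    have "(LINT p:cell b i \<times> cell b j|unit_square. indicator (S\<times>T) p) =
       (LINT p|unit_square. indicator ((S \<inter> cell b i) \<times> (T \<inter> cell b j)) p)"
      unfolding set_lebesgue_integral_def
      by (intro Bochner_Integration.integral_cong refl) (auto simp: indicator_def)
    also have "\<dots> = measure unit_square ((S \<inter> cell b i) \<times> (T \<inter> cell b j))"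
      by (intro integral_indicator_sq rect_sets sets.Int S T cell_sets[OF b])
    also have "\<dots> = leb (S \<inter> cell b i) * leb (T \<inter> cell b j)"
      by (intro measure_rect sets.Int S T cell_sets[OF b])
    finally show ?thesis .
  qed
  have "(LINT p:S\<times>T|unit_square. step b A p) = (LINT p|unit_square. indicator (S\<times>T) p * step b A p)"
    by (simp add: set_lebesgue_integral_def)
  also have "\<dots> = (\<Sum>i\<le>n. \<Sum>j\<le>n. A i j * (LINT p:cell b i \<times> cell b j|unit_square. indicator (S\<times>T) p))"
    by (intro integral_mult_step bdd_fun_indicator rect_sets S T b)
  finally show ?thesis unfolding rect .
qed

lemma cut_norm_le_L1:
  assumes F: "bdd_fun F" shows "cut_norm F \<le> (LINT p|unit_square. \<bar>F p\<bar>)"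
proof (rule cut_norm_least)
  fix S T assume "S \<in> sets unit_interval" "T \<in> sets unit_interval"
  note E = rect_sets[OF this]
  have "\<bar>LINT p:S\<times>T|unit_square. F p\<bar> \<le> (LINT p|unit_square. \<bar>F p * indicator (S\<times>T) p\<bar>)"
    unfolding set_integral_indicator by (rule integral_abs_bound)
  also have "\<dots> \<le> (LINT p|unit_square. \<bar>F p\<bar>)"
    by (intro integral_mono bdd_fun_integrable bdd_fun_abs bdd_fun_mult F bdd_fun_indicator E)
      (auto simp: indicator_def)
  finally show "\<bar>LINT p:S\<times>T|unit_square. F p\<bar> \<le> (LINT p|unit_square. \<bar>F p\<bar>)" .
qed

lemma leb_sum_cells:
  assumes b: "labelling n b" and S: "S \<in> sets unit_interval"
  shows "(\<Sum>i\<le>n. leb (S \<inter> cell b i)) = leb S"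
proof -
  have "leb (\<Union>i\<in>{..n}. S \<inter> cell b i) = (\<Sum>i\<le>n. leb (S \<inter> cell b i))"
    using S cell_sets[OF b]
    by (intro unit_interval.finite_measure_finite_Union)
        (auto simp: disjoint_family_on_def cell_def)
  moreover have "(\<Union>i\<in>{..n}. S \<inter> cell b i) = S"
    using b sets_unit_intervalD[OF S] by (fastforce simp: labelling_def cell_def)
  ultimately show ?thesis by simp
qed

section \<open>Uniform grid blocks\<close>

lemma labelling_block: "labelling n (block n)"
proof -
  have "block n \<in> unit_interval \<rightarrow>\<^sub>M count_space UNIV"
    unfolding block_def by (rule measurable_restrict_space1) simp
  moreover have "block n x \<le> n" if "x \<in> {0..1}" for x
  proof -
    have "real n * x \<le> real n" using that by (simp add: mult_left_le)
    then show ?thesis unfolding block_def by linarith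
  qed
  ultimately show ?thesis by (simp add: labelling_def)
qed

lemma block_mono: "x \<le> y \<Longrightarrow> block n x \<le> block n y"
  unfolding block_def by (intro nat_mono ceiling_mono mult_left_mono) auto

lemma cell_block:
  assumes "u \<in> {1..n}"
  shows "cell (block n) u = {(real u - 1) / real n <.. real u / real n}"
proof -
  have n: "real n > 0" using assms by auto
  have "block n x = u \<longleftrightarrow> real u - 1 < real n * x \<and> real n * x \<le> real u" for x
    using assms unfolding block_def by (simp add: nat_eq_iff ceiling_eq_iff)
  moreover have "x \<in> {0..1}" if "real u - 1 < real n * x" "real n * x \<le> real u" for x
  proof -
    have "real n * x > 0" using that assms by auto
    then have "x > 0" using n zero_less_mult_pos by blast
    moreover have "real n * x \<le> real n * 1" using that assms
      by (simp add: order.trans[of _ "real u"])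
    then have "x \<le> 1" using n by (subst (asm) mult_le_cancel_left_pos) auto
    ultimately show ?thesis by simp
  qed
  ultimately have "x \<in> cell (block n) u \<longleftrightarrow> real u - 1 < real n * x \<and> real n * x \<le> real u" for x
    by (auto simp: cell_def simp del: atLeastAtMost_iff)
  moreover have "(real u - 1) / real n < x \<longleftrightarrow> real u - 1 < real n * x"
    "x \<le> real u / real n \<longleftrightarrow> real n * x \<le> real u" for x
    using n by (simp_all add: pos_divide_less_eq pos_le_divide_eq mult.commute)
  ultimately show ?thesis by (intro set_eqI) (simp only: greaterThanAtMost_iff)
qed

lemma leb_eq: "S \<subseteq> {0..1} \<Longrightarrow> leb S = measure lborel S"
  by (simp add: measure_restrict_space)

lemma leb_cell_block:
  assumes "n \<ge> 1"
  shows "leb (cell (block n) u) = (if u \<in> {1..n} then 1 / real n else 0)"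
proof (cases "u \<in> {1..n}")
  case True
  have "cell (block n) u \<subseteq> {0..1}" by (auto simp: cell_def)
  then have "leb (cell (block n) u) = measure lborel {(real u - 1) / real n <.. real u / real n}"
    by (simp add: leb_eq flip: cell_block[OF True])
  also have "\<dots> = 1 / real n"
    by (subst measure_lborel_Ioc) (auto simp: divide_right_mono diff_divide_distrib)
  finally show ?thesis using True by simp
next
  case False
  \<comment> \<open>For \<open>u > n\<close> the cell is empty, for \<open>u = 0\<close> it is the
    point 0; both are null.\<close>
  have "cell (block n) u \<subseteq> {0}"
  proof
    fix x assume "x \<in> cell (block n) u"
    then have x: "x \<in> {0..1}" "block n x = u" by (auto simp: cell_def)
    with labelling_block[of n] have "u \<le> n" by (auto simp: labelling_def)
    with False have "u = 0" by auto
    then have "real n * x \<le> 0" using x by (simp add: block_def)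
    then show "x \<in> {0}" using x assms by (auto simp: mult_le_0_iff)
  qed
  then have "cell (block n) u = {} \<or> cell (block n) u = {0}" by blast
  moreover have "leb {0} = 0" by (subst leb_eq) auto
  ultimately have "leb (cell (block n) u) = 0" by (elim disjE) (simp_all only: measure_empty)
  then show ?thesis using False by simp
qed

lemma block_in: assumes "n \<ge> 1" "x \<in> {0<..1}" shows "block n x \<in> {1..n}"
proof -
  have "real n * x > 0" using assms by simp
  moreover have "block n x \<le> n" using labelling_block[of n] assms by (auto simp: labelling_def)
  ultimately show ?thesis by (simp add: block_def) linarith
qed

section \<open>Convergence of block averages\<close>

text \<open>The factor is the reciprocal of the area of a grid block, so this is a mean for indices
  in \<open>{1..n}\<close>; on the null blocks of index 0 the value is 0.\<close>

definition avg :: "nat \<Rightarrow> (real \<times> real \<Rightarrow> real) \<Rightarrow> nat \<Rightarrow> nat \<Rightarrow> real" where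
  "avg n f u v = real n ^ 2 * (LINT p:cell (block n) u \<times> cell (block n) v|unit_square. f p)"

text \<open>The block means form the conditional expectation of \<open>f\<close> on the grid, and
  this is its \<open>L^1\<close> error.\<close>

definition avg_err :: "nat \<Rightarrow> (real \<times> real \<Rightarrow> real) \<Rightarrow> real" where
  "avg_err n f = (LINT p|unit_square. \<bar>step (block n) (avg n f) p - f p\<bar>)"

lemma cell_rect_sets: "labelling n b \<Longrightarrow> cell b i \<times> cell b j \<in> sets unit_square"
  by (intro rect_sets cell_sets)

lemma bdd_fun_set_integral:
  "bdd_fun f \<Longrightarrow> E \<in> sets unit_square \<Longrightarrow> set_integrable unit_square E f"
  unfolding set_integrable_def by (intro integrable_mult_indicator bdd_fun_integrable)

lemma avg_add:
  assumes "bdd_fun f" "bdd_fun g"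
  shows "avg n (\<lambda>p. f p + g p) u v = avg n f u v + avg n g u v"
  unfolding avg_def
  by (subst set_integral_add) (auto intro!: bdd_fun_set_integral assms cell_rect_sets
      labelling_block simp: distrib_left)

lemma avg_cmult: "avg n (\<lambda>p. c * f p) u v = c * avg n f u v"
  unfolding avg_def by (simp add: mult_ac)

lemma avg_diff:
  assumes "bdd_fun f" "bdd_fun g"
  shows "avg n (\<lambda>p. f p - g p) u v = avg n f u v - avg n g u v"
  unfolding avg_def
  by (subst set_integral_diff) (auto intro!: bdd_fun_set_integral assms cell_rect_sets
      labelling_block simp: right_diff_distrib)

lemma bdd_fun_step_block: "bdd_fun (step (block n) A)"
  by (rule bdd_fun_step) (rule labelling_block)

lemma integral_step:
  assumes b: "labelling n b"
  shows "(LINT p|unit_square. step b A p) = (\<Sum>i\<le>n. \<Sum>j\<le>n. A i j * (leb (cell b i) * leb (cell b j)))"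
proof -
  have "(LINT p|unit_square. step b A p) = (LINT p|unit_square. 1 * step b A p)" by simp
  also have "\<dots> = (\<Sum>i\<le>n. \<Sum>j\<le>n. A i j * (LINT p:cell b i \<times> cell b j|unit_square. 1))"
    by (rule integral_mult_step[OF bdd_fun_const b])
  finally show ?thesis
    using integral_indicator_sq[OF cell_rect_sets[OF b]]
        measure_rect[OF cell_sets[OF b] cell_sets[OF b]]
    by (simp add: set_lebesgue_integral_def)
qed

lemma integral_cells:
  assumes f: "bdd_fun f" and b: "labelling n b"
  shows "(\<Sum>i\<le>n. \<Sum>j\<le>n. LINT p:cell b i \<times> cell b j|unit_square. f p) = (LINT p|unit_square. f p)"
  using integral_mult_step[OF f b, of "\<lambda>_ _. 1"] by (simp add: step_def case_prod_unfold)

lemma abs_set_integral_le: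
  assumes "bdd_fun f" "E \<in> sets unit_square"
  shows "\<bar>LINT p:E|unit_square. f p\<bar> \<le> (LINT p:E|unit_square. \<bar>f p\<bar>)"
proof -
  have "\<bar>LINT p:E|unit_square. f p\<bar> \<le> (LINT p|unit_square. \<bar>indicator E p *\<^sub>R f p\<bar>)"
    unfolding set_lebesgue_integral_def by (rule integral_abs_bound)
  then show ?thesis by (simp add: set_lebesgue_integral_def abs_mult)
qed

lemma sum_sum_mono:
  "(\<And>i j. F i j \<le> (G i j :: real)) \<Longrightarrow> (\<Sum>i\<in>I. \<Sum>j\<in>J. F i j) \<le> (\<Sum>i\<in>I. \<Sum>j\<in>J. G i j)"
  by (intro sum_mono)

text \<open>Averaging contracts \<open>L^1\<close> block by block: the mean of \<open>f\<close> over
  a block times its area is in absolute value at most the integral of the absolute value there. This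
  makes the averaging error stable under \<open>L^1\<close> approximation.\<close>

lemma step_avg_L1:
  assumes n: "n \<ge> 1" and f: "bdd_fun f"
  shows "(LINT p|unit_square. \<bar>step (block n) (avg n f) p\<bar>) \<le> (LINT p|unit_square. \<bar>f p\<bar>)"
proof -
  let ?b = "block n"
  have b: "labelling n ?b" by (rule labelling_block)
  have "(LINT p|unit_square. \<bar>step ?b (avg n f) p\<bar>) =
      (LINT p|unit_square. step ?b (\<lambda>i j. \<bar>avg n f i j\<bar>) p)"
    by (simp add: step_def case_prod_unfold)
  also have "\<dots> = (\<Sum>i\<le>n. \<Sum>j\<le>n. \<bar>avg n f i j\<bar> * (leb (cell ?b i) * leb (cell ?b j)))"
    by (rule integral_step[OF b])
  also have "\<dots> \<le> (\<Sum>i\<le>n. \<Sum>j\<le>n. LINT p:cell ?b i \<times> cell ?b j|unit_square. \<bar>f p\<bar>)"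
  proof (rule sum_sum_mono)
    fix i j
    have le: "\<bar>LINT p:cell ?b i \<times> cell ?b j|unit_square. f p\<bar> \<le>
        (LINT p:cell ?b i \<times> cell ?b j|unit_square. \<bar>f p\<bar>)"
      by (intro abs_set_integral_le f cell_rect_sets[OF b])
    show "\<bar>avg n f i j\<bar> * (leb (cell ?b i) * leb (cell ?b j)) \<le>
        (LINT p:cell ?b i \<times> cell ?b j|unit_square. \<bar>f p\<bar>)"
      using le n unfolding leb_cell_block[OF n] avg_def
      by (auto simp: abs_mult power2_eq_square)
  qed
  also have "\<dots> = (LINT p|unit_square. \<bar>f p\<bar>)"
    by (rule integral_cells[OF bdd_fun_abs[OF f] b])
  finally show ?thesis .
qed

lemma avg_err_nonneg: "0 \<le> avg_err n f"
  unfolding avg_err_def by (rule Bochner_Integration.integral_nonneg) simp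

lemma avg_err_add:
  assumes f: "bdd_fun f" and g: "bdd_fun g"
  shows "avg_err n (\<lambda>p. f p + g p) \<le> avg_err n f + avg_err n g"
proof -
  have "avg_err n (\<lambda>p. f p + g p) \<le> (LINT p|unit_square. \<bar>step (block n) (avg n f) p - f p\<bar> +
      \<bar>step (block n) (avg n g) p - g p\<bar>)"
    unfolding avg_err_def
    by (intro integral_mono bdd_fun_integrable bdd_fun_abs bdd_fun_add bdd_fun_diff
        bdd_fun_step_block f g)
      (auto simp: step_def avg_add[OF f g])
  also have "\<dots> = avg_err n f + avg_err n g"
    unfolding avg_err_def
    by (intro Bochner_Integration.integral_add bdd_fun_integrable bdd_fun_abs bdd_fun_diff
        bdd_fun_step_block f g)
  finally show ?thesis .
qed

lemma avg_err_cmult: "avg_err n (\<lambda>p. c * f p) = \<bar>c\<bar> * avg_err n f"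
  unfolding avg_err_def
  by (simp add: step_def case_prod_unfold avg_cmult abs_mult flip: right_diff_distrib)

text \<open>Subadditivity with \<open>f = g + (f - g)\<close>. The averaging error of
  \<open>f - g\<close> is at most its \<open>L^1\<close> norm plus that of its block means, which is
  where the factor 2 comes from.\<close>

lemma avg_err_close:
  assumes n: "n \<ge> 1" and f: "bdd_fun f" and g: "bdd_fun g"
  shows "avg_err n f \<le> avg_err n g + 2 * (LINT p|unit_square. \<bar>f p - g p\<bar>)"
proof -
  have fg: "bdd_fun (\<lambda>p. f p - g p)" by (rule bdd_fun_diff[OF f g])
  have "avg_err n (\<lambda>p. f p - g p) \<le> (LINT p|unit_square.
      \<bar>step (block n) (avg n (\<lambda>p. f p - g p)) p\<bar> + \<bar>f p - g p\<bar>)"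
    unfolding avg_err_def
    by (intro integral_mono bdd_fun_integrable bdd_fun_abs bdd_fun_add bdd_fun_diff
        bdd_fun_step_block f g)
      auto
  also have "\<dots> = (LINT p|unit_square. \<bar>step (block n) (avg n (\<lambda>p. f p - g p)) p\<bar>) +
      (LINT p|unit_square. \<bar>f p - g p\<bar>)"
    by (intro Bochner_Integration.integral_add bdd_fun_integrable bdd_fun_abs bdd_fun_diff
        bdd_fun_step_block f g)
  also have "\<dots> \<le> 2 * (LINT p|unit_square. \<bar>f p - g p\<bar>)"
    using step_avg_L1[OF n fg] by simp
  finally show ?thesis using avg_err_add[OF g fg, of n] by simp
qed

text \<open>The property is stable under linear combinations and \<open>L^1\<close> limits, which is
  what a Dynkin-class argument starting from rectangles requires.\<close>

definition avg_converges :: "(real \<times> real \<Rightarrow> real) \<Rightarrow> bool" where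
  "avg_converges f \<longleftrightarrow> (\<lambda>n. avg_err n f) \<longlonglongrightarrow> 0"

lemma avg_converges_add:
  assumes "bdd_fun f" "bdd_fun g" "avg_converges f" "avg_converges g"
  shows "avg_converges (\<lambda>p. f p + g p)"
proof -
  have "(\<lambda>n. avg_err n f + avg_err n g) \<longlonglongrightarrow> 0"
    using tendsto_add[of "\<lambda>n. avg_err n f" 0 _ "\<lambda>n. avg_err n g" 0] assms
    by (simp add: avg_converges_def)
  note lim = this
  show ?thesis unfolding avg_converges_def
    by (rule tendsto_sandwich[OF _ _ tendsto_const lim])
      (auto intro!: always_eventually avg_err_nonneg avg_err_add assms)
qed

lemma avg_converges_cmult: "avg_converges f \<Longrightarrow> avg_converges (\<lambda>p. c * f p)"
  unfolding avg_converges_def avg_err_cmult by (rule tendsto_mult_right_zero)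

lemma avg_converges_zero: "avg_converges (\<lambda>p. 0)"
  unfolding avg_converges_def avg_err_def avg_def step_def by (simp add: case_prod_unfold)

lemma avg_converges_sum:
  "finite I \<Longrightarrow> (\<And>i. i \<in> I \<Longrightarrow> bdd_fun (F i)) \<Longrightarrow> (\<And>i. i \<in> I \<Longrightarrow> avg_converges (F i)) \<Longrightarrow>
      avg_converges (\<lambda>p. \<Sum>i\<in>I. F i p)"
proof (induction I rule: finite_induct)
  case (insert x I)
  then show ?case by (auto intro!: avg_converges_add bdd_fun_sum)
qed (simp add: avg_converges_zero)

lemma avg_converges_close:
  assumes f: "bdd_fun f"
    and g: "\<And>e. e > 0 \<Longrightarrow> \<exists>g. bdd_fun g \<and> avg_converges g \<and> (LINT p|unit_square. \<bar>f p - g p\<bar>) \<le> e"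
  shows "avg_converges f"
  unfolding avg_converges_def
proof (rule LIMSEQ_I)
  fix e :: real assume e: "e > 0"
  \<comment> \<open>A quarter suffices because the \<open>L^1\<close> distance enters
    \<open>avg_err_close\<close> twice; the other half of \<open>e\<close> is left for
    \<open>g\<close>.\<close>
  obtain g where g: "bdd_fun g" "avg_converges g" "(LINT p|unit_square. \<bar>f p - g p\<bar>) \<le> e / 4"
    using g[of "e/4"] e by auto
  obtain N where N: "\<And>n. n \<ge> N \<Longrightarrow> norm (avg_err n g - 0) < e / 2"
    using LIMSEQ_D[of "\<lambda>n. avg_err n g" 0 "e/2"] g(2) e unfolding avg_converges_def by auto
  show "\<exists>no. \<forall>n\<ge>no. norm (avg_err n f - 0) < e"
  proof (intro exI[of _ "max 1 N"] allI impI)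
    fix n assume n: "n \<ge> max 1 N"
    then have "avg_err n f \<le> avg_err n g + 2 * (LINT p|unit_square. \<bar>f p - g p\<bar>)"
      by (intro avg_err_close f g) auto
    moreover have "avg_err n g < e / 2" using N[of n] n by auto
    ultimately show "norm (avg_err n f - 0) < e" using g(3) avg_err_nonneg[of n f] by simp
  qed
qed

lemma avg_converges_cong:
  assumes f: "bdd_fun f" and g: "bdd_fun g" "avg_converges g"
      and eq: "\<And>p. p \<in> space unit_square \<Longrightarrow> f p = g p"
  shows "avg_converges f"
proof (rule avg_converges_close[OF f])
  have "(LINT p|unit_square. \<bar>f p - g p\<bar>) = (LINT p|unit_square. 0)"
    by (rule Bochner_Integration.integral_cong) (auto simp: eq)
  then show "\<exists>g. bdd_fun g \<and> avg_converges g \<and> (LINT p|unit_square. \<bar>f p - g p\<bar>) \<le> e" if "e > 0"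
      for e
    using g that by (intro exI[of _ g]) auto
qed

section \<open>From rectangles of initial segments to all measurable functions\<close>

definition initial :: "real \<Rightarrow> real set" where "initial a = {0..1} \<inter> {..a}"

lemma initial_sets: "initial a \<in> sets unit_interval"
  by (auto simp: initial_def sets_restrict_space)

text \<open>\<open>r\<close> is the fraction of the block of \<open>x\<close> that lies in the
  initial segment. Away from the block with the index of the cut point \<open>a\<close> and from the
  null block of index 0, a block lies entirely inside or entirely outside the segment.\<close>

lemma initial_avg:
  fixes a x :: real
  assumes n: "n \<ge> 1" and x: "x \<in> {0..1}"
    and r_def: "r = real n * leb (initial a \<inter> cell (block n) (block n x))"
  shows "0 \<le> r" "r \<le> 1" "\<bar>r - indicator (initial a) x\<bar> \<le>
      of_bool (block n x = 0) + of_bool (block n x = block n a)"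
proof -
  let ?c = "cell (block n) (block n x)"
  note c = cell_sets[OF labelling_block[of n], of "block n x"]
  have "leb (initial a \<inter> ?c) \<le> leb ?c"
    by (intro unit_interval.finite_measure_mono c) auto
  also have "\<dots> \<le> 1 / real n" unfolding leb_cell_block[OF n] by auto
  finally show r: "0 \<le> r" "r \<le> 1" using n by (auto simp: r_def field_simps)
  have less: "y \<le> a" if "block n y < block n a" for y
    using block_mono[of a y n] that by linarith
  have gr: "\<not> y \<le> a" if "block n y > block n a" for y
    using block_mono[of y a n] that by auto
  consider "block n x = 0" | "block n x = block n a" | "block n x \<noteq> 0" "block n x <
      block n a" | "block n x > block n a"
    by linarith
  then show "\<bar>r - indicator (initial a) x\<bar> \<le> of_bool (block n x = 0) + of_bool (block n x =
      block n a)"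
  proof cases
    case 3
    then have "initial a \<inter> ?c = ?c" using less by (auto simp: initial_def cell_def)
    moreover have "leb ?c = 1 / real n"
    proof -
      have "block n x \<in> {1..n}" using 3 labelling_block[of n] x by (auto simp: labelling_def)
      then show ?thesis by (simp only: leb_cell_block[OF n] if_True)
    qed
    ultimately have "r = 1" using n by (simp add: r_def)
    moreover have "x \<in> initial a" using less[OF 3(2)] x by (auto simp: initial_def)
    ultimately show ?thesis by simp
  next
    case 4
    then have "initial a \<inter> ?c = {}" using gr by (auto simp: initial_def cell_def)
    then have "r = 0" by (simp add: r_def)
    moreover have "x \<notin> initial a" using gr[OF 4] by (auto simp: initial_def)
    ultimately show ?thesis by simp
  qed (use r in \<open>auto simp: indicator_def\<close>)
qed

lemma avg_rect:
  assumes "S \<in> sets unit_interval" "T \<in> sets unit_interval"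
  shows "avg n (indicator (S \<times> T)) u v = (real n * leb (S \<inter> cell (block n) u)) *
      (real n * leb (T \<inter> cell (block n) v))"
proof -
  let ?c = "\<lambda>u. cell (block n) u"
  have c: "?c u \<in> sets unit_interval" for u by (rule cell_sets[OF labelling_block])
  have "(LINT p:?c u \<times> ?c v|unit_square. indicator (S \<times> T) p) =
       (LINT p|unit_square. indicator ((S \<inter> ?c u) \<times> (T \<inter> ?c v)) p :: real)"
    unfolding set_lebesgue_integral_def
    by (intro Bochner_Integration.integral_cong refl) (auto simp: indicator_def)
  also have "\<dots> = measure unit_square ((S \<inter> ?c u) \<times> (T \<inter> ?c v))"
    by (intro integral_indicator_sq rect_sets sets.Int assms c)
  also have "\<dots> = leb (S \<inter> ?c u) * leb (T \<inter> ?c v)"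
    by (intro measure_rect sets.Int assms c)
  finally show ?thesis by (simp add: avg_def power2_eq_square)
qed

lemma sum_of_bool_delta: "(\<Sum>i\<le>n. of_bool (i = (j::nat)) * (g i::real)) = (if j \<le> n then g j else 0)"
proof -
  have "(\<Sum>i\<le>n. of_bool (i = j) * g i) = (\<Sum>i\<le>n. if i = j then g i else 0)" by (intro sum.cong) auto
  then show ?thesis by simp
qed

text \<open>Block means of a rectangle are products of two fractions. Up to null blocks they differ
  from the indicator only on the grid column that \<open>a\<close> cuts and the grid row that
  \<open>c\<close> cuts, each of area at most \<open>1/n\<close>.\<close>

lemma avg_converges_initial: "avg_converges (indicator (initial a \<times> initial c))"
proof -
  let ?f = "indicator (initial a \<times> initial c) :: _ \<Rightarrow> real"
  have f: "bdd_fun ?f" by (intro bdd_fun_indicator rect_sets initial_sets)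
  have "avg_err n ?f \<le> 2 / real n" if n: "n \<ge> 1" for n
  proof -
    define \<alpha> where "\<alpha> = block n a"
    define \<gamma> where "\<gamma> = block n c"
    \<comment> \<open>The terms at index 0 cover the null block only and vanish on
      integration.\<close>
    define B where "B = (\<lambda>u v. (of_bool (u = 0) + of_bool (u = \<alpha>)) + (of_bool (v =
        0) + of_bool (v = \<gamma>)) :: real)"
    have b: "labelling n (block n)" by (rule labelling_block)
    have "avg_err n ?f \<le> (LINT p|unit_square. step (block n) B p)"
      unfolding avg_err_def
    proof (intro integral_mono bdd_fun_integrable bdd_fun_abs bdd_fun_diff bdd_fun_step_block f)
      fix p assume "p \<in> space unit_square"
      then obtain x y where p: "p = (x, y)" "x \<in> {0..1}" "y \<in> {0..1}"
        by (auto simp: space_unit_square)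
      define r where "r = real n * leb (initial a \<inter> cell (block n) (block n x))"
      define s where "s = real n * leb (initial c \<inter> cell (block n) (block n y))"
      define i where "i = (indicator (initial a) x :: real)"
      define j where "j = (indicator (initial c) y :: real)"
      have st: "step (block n) (avg n ?f) p = r * s"
        by (simp add: p step_def avg_rect initial_sets r_def s_def)
      have fp: "?f p = i * j" by (simp add: p i_def j_def indicator_times)
      note R = initial_avg[OF n p(2) r_def, folded i_def \<alpha>_def]
      note S = initial_avg[OF n p(3) s_def, folded j_def \<gamma>_def]
      have "r * s - i * j = (r - i) * s + i * (s - j)" by (simp add: algebra_simps)
      then have "\<bar>r * s - i * j\<bar> \<le> \<bar>r - i\<bar> * s + i * \<bar>s - j\<bar>"
        using abs_triangle_ineq[of "(r - i) * s" "i * (s - j)"] S by (simp add: abs_mult i_def)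
      also have "\<dots> \<le> \<bar>r - i\<bar> * 1 + 1 * \<bar>s - j\<bar>"
        using S by (intro add_mono mult_mono) (auto simp: i_def)
      also have "\<dots> \<le> B (block n x) (block n y)" using R(3) S(3) by (simp add: B_def)
      finally show "\<bar>step (block n) (avg n ?f) p - ?f p\<bar> \<le> step (block n) B p"
        unfolding st fp by (simp add: step_def p)
    qed
    also have "\<dots> = (\<Sum>i\<le>n. \<Sum>j\<le>n. B i j * (leb (cell (block n) i) * leb (cell (block n) j)))"
      by (rule integral_step[OF b])
    also have "\<dots> \<le> 2 / real n"
    proof -
      define l where "l = (\<lambda>i. leb (cell (block n) i))"
      have l1: "(\<Sum>i\<le>n. l i) = 1"
      proof -
        have "(\<Sum>i\<le>n. l i) = (\<Sum>i\<le>n. leb ({0..1} \<inter> cell (block n) i))"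
          unfolding l_def by (intro sum.cong refl arg_cong[where f=leb]) (auto simp: cell_def)
        also have "\<dots> = leb {0..1}"
          by (rule leb_sum_cells[OF b]) (use sets.top[of unit_interval] in simp)
        finally show ?thesis using unit_interval.prob_space by simp
      qed
      have l0: "l 0 = 0" unfolding l_def using leb_cell_block[OF n] by simp
      have ln: "l i \<le> 1 / real n" for i unfolding l_def using leb_cell_block[OF n] by simp
      have "(\<Sum>i\<le>n. \<Sum>j\<le>n. B i j * (l i * l j)) =
          (\<Sum>i\<le>n. ((of_bool (i = 0) * l i) + of_bool (i = \<alpha>) * l i) * (\<Sum>j\<le>n. l j)) +
          (\<Sum>i\<le>n. l i * (\<Sum>j\<le>n. of_bool (j = 0) * l j + of_bool (j = \<gamma>) * l j))"
        unfolding B_def sum.distrib[of _ _ "{..n}", symmetric] sum_distrib_left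
        by (intro sum.cong refl) (simp add: distrib_left distrib_right mult_ac)
      also have "\<dots> = (if \<alpha> \<le> n then l \<alpha> else 0) + (if \<gamma> \<le> n then l \<gamma> else 0)"
        unfolding sum_distrib_right[symmetric] l1 by (simp add: sum.distrib sum_of_bool_delta l0 l1)
      also have "\<dots> \<le> 2 / real n"
        using add_mono[OF ln[of \<alpha>] ln[of \<gamma>]] ln[of \<alpha>] ln[of \<gamma>] divide_right_mono[of 1 2 "real n"]
        by (auto simp: add_divide_distrib[symmetric])
      finally show ?thesis by (simp add: l_def)
    qed
    finally show ?thesis .
  qed
  then have "\<forall>\<^sub>F n in sequentially. avg_err n ?f \<le> 2 / real n"
    by (intro eventually_sequentiallyI[of 1]) auto
  note le = this
  have "(\<lambda>n. 2 / real n) \<longlonglongrightarrow> 0" by (rule lim_const_over_n)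
  note lim = this
  show ?thesis unfolding avg_converges_def
    by (rule tendsto_sandwich[OF always_eventually le tendsto_const lim]) (simp add: avg_err_nonneg)
qed

lemma sets_unit_interval_initial: "sets unit_interval = sigma_sets {0..1} (range initial)"
proof -
  have "sets unit_interval = (\<inter>) {0..1} ` sigma_sets UNIV (range atMost)"
    by (subst sets_restrict_space) (simp add: borel_eq_atMost)
  also have "\<dots> = sigma_sets {0..1} ((\<inter>) {0..1} ` range atMost)"
  proof (rule sigma_sets_Int)
    have "{0..1::real} \<in> sets borel" by simp
    then show "{0..1::real} \<in> sigma_sets UNIV (range atMost)"
      by (subst (asm) borel_eq_atMost) simp
  qed simp
  also have "(\<inter>) {0..1} ` range atMost = range initial"
    by (simp only: image_image initial_def[abs_def])
  finally show ?thesis .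
qed

lemma sets_unit_square_initial:
  "sets unit_square = sigma_sets ({0..1} \<times> {0..1}) {S \<times> T | S T. S \<in> range initial \<and>
      T \<in> range initial}"
proof -
  have u: "\<Union>{initial 1} = space unit_interval" by (auto simp: initial_def)
  have P: "range initial \<subseteq> Pow (space unit_interval)" by (auto simp: initial_def)
  have "sets unit_square = sets (sigma (space unit_interval \<times> space unit_interval) {S \<times> T | S T.
      S \<in> range initial \<and> T \<in> range initial})"
    by (rule sets_pair_eq[where Ca="{initial 1}" and Cb="{initial 1}"])
      (use u P sets_unit_interval_initial in auto)
  also have "\<dots> = sigma_sets ({0..1} \<times> {0..1}) {S \<times> T | S T. S \<in> range initial \<and> T \<in> range initial}"
    by (subst sets_measure_of) (auto simp: initial_def)
  finally show ?thesis .
qed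

lemma integral_abs_indicator_diff:
  assumes A: "A \<in> sets unit_square" and B: "B \<in> sets unit_square" "B \<subseteq> A"
  shows "(LINT p|unit_square. \<bar>indicator A p - indicator B p :: real\<bar>) =
      measure unit_square A - measure unit_square B"
proof -
  have "(LINT p|unit_square. \<bar>indicator A p - indicator B p :: real\<bar>) =
      (LINT p|unit_square. indicator (A - B) p)"
    using B by (intro Bochner_Integration.integral_cong) (auto simp: indicator_def)
  also have "\<dots> = measure unit_square (A - B)" by (intro integral_indicator_sq sets.Diff A B)
  finally show ?thesis using unit_square.finite_measure_Diff[OF A B] by simp
qed

text \<open>Pi-lambda argument. Complements are differences of indicators, and a disjoint union is
  an \<open>L^1\<close> limit of its finite partial unions; both cases reduce to the closure
  properties of \<open>avg_converges\<close>.\<close>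

lemma avg_converges_indicator:
  assumes E: "E \<in> sets unit_square" shows "avg_converges (indicator E)"
proof -
  let ?G = "{S \<times> T | S T. S \<in> range initial \<and> T \<in> range initial}"
  let ?O = "{0..1} \<times> {0..1::real}"
  have int: "Int_stable ?G"
  proof (rule Int_stableI)
    have i: "initial a \<inter> initial c = initial (min a c)" for a c by (auto simp: initial_def)
    fix A B assume "A \<in> ?G" "B \<in> ?G"
    then obtain a b c d where "A = initial a \<times> initial b" "B = initial c \<times> initial d" by auto
    then have "A \<inter> B = initial (min a c) \<times> initial (min b d)" by (simp add: Times_Int_Times i)
    then show "A \<inter> B \<in> ?G" by blast
  qed
  have sub: "?G \<subseteq> Pow ?O" by (auto simp: initial_def)
  have "E \<in> sigma_sets ?O ?G" using E sets_unit_square_initial by simp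
  with int sub show ?thesis
  proof (induction rule: sigma_sets_induct_disjoint)
    case (basic A)
    then show ?case by (auto simp: avg_converges_initial)
  next
    case empty
    then show ?case using avg_converges_zero by (simp add: indicator_def)
  next
    case (compl A)
    then have A: "A \<in> sets unit_square" using sets_unit_square_initial by simp
    have O: "indicator ?O = (indicator (initial 1 \<times> initial 1) :: _ \<Rightarrow> real)"
      by (simp add: initial_def Int_absorb2)
    have s: "bdd_fun (indicator (initial 1 \<times> initial 1))" "bdd_fun (indicator A)"
      by (intro bdd_fun_indicator rect_sets initial_sets A)+
    show ?case
    proof (rule avg_converges_cong)
      show "bdd_fun (indicator (?O - A))"
        using sets.compl_sets[OF A] by (intro bdd_fun_indicator) (simp add: space_unit_square)
      show "bdd_fun (\<lambda>p. indicator (initial 1 \<times> initial 1) p + (-1) * indicator A p)"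
        by (intro bdd_fun_add bdd_fun_cmult s)
      show "avg_converges (\<lambda>p. indicator (initial 1 \<times> initial 1) p + (-1) * indicator A p)"
        by (intro avg_converges_add avg_converges_initial avg_converges_cmult compl.IH
            bdd_fun_cmult s)
    qed (auto simp: space_unit_square indicator_def initial_def)
  next
    case (union A)
    have A: "A i \<in> sets unit_square" for i using union sets_unit_square_initial by blast
    then have U: "(\<Union>i. A i) \<in> sets unit_square" by blast
    show ?case
    proof (rule avg_converges_close[OF bdd_fun_indicator[OF U]])
      fix e :: real assume e: "e > 0"
      have "(\<lambda>i. measure unit_square (A i)) sums measure unit_square (\<Union>i. A i)"
        using union A by (intro unit_square.finite_measure_UNION) auto
      then obtain N where N: "\<bar>(\<Sum>i<N. measure unit_square (A i)) - measure unit_square (\<Union>i. A i)\<bar> <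
          e"
        unfolding sums_def using LIMSEQ_D[of _ _ e] e by fastforce
      have B: "(\<Union>i<N. A i) \<in> sets unit_square" using A by blast
      have dis: "disjoint_family_on A {..<N}" using union(1) by (auto simp: disjoint_family_on_def)
      have mB: "measure unit_square (\<Union>i<N. A i) = (\<Sum>i<N. measure unit_square (A i))"
        using A dis by (intro unit_square.finite_measure_finite_Union) auto
      have ind: "indicator (\<Union>i<N. A i) = (\<lambda>p. \<Sum>i<N. indicator (A i) p :: real)"
        by (rule ext) (rule indicator_UN_disjoint, use dis in auto)
      show "\<exists>g. bdd_fun g \<and> avg_converges g \<and> (LINT p|unit_square. \<bar>indicator (\<Union>i. A i) p - g p\<bar>) \<le>
          e"
      proof (intro exI[of _ "indicator (\<Union>i<N. A i)"] conjI)
        show "bdd_fun (indicator (\<Union>i<N. A i))" by (rule bdd_fun_indicator[OF B])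
        show "avg_converges (indicator (\<Union>i<N. A i))"
          unfolding ind by (intro avg_converges_sum bdd_fun_indicator A union.IH) auto
        show "(LINT p|unit_square. \<bar>indicator (\<Union>i. A i) p - indicator (\<Union>i<N. A i) p\<bar>) \<le> e"
          using N by (subst integral_abs_indicator_diff[OF U B]) (auto simp: mB)
      qed
    qed
  qed
qed

text \<open>Rounding \<open>f\<close> down to a multiple of \<open>1/M\<close> gives the mean of the
  indicators of \<open>M\<close> superlevel sets and moves \<open>f\<close> by at most
  \<open>1/M\<close> uniformly, so indicators suffice.\<close>

theorem avg_err_tendsto:
  assumes f: "bdd_fun f" and f01: "\<And>p. p \<in> space unit_square \<Longrightarrow> f p \<in> {0..1}"
  shows "(\<lambda>n. avg_err n f) \<longlonglongrightarrow> 0"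
proof -
  have "avg_converges f"
  proof (rule avg_converges_close[OF f])
    fix e :: real assume e: "e > 0"
    obtain m where m: "1 / real (Suc m) < e" using nat_approx_posE[OF e] by auto
    define M where "M = Suc m"
    define L where "L j = {p \<in> space unit_square. real j / real M \<le> f p}" for j
    have L: "L j \<in> sets unit_square" for j
      unfolding L_def using f by (intro borel_measurable_le) (auto simp: bdd_fun_def)
    define g where "g p = (1 / real M) * (\<Sum>j=1..M. indicator (L j) p)" for p
    have g: "bdd_fun g" "avg_converges g"
      unfolding g_def
      by (intro bdd_fun_cmult bdd_fun_sum avg_converges_cmult avg_converges_sum bdd_fun_indicator L
          avg_converges_indicator finite_atLeastAtMost)+
    have close: "\<bar>f p - g p\<bar> \<le> 1 / real M" if p: "p \<in> space unit_square" for p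
    proof -
      have M: "real M > 0" by (simp add: M_def)
      have "(\<Sum>j=1..M. indicator (L j) p :: real) = (\<Sum>j\<in>{1..M}. if real j \<le>
          real M * f p then 1 else 0)"
        using p M by (intro sum.cong refl) (auto simp: L_def indicator_def field_simps)
      also have "\<dots> = card {j\<in>{1..M}. real j \<le> real M * f p}"
        by (simp add: sum.If_cases Int_def)
      also have "{j\<in>{1..M}. real j \<le> real M * f p} = {1..nat \<lfloor>real M * f p\<rfloor>}"
      proof -
        have "real M * f p \<le> real M" using f01[OF p] by (simp add: mult_left_le)
        then have "real j \<le> real M * f p \<Longrightarrow> j \<le> M" for j by linarith
        moreover have "real j \<le> real M * f p \<longleftrightarrow> j \<le> nat \<lfloor>real M * f p\<rfloor>" for j
          using f01[OF p] by (subst le_nat_iff) (auto simp: le_floor_iff)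
        moreover have "j \<ge> 1 \<longleftrightarrow> j \<in> {1..}" for j :: nat by simp
        ultimately show ?thesis
          by (intro set_eqI) (simp only: atLeastAtMost_iff mem_Collect_eq, blast)
      qed
      finally have gp: "g p = real_of_int \<lfloor>real M * f p\<rfloor> / real M"
        using f01[OF p] by (simp add: g_def)
      have "f p - g p = (real M * f p - real_of_int \<lfloor>real M * f p\<rfloor>) / real M"
        unfolding gp using M by (simp add: field_simps)
      moreover have "\<bar>real M * f p - real_of_int \<lfloor>real M * f p\<rfloor>\<bar> \<le> 1" by linarith
      ultimately show ?thesis using M by (simp add: divide_right_mono)
    qed
    have "(LINT p|unit_square. \<bar>f p - g p\<bar>) \<le> (LINT p|unit_square. 1 / real M)"
      by (intro integral_mono bdd_fun_integrable bdd_fun_abs bdd_fun_diff f g bdd_fun_const close)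
    also have "\<dots> = 1 / real M" using unit_square.prob_space
      by (subst Bochner_Integration.lebesgue_integral_const) simp
    finally show "\<exists>g. bdd_fun g \<and> avg_converges g \<and> (LINT p|unit_square. \<bar>f p - g p\<bar>) \<le> e"
      using g m by (intro exI[of _ g]) (auto simp: M_def)
  qed
  then show ?thesis by (simp add: avg_converges_def)
qed

section \<open>Cut decompositions of matrices\<close>

text \<open>A linear functional on a cube is maximal at a vertex, here the one that selects the
  positive coefficients.\<close>

lemma sum_le_subset_sum:
  fixes a s :: "'a \<Rightarrow> real"
  assumes "finite I" "\<And>u. u \<in> I \<Longrightarrow> 0 \<le> s u \<and> s u \<le> 1"
  shows "\<exists>S\<subseteq>I. (\<Sum>u\<in>I. a u * s u) \<le> (\<Sum>u\<in>S. a u)"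
proof (intro exI conjI)
  show "{u\<in>I. a u > 0} \<subseteq> I" by auto
  have "(\<Sum>u\<in>I. a u * s u) \<le> (\<Sum>u\<in>I. if a u > 0 then a u else 0)"
    using assms by (intro sum_mono) (auto simp: mult_left_le mult_nonpos_nonneg)
  also have "\<dots> = (\<Sum>u\<in>{u\<in>I. a u > 0}. a u)"
    using assms by (simp add: sum.inter_filter)
  finally show "(\<Sum>u\<in>I. a u * s u) \<le> (\<Sum>u\<in>{u\<in>I. a u > 0}. a u)" .
qed

lemma bilinear_le_subset_sum:
  fixes A :: "'a \<Rightarrow> 'a \<Rightarrow> real"
  assumes I: "finite I" and s: "\<And>u. u \<in> I \<Longrightarrow> 0 \<le> s u \<and> s u \<le> 1"
    and t: "\<And>u. u \<in> I \<Longrightarrow> 0 \<le> t u \<and> t u \<le> 1"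
  shows "\<exists>S\<subseteq>I. \<exists>T\<subseteq>I. (\<Sum>u\<in>I. \<Sum>v\<in>I. A u v * (s u * t v)) \<le> (\<Sum>u\<in>S. \<Sum>v\<in>T. A u v)"
proof -
  have 1: "(\<Sum>u\<in>I. \<Sum>v\<in>I. A u v * (s u * t v)) = (\<Sum>u\<in>I. (\<Sum>v\<in>I. A u v * t v) * s u)"
    by (simp add: sum_distrib_right sum_distrib_left mult_ac)
  have "\<exists>S\<subseteq>I. (\<Sum>u\<in>I. (\<Sum>v\<in>I. A u v * t v) * s u) \<le> (\<Sum>u\<in>S. \<Sum>v\<in>I. A u v * t v)"
    by (rule sum_le_subset_sum[OF I s])
  then obtain S where S: "S \<subseteq> I" "(\<Sum>u\<in>I. (\<Sum>v\<in>I. A u v * t v) * s u) \<le> (\<Sum>u\<in>S. \<Sum>v\<in>I. A u v * t v)"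
    by (elim exE conjE)
  have 2: "(\<Sum>u\<in>S. \<Sum>v\<in>I. A u v * t v) = (\<Sum>v\<in>I. (\<Sum>u\<in>S. A u v) * t v)"
    by (subst sum.swap) (simp add: sum_distrib_right)
  have "\<exists>T\<subseteq>I. (\<Sum>v\<in>I. (\<Sum>u\<in>S. A u v) * t v) \<le> (\<Sum>v\<in>T. \<Sum>u\<in>S. A u v)"
    by (rule sum_le_subset_sum[OF I t])
  then obtain T where T: "T \<subseteq> I" "(\<Sum>v\<in>I. (\<Sum>u\<in>S. A u v) * t v) \<le> (\<Sum>v\<in>T. \<Sum>u\<in>S. A u v)"
    by (elim exE conjE)
  have 3: "(\<Sum>v\<in>T. \<Sum>u\<in>S. A u v) = (\<Sum>u\<in>S. \<Sum>v\<in>T. A u v)" by (rule sum.swap)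
  have "(\<Sum>u\<in>I. \<Sum>v\<in>I. A u v * (s u * t v)) \<le> (\<Sum>u\<in>S. \<Sum>v\<in>T. A u v)"
    using S(2) T(2) unfolding 1 2 3 by linarith
  then show ?thesis using S(1) T(1) by (intro exI[of _ S] exI[of _ T] conjI)
qed

text \<open>A bilinear form is linear in each argument, so over a product of two cubes it is maximal
  at a pair of vertices; the form of \<open>- A\<close> supplies the other sign. This reduces
  measurable sets, which may cut grid blocks fractionally, to unions of whole blocks.\<close>

lemma bilinear_bound:
  fixes A :: "'a \<Rightarrow> 'a \<Rightarrow> real"
  assumes I: "finite I" and s: "\<And>u. u \<in> I \<Longrightarrow> 0 \<le> s u \<and> s u \<le> 1"
    and t: "\<And>u. u \<in> I \<Longrightarrow> 0 \<le> t u \<and> t u \<le> 1"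
    and c: "\<And>S T. S \<subseteq> I \<Longrightarrow> T \<subseteq> I \<Longrightarrow> \<bar>\<Sum>u\<in>S. \<Sum>v\<in>T. A u v\<bar> \<le> c"
  shows "\<bar>\<Sum>u\<in>I. \<Sum>v\<in>I. A u v * (s u * t v)\<bar> \<le> c"
proof -
  have sub: "\<exists>S\<subseteq>I. \<exists>T\<subseteq>I. (\<Sum>u\<in>I. \<Sum>v\<in>I. B u v * (s u * t v)) \<le> (\<Sum>u\<in>S. \<Sum>v\<in>T. B u v)" for B
    by (rule bilinear_le_subset_sum[OF I s t])
  obtain S T where "S \<subseteq> I" "T \<subseteq> I" "(\<Sum>u\<in>I. \<Sum>v\<in>I. A u v * (s u * t v)) \<le> (\<Sum>u\<in>S. \<Sum>v\<in>T. A u v)"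
    using sub[of A] by (elim exE conjE)
  then have 1: "(\<Sum>u\<in>I. \<Sum>v\<in>I. A u v * (s u * t v)) \<le> c" using c[of S T] by linarith
  obtain S T where ST: "S \<subseteq> I" "T \<subseteq> I" "(\<Sum>u\<in>I. \<Sum>v\<in>I. - A u v * (s u * t v)) \<le> (\<Sum>u\<in>S. \<Sum>v\<in>T. - A u v)"
    using sub[of "\<lambda>u v. - A u v"] by (elim exE conjE)
  have "- (\<Sum>u\<in>I. \<Sum>v\<in>I. A u v * (s u * t v)) \<le> - (\<Sum>u\<in>S. \<Sum>v\<in>T. A u v)"
    using ST(3) by (simp add: sum_negf)
  then have "- (\<Sum>u\<in>I. \<Sum>v\<in>I. A u v * (s u * t v)) \<le> c" using c[OF ST(1,2)] by linarith
  with 1 show ?thesis by linarith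
qed

text \<open>Energy decrement, as in the weak regularity lemma of Frieze and Kannan. As long as some
  pair of sets violates the bound, subtracting a multiple of the indicator of its rectangle lowers
  the square sum by at least \<open>\<epsilon>^2 * (card I)^2\<close>, so the budget of
  \<open>m\<close> rounds suffices.\<close>

lemma cut_decomposition:
  fixes A :: "'a \<Rightarrow> 'a \<Rightarrow> real"
  assumes I: "finite I" "I \<noteq> {}" and eps: "\<epsilon> > 0" and K: "K \<ge> 0"
    and "(\<Sum>u\<in>I. \<Sum>v\<in>I. (A u v)\<^sup>2) \<le> K\<^sup>2 * (real (card I))\<^sup>2"
    and "(\<Sum>u\<in>I. \<Sum>v\<in>I. (A u v)\<^sup>2) \<le> real m * \<epsilon>\<^sup>2 * (real (card I))\<^sup>2"
  shows "\<exists>c S T. (\<forall>i<m. \<bar>c i\<bar> \<le> K) \<and> (\<forall>S'\<subseteq>I. \<forall>T'\<subseteq>I.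
    \<bar>\<Sum>u\<in>S'. \<Sum>v\<in>T'. A u v - (\<Sum>i<m. c i * (of_bool (u \<in> S i) * of_bool (v \<in> T i)))\<bar> \<le> \<epsilon> *
        (real (card I))\<^sup>2)"
  using assms(5,6)
proof (induction m arbitrary: A)
  case 0
  then have "(\<Sum>u\<in>I. \<Sum>v\<in>I. (A u v)\<^sup>2) = 0" by (intro antisym sum_nonneg) auto
  then have "\<forall>u\<in>I. \<forall>v\<in>I. A u v = 0"
    using I(1) by (simp add: sum_nonneg_eq_0_iff sum_nonneg)
  then have "(\<Sum>u\<in>S. \<Sum>v\<in>T. A u v) = 0" if "S \<subseteq> I" "T \<subseteq> I" for S T
    using that by (intro sum.neutral ballI) blast
  then show ?case using eps by (auto simp: sum_subtractf)
next
  case (Suc m)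
  define N where "N = real (card I)"
  have N: "N > 0" using I by (simp add: N_def card_gt_0_iff)
  show ?case
  proof (cases "\<forall>S'\<subseteq>I. \<forall>T'\<subseteq>I. \<bar>\<Sum>u\<in>S'. \<Sum>v\<in>T'. A u v\<bar> \<le> \<epsilon> * N\<^sup>2")
    case True
    then show ?thesis using K by (intro exI[of _ "\<lambda>_. 0"] exI[of _ "\<lambda>_. {}"]) (auto simp: N_def)
  next
    case False
    then obtain S' T' where ST: "S' \<subseteq> I" "T' \<subseteq> I" and gt: "\<bar>\<Sum>u\<in>S'. \<Sum>v\<in>T'. A u v\<bar> > \<epsilon> * N\<^sup>2"
      unfolding not_all not_imp not_le by (elim exE conjE)
    \<comment> \<open>Dividing by \<open>N^2\<close>, not by the size of
      \<open>S' \<times> T'\<close>, makes the energy drop by at least \<open>c0^2 * N^2\<close>. As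
      the energy stays nonnegative and starts below \<open>K^2 * N^2\<close>, the same estimate
      bounds \<open>c0\<close> by \<open>K\<close>.\<close>
    define c0 where "c0 = (\<Sum>u\<in>S'. \<Sum>v\<in>T'. A u v) / N\<^sup>2"
    define d where "d u v = (of_bool (u \<in> S') * of_bool (v \<in> T') :: real)" for u v
    define A' where "A' u v = A u v - c0 * d u v" for u v
    have sumST: "(\<Sum>u\<in>I. \<Sum>v\<in>I. F u v * d u v) = (\<Sum>u\<in>S'. \<Sum>v\<in>T'. F u v)" for F :: "'a \<Rightarrow> 'a \<Rightarrow> real"
    proof -
      have "(\<Sum>u\<in>I. \<Sum>v\<in>I. F u v * d u v) = (\<Sum>u\<in>I. if u \<in> S' then \<Sum>v\<in>I.
          if v \<in> T' then F u v else 0 else 0)"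
        unfolding d_def by (intro sum.cong refl) (auto intro!: sum.cong)
      also have "\<dots> = (\<Sum>u\<in>I \<inter> S'. \<Sum>v\<in>I \<inter> T'. F u v)" using I by (simp add: sum.inter_restrict)
      moreover have "I \<inter> S' = S'" "I \<inter> T' = T'" using ST by auto
      ultimately show ?thesis by simp
    qed
    have c0N: "(\<Sum>u\<in>S'. \<Sum>v\<in>T'. A u v) = c0 * N\<^sup>2" using N by (simp add: c0_def)
    have dd: "(d u v)\<^sup>2 = d u v" for u v by (simp add: d_def)
    have "(\<Sum>u\<in>I. \<Sum>v\<in>I. (A' u v)\<^sup>2) = (\<Sum>u\<in>I. \<Sum>v\<in>I. (A u v)\<^sup>2 - 2 * c0 * (A u v * d u v) +
        c0\<^sup>2 * (1 * d u v))"
      unfolding A'_def by (intro sum.cong refl) (simp add: power2_diff power_mult_distrib dd)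
    also have "\<dots> = (\<Sum>u\<in>I. \<Sum>v\<in>I. (A u v)\<^sup>2) - 2 * c0 * (c0 * N\<^sup>2) +
        c0\<^sup>2 * (real (card S') * real (card T'))"
      unfolding sum.distrib sum_subtractf sum_distrib_left[symmetric] sumST c0N
      using sumST[of "\<lambda>_ _. 1"] by simp
    also have "\<dots> \<le> (\<Sum>u\<in>I. \<Sum>v\<in>I. (A u v)\<^sup>2) - 2 * c0 * (c0 * N\<^sup>2) + c0\<^sup>2 * (N * N)"
      using card_mono[OF I(1) ST(1)] card_mono[OF I(1) ST(2)]
      by (intro add_mono order.refl mult_left_mono mult_mono) (auto simp: N_def)
    finally have energy: "(\<Sum>u\<in>I. \<Sum>v\<in>I. (A' u v)\<^sup>2) \<le> (\<Sum>u\<in>I. \<Sum>v\<in>I. (A u v)\<^sup>2) - c0\<^sup>2 * N\<^sup>2"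
      by (simp add: power2_eq_square algebra_simps)
    have "\<bar>c0\<bar> > \<epsilon>" using gt N unfolding c0N abs_mult by simp
    then have c0eps: "c0\<^sup>2 \<ge> \<epsilon>\<^sup>2" using eps by (simp add: abs_le_square_iff[symmetric])
    have "0 \<le> (\<Sum>u\<in>I. \<Sum>v\<in>I. (A' u v)\<^sup>2)" by (intro sum_nonneg) auto
    then have "c0\<^sup>2 * N\<^sup>2 \<le> K\<^sup>2 * N\<^sup>2" using energy Suc.prems(1) by (simp add: N_def)
    then have "c0\<^sup>2 \<le> K\<^sup>2" using N by simp
    then have c0K: "\<bar>c0\<bar> \<le> K" using K by (simp add: abs_le_square_iff[symmetric])
    have 1: "(\<Sum>u\<in>I. \<Sum>v\<in>I. (A' u v)\<^sup>2) \<le> K\<^sup>2 * (real (card I))\<^sup>2"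
      using energy Suc.prems(1) mult_nonneg_nonneg[OF zero_le_power2[of c0] zero_le_power2[of N]]
      by linarith
    have "c0\<^sup>2 * N\<^sup>2 \<ge> \<epsilon>\<^sup>2 * N\<^sup>2" using c0eps by (simp add: mult_right_mono)
    then have 2: "(\<Sum>u\<in>I. \<Sum>v\<in>I. (A' u v)\<^sup>2) \<le> real m * \<epsilon>\<^sup>2 * (real (card I))\<^sup>2"
      using energy Suc.prems(2) by (simp add: N_def algebra_simps)
    obtain c S T where c: "\<forall>i<m. \<bar>c i\<bar> \<le> K" and
      cST: "\<forall>S'\<subseteq>I. \<forall>T'\<subseteq>I. \<bar>\<Sum>u\<in>S'. \<Sum>v\<in>T'. A' u v -
          (\<Sum>i<m. c i * (of_bool (u \<in> S i) * of_bool (v \<in> T i)))\<bar> \<le> \<epsilon> * (real (card I))\<^sup>2"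
      using Suc.IH[OF 1 2] by (elim exE conjE)
    show ?thesis
    proof (intro exI conjI allI impI)
      \<comment> \<open>The new rectangle is put at index 0; \<open>case_nat\<close> shifts the
        others by one.\<close>
      show "\<bar>case_nat c0 c i\<bar> \<le> K" if "i < Suc m" for i
        using that c0K c by (cases i) auto
      fix U V assume UV: "U \<subseteq> I" "V \<subseteq> I"
      have "A u v - (\<Sum>i<Suc m. case_nat c0 c i * (of_bool (u \<in> case_nat S' S i) *
          of_bool (v \<in> case_nat T' T i))) =
         A' u v - (\<Sum>i<m. c i * (of_bool (u \<in> S i) * of_bool (v \<in> T i)))" for u v
        unfolding sum.lessThan_Suc_shift A'_def d_def by simp
      then show "\<bar>\<Sum>u\<in>U. \<Sum>v\<in>V. A u v - (\<Sum>i<Suc m.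
          case_nat c0 c i * (of_bool (u \<in> case_nat S' S i) * of_bool (v \<in> case_nat T' T i)))\<bar> \<le> \<epsilon> *
          (real (card I))\<^sup>2"
        using cST[rule_format, OF UV] by simp
    qed
  qed
qed

text \<open>Sorted labels make the label function on the unit interval monotone, so that only few
  cells of a coarse grid contain a change of label.\<close>

lemma sorting_permutation:
  fixes s :: "nat \<Rightarrow> nat"
  shows "\<exists>\<sigma>. \<sigma> permutes {1..N} \<and> mono_on {1..N} (s \<circ> \<sigma>)"
proof -
  define xs where "xs = map s [1..<Suc N]"
  have len: "length xs = N" by (simp add: xs_def)
  have "mset (sort xs) = mset xs" by simp
  then obtain p where p: "p permutes {..<N}" "permute_list p xs = sort xs"
    using mset_eq_permutation[of "sort xs" xs] len by auto
  have nth: "sort xs ! i = s (Suc (p i))" if "i < N" for i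
  proof -
    have "p i < N" using permutes_in_image[OF p(1), of i] that by simp
    then show ?thesis using that p permute_list_nth[of p xs i] len
      by (simp add: xs_def del: upt_Suc)
  qed
  define \<sigma> where "\<sigma> u = (if u \<in> {1..N} then Suc (p (u - 1)) else u)" for u
  have "bij_betw \<sigma> {1..N} {1..N}"
  proof -
    have "bij_betw (\<lambda>u. u - 1) {1..N} {..<N}"
      by (rule bij_betw_byWitness[where f'=Suc]) auto
    moreover have "bij_betw p {..<N} {..<N}" by (rule permutes_imp_bij[OF p(1)])
    moreover have "bij_betw Suc {..<N} {1..N}"
      by (rule bij_betw_byWitness[where f'="\<lambda>u. u - 1"]) auto
    ultimately have "bij_betw (Suc \<circ> (p \<circ> (\<lambda>u. u - 1))) {1..N} {1..N}"
      by (blast intro: bij_betw_trans)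
    then show ?thesis by (rule bij_betw_cong[THEN iffD1, rotated]) (simp add: \<sigma>_def)
  qed
  then have "\<sigma> permutes {1..N}" by (rule bij_imp_permutes) (auto simp: \<sigma>_def)
  moreover have "mono_on {1..N} (s \<circ> \<sigma>)"
  proof (rule mono_onI)
    fix u v assume uv: "u \<in> {1..N}" "v \<in> {1..N}" "u \<le> v"
    have "sort xs ! (u - 1) \<le> sort xs ! (v - 1)"
      using uv len by (intro sorted_nth_mono) auto
    then show "(s \<circ> \<sigma>) u \<le> (s \<circ> \<sigma>) v" using uv nth[of "u-1"] nth[of "v-1"] by (simp add: \<sigma>_def)
  qed
  ultimately show ?thesis by blast
qed

section \<open>Block permutations and regularity\<close>

lemma sum_atMost_split: "(\<Sum>i\<le>N. f i) = f 0 + (\<Sum>i\<in>{1..N}. f i :: real)" for N :: nat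
proof -
  have "{..N} = insert 0 {1..N}" by auto
  then show ?thesis by simp
qed

text \<open>A measurable set meets block \<open>u\<close> in a fraction between 0 and 1, so
  rectangle integrals of a step function are bilinear forms in such fractions and
  \<open>bilinear_bound\<close> applies; the null block of index 0 drops out.\<close>

lemma cut_norm_step_le:
  assumes N: "N \<ge> 1"
    and c: "\<And>S T. S \<subseteq> {1..N} \<Longrightarrow> T \<subseteq> {1..N} \<Longrightarrow> \<bar>\<Sum>u\<in>S. \<Sum>v\<in>T. A u v\<bar> \<le> c * (real N)\<^sup>2"
  shows "cut_norm (step (block N) A) \<le> c"
proof (rule cut_norm_least)
  fix S T assume ST: "S \<in> sets unit_interval" "T \<in> sets unit_interval"
  define s where "s S u = real N * leb (S \<inter> cell (block N) u)" for S u
  have cs: "cell (block N) u \<in> sets unit_interval" for u by (rule cell_sets[OF labelling_block])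
  have le: "leb (S \<inter> cell (block N) u) \<le> leb (cell (block N) u)" if "S \<in> sets unit_interval" for S u
    using that cs by (intro unit_interval.finite_measure_mono) auto
  have s01: "0 \<le> s S u \<and> s S u \<le> 1" if "S \<in> sets unit_interval" for S u
  proof -
    have "leb (S \<inter> cell (block N) u) \<le> 1 / real N"
      using le[OF that, of u] leb_cell_block[OF N, of u] by (auto split:
          if_splits intro: order_trans)
    then show ?thesis using N by (simp add: s_def field_simps)
  qed
  have s0: "leb (S \<inter> cell (block N) 0) = 0" if "S \<in> sets unit_interval" for S
    using le[OF that, of 0] leb_cell_block[OF N, of 0] by (simp add: measure_le_0_iff)
  have "(LINT p:S\<times>T|unit_square. step (block N) A p) =
      (\<Sum>i\<le>N. \<Sum>j\<le>N. A i j * (leb (S \<inter> cell (block N) i) * leb (T \<inter> cell (block N) j)))"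
    by (rule set_integral_step[OF labelling_block ST])
  also have "\<dots> = (\<Sum>i\<in>{1..N}. \<Sum>j\<in>{1..N}. A i j * (leb (S \<inter> cell (block N) i) *
      leb (T \<inter> cell (block N) j)))"
    by (simp add: sum_atMost_split s0 ST)
  finally have eq: "(real N)\<^sup>2 * (LINT p:S\<times>T|unit_square. step (block N) A p) =
      (\<Sum>i\<in>{1..N}. \<Sum>j\<in>{1..N}. A i j * (s S i * s T j))"
    by (simp add: s_def sum_distrib_left power2_eq_square mult_ac)
  have "\<bar>\<Sum>i\<in>{1..N}. \<Sum>j\<in>{1..N}. A i j * (s S i * s T j)\<bar> \<le> c * (real N)\<^sup>2"
    by (rule bilinear_bound) (use s01 ST c in auto)
  then have "(real N)\<^sup>2 * \<bar>LINT p:S\<times>T|unit_square. step (block N) A p\<bar> \<le> (real N)\<^sup>2 * c"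
    unfolding eq[symmetric] abs_mult by (simp add: mult.commute)
  then show "\<bar>LINT p:S\<times>T|unit_square. step (block N) A p\<bar> \<le> c"
    by (rule mult_left_le_imp_le) (use N in simp)
qed

text \<open>Block \<open>u\<close> is translated rigidly onto block \<open>\<sigma> u\<close>. For
  \<open>\<sigma>\<close> permuting \<open>{1..n}\<close> the index 0 is fixed, so the point 0 stays
  in place.\<close>

definition block_perm :: "nat \<Rightarrow> (nat \<Rightarrow> nat) \<Rightarrow> real \<Rightarrow> real" where
  "block_perm n \<sigma> x = x + (real (\<sigma> (block n x)) - real (block n x)) / real n"

lemma cell_self: "x \<in> {0..1} \<Longrightarrow> x \<in> cell b (b x)"
  by (simp add: cell_def)

lemma block_perm:
  assumes n: "n \<ge> 1" and \<sigma>: "\<sigma> permutes {1..n}" and x: "x \<in> {0..1}"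
  shows "block_perm n \<sigma> x \<in> cell (block n) (\<sigma> (block n x))"
proof (cases "block n x = 0")
  case True
  then have "\<sigma> (block n x) = block n x" using permutes_not_in[OF \<sigma>] by simp
  then show ?thesis using cell_self[OF x] by (simp add: block_perm_def)
next
  case False
  then have u: "block n x \<in> {1..n}" using labelling_block[of n] x by (auto simp: labelling_def)
  then have v: "\<sigma> (block n x) \<in> {1..n}" using permutes_in_image[OF \<sigma>] by blast
  show ?thesis
    using cell_self[OF x, of "block n"] unfolding cell_block[OF u] cell_block[OF v]
    by (auto simp: block_perm_def diff_divide_distrib)
qed

lemma block_perm_in: "n \<ge> 1 \<Longrightarrow> \<sigma> permutes {1..n} \<Longrightarrow> x \<in> {0..1} \<Longrightarrow> block_perm n \<sigma> x \<in> {0..1}"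
  and block_block_perm: "n \<ge> 1 \<Longrightarrow> \<sigma> permutes {1..n} \<Longrightarrow> x \<in> {0..1} \<Longrightarrow>
      block n (block_perm n \<sigma> x) = \<sigma> (block n x)"
  using block_perm[of n \<sigma> x] by (simp_all add: cell_def)

lemma block_perm_inverse:
  assumes "n \<ge> 1" "\<sigma> permutes {1..n}" "x \<in> {0..1}" "\<And>u. \<tau> (\<sigma> u) = u"
  shows "block_perm n \<tau> (block_perm n \<sigma> x) = x"
  using block_block_perm[OF assms(1-3)] assms(4)
  by (simp add: block_perm_def[of n \<tau>]) (simp add: block_perm_def diff_divide_distrib)

lemma block_perm_measurable:
  assumes n: "n \<ge> 1" and \<sigma>: "\<sigma> permutes {1..n}"
  shows "block_perm n \<sigma> \<in> unit_interval \<rightarrow>\<^sub>M unit_interval"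
proof (rule measurable_restrict_space2)
  show "block_perm n \<sigma> \<in> space unit_interval \<rightarrow> {0..1}"
    using block_perm_in[OF n \<sigma>] by simp
  have "(\<lambda>x. (real (\<sigma> (block n x)) - real (block n x)) / real n) \<in> borel_measurable unit_interval"
    by (rule measurable_compose[where f="block n" and N="count_space UNIV"])
      (use labelling_block[of n] in \<open>auto simp: labelling_def\<close>)
  moreover have "(\<lambda>x. x) \<in> borel_measurable unit_interval"
    by (rule measurable_restrict_space1) simp
  ultimately have "block_perm n \<sigma> \<in> borel_measurable unit_interval"
    unfolding block_perm_def[abs_def] by (intro borel_measurable_add)
  then show "block_perm n \<sigma> \<in> unit_interval \<rightarrow>\<^sub>M lborel" by simp
qed

lemma leb_sum_blocks:
  assumes n: "n \<ge> 1" and S: "S \<in> sets unit_interval"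
  shows "leb S = (\<Sum>u\<in>{1..n}. leb (S \<inter> cell (block n) u))"
proof -
  have "leb (S \<inter> cell (block n) 0) \<le> leb (cell (block n) 0)"
    by (intro unit_interval.finite_measure_mono cell_sets[OF labelling_block]) auto
  then have "leb (S \<inter> cell (block n) 0) = 0"
    using leb_cell_block[OF n, of 0] by (simp add: measure_le_0_iff)
  then show ?thesis
    unfolding leb_sum_cells[OF labelling_block[of n] S, symmetric]
    by (simp add: sum_atMost_split)
qed

lemma measure_translate:
  assumes "B \<in> sets borel" shows "measure lborel ((+) c -` B) = measure lborel (B :: real set)"
proof -
  have "measure (distr lborel borel ((+) c)) B = measure lborel ((+) c -` B \<inter> space lborel)"
    using assms by (intro measure_distr) auto
  then show ?thesis by (simp add: lborel_distr_plus)
qed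

lemma borel_unit_interval: "S \<in> sets unit_interval \<Longrightarrow> S \<in> sets borel"
  by (auto simp: sets_restrict_space)

text \<open>Lebesgue measure is translation invariant on every block, and summing over the blocks
  absorbs the permutation.\<close>

lemma leb_block_perm:
  assumes n: "n \<ge> 1" and \<sigma>: "\<sigma> permutes {1..n}" and A: "A \<in> sets unit_interval"
  shows "leb (block_perm n \<sigma> -` A \<inter> {0..1}) = leb A"
proof -
  let ?f = "block_perm n \<sigma>" and ?c = "cell (block n)"
  have m: "?f -` A \<inter> {0..1} \<in> sets unit_interval"
    using measurable_sets[OF block_perm_measurable[OF n \<sigma>] A] by simp
  have cs: "?c u \<in> sets unit_interval" for u by (rule cell_sets[OF labelling_block])
  have "leb (?f -` A \<inter> {0..1} \<inter> ?c u) = leb (A \<inter> ?c (\<sigma> u))" if u: "u \<in> {1..n}" for u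
  proof -
    have v: "\<sigma> u \<in> {1..n}" using permutes_in_image[OF \<sigma>] u by blast
    define d where "d = (real (\<sigma> u) - real u) / real n"
    have "?f -` A \<inter> {0..1} \<inter> ?c u = (+) d -` (A \<inter> ?c (\<sigma> u))"
    proof (rule set_eqI)
      fix x
      have "d + x \<in> ?c (\<sigma> u) \<longleftrightarrow> x \<in> ?c u"
        unfolding cell_block[OF u] cell_block[OF v] by (auto simp: d_def diff_divide_distrib)
      moreover have "?f x = d + x" "x \<in> {0..1}" if "x \<in> ?c u"
        using that by (auto simp: cell_def block_perm_def d_def)
      ultimately show "x \<in> ?f -` A \<inter> {0..1} \<inter> ?c u \<longleftrightarrow> x \<in> (+) d -` (A \<inter> ?c (\<sigma> u))" by auto
    qed
    moreover have "measure lborel ((+) d -` (A \<inter> ?c (\<sigma> u))) = measure lborel (A \<inter> ?c (\<sigma> u))"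
      by (intro measure_translate borel_unit_interval sets.Int A cs)
    moreover have "?f -` A \<inter> {0..1} \<inter> ?c u \<subseteq> {0..1}" "A \<inter> ?c (\<sigma> u) \<subseteq> {0..1}"
      using sets_unit_intervalD[OF A] by auto
    ultimately show ?thesis by (simp only: leb_eq)
  qed
  then have "leb (?f -` A \<inter> {0..1}) = (\<Sum>u\<in>{1..n}. leb (A \<inter> ?c (\<sigma> u)))"
    unfolding leb_sum_blocks[OF n m] by (intro sum.cong refl)
  also have "\<dots> = (\<Sum>u\<in>{1..n}. leb (A \<inter> ?c u))"
    using sum.permute[OF \<sigma>, of "\<lambda>u. leb (A \<inter> ?c u)"] by (simp add: comp_def)
  also have "\<dots> = leb A" by (rule leb_sum_blocks[OF n A, symmetric])
  finally show ?thesis .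
qed

lemma block_perm_mp:
  assumes n: "n \<ge> 1" and \<sigma>: "\<sigma> permutes {1..n}"
  shows "block_perm n \<sigma> \<in> mp_bijections"
proof -
  \<comment> \<open>The inverse permutation gives an explicit inverse map, whose measurability
    \<open>mp_bijections\<close> also demands.\<close>
  define \<tau> where "\<tau> = inv \<sigma>"
  have \<tau>: "\<tau> permutes {1..n}" unfolding \<tau>_def by (rule permutes_inv[OF \<sigma>])
  have inv1: "\<tau> (\<sigma> u) = u" "\<sigma> (\<tau> u) = u" for u
    using permutes_inverses[OF \<sigma>] by (simp_all add: \<tau>_def)
  let ?f = "block_perm n \<sigma>" and ?g = "block_perm n \<tau>"
  have gf: "?g (?f x) = x" and fg: "?f (?g x) = x" if "x \<in> {0..1}" for x
    using block_perm_inverse[OF n \<sigma> that, of \<tau>] block_perm_inverse[OF n \<tau> that, of \<sigma>] inv1 by auto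
  have bij: "bij_betw ?f {0..1} {0..1}"
    by (rule bij_betw_byWitness[where f'="?g"])
      (use gf fg block_perm_in[OF n \<sigma>] block_perm_in[OF n \<tau>] in \<open>auto simp del: atLeastAtMost_iff\<close>)
  have "inv_into {0..1} ?f x = ?g x" if "x \<in> {0..1}" for x
    using bij fg[OF that] block_perm_in[OF n \<tau> that] unfolding bij_betw_def
    by (metis inv_into_f_f)
  then have "inv_into {0..1} ?f \<in> unit_interval \<rightarrow>\<^sub>M unit_interval"
    by (subst measurable_cong[where g="?g"]) (auto intro: block_perm_measurable[OF n \<tau>] simp del:
        atLeastAtMost_iff)
  moreover have "distr unit_interval unit_interval ?f = unit_interval"
  proof (rule measure_eqI)
    fix A assume "A \<in> sets (distr unit_interval unit_interval ?f)"
    then have A: "A \<in> sets unit_interval" by simp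
    have "emeasure (distr unit_interval unit_interval ?f) A =
        emeasure unit_interval (?f -` A \<inter> {0..1})"
      using emeasure_distr[OF block_perm_measurable[OF n \<sigma>] A] by simp
    then show "emeasure (distr unit_interval unit_interval ?f) A = emeasure unit_interval A"
      using leb_block_perm[OF n \<sigma> A] by (simp add: unit_interval.emeasure_eq_measure)
  qed simp
  ultimately show ?thesis using bij block_perm_measurable[OF n \<sigma>] by (simp add: mp_bijections_def)
qed

section \<open>Rearrangements, the cut distance and block means of graphons\<close>

lemma mp_in: "\<phi> \<in> mp_bijections \<Longrightarrow> x \<in> {0..1} \<Longrightarrow> \<phi> x \<in> {0..1}"
  using bij_betwE[OF mp_bijectionsD(1)] by blast

lemma pullback_in:
  assumes W: "W \<in> prob_graphons k" and \<phi>: "\<phi> \<in> mp_bijections"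
  shows "pullback \<phi> W \<in> prob_graphons k"
  using W mp_in[OF \<phi>] pullback_bdd[OF W _ \<phi>]
  by (auto simp: prob_graphons_def pullback_def bdd_fun_def simp del: atLeastAtMost_iff)

lemma cut_dist_pullback_self:
  assumes W: "W \<in> prob_graphons k" and \<phi>: "\<phi> \<in> mp_bijections"
  shows "cut_dist k (pullback \<phi> W) W = 0"
  using cut_dist_lower[OF pullback_in[OF assms] W \<phi>] cut_dist_nonneg[OF pullback_in[OF assms] W]
  by (simp add: vec_cut_norm_def cut_norm_zero)

lemma cut_dist_le_norm:
  assumes "U \<in> prob_graphons k" "W \<in> prob_graphons k"
  shows "cut_dist k U W \<le> vec_cut_norm k (\<lambda>a p. U a p - W a p)"
  using cut_dist_lower[OF assms id_mp] by (simp add: pullback_def)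

text \<open>A graphon is at distance zero from each of its pullbacks, so both sides may be
  rearranged before they are compared.\<close>

lemma cut_dist_le_pullbacks:
  assumes U: "U \<in> prob_graphons k" and W: "W \<in> prob_graphons k"
    and \<phi>: "\<phi> \<in> mp_bijections" and \<psi>: "\<psi> \<in> mp_bijections"
  shows "cut_dist k U W \<le> vec_cut_norm k (\<lambda>a p. pullback \<phi> U a p - pullback \<psi> W a p)"
proof -
  note U' = pullback_in[OF U \<phi>] and W' = pullback_in[OF W \<psi>]
  have "cut_dist k U W \<le> cut_dist k U (pullback \<phi> U) + (cut_dist k (pullback \<phi> U) (pullback \<psi> W) +
      cut_dist k (pullback \<psi> W) W)"
    using cut_dist_triangle[OF U U' W] cut_dist_triangle[OF U' W' W] by linarith
  then show ?thesis
    using cut_dist_pullback_self[OF U \<phi>] cut_dist_pullback_self[OF W \<psi>] cut_dist_commute[OF U U']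
      cut_dist_le_norm[OF U' W'] by linarith
qed

lemma graphon_01:
  assumes "W \<in> prob_graphons k" "a \<in> {1..k}" "x \<in> {0..1}" "y \<in> {0..1}"
  shows "W a (x, y) \<in> {0..1}"
proof -
  have "(\<lambda>a. W a (x, y)) \<in> prob_simplex k" using assms(1,3,4) by (simp add: prob_graphons_def)
  then show ?thesis using assms(2) unfolding prob_simplex_def by blast
qed

lemma graphon_avg_err:
  assumes "W \<in> prob_graphons k" "a \<in> {1..k}"
  shows "(\<lambda>n. avg_err n (W a)) \<longlonglongrightarrow> 0"
  using graphon_01[OF assms]
  by (intro avg_err_tendsto prob_graphons_bdd[OF assms]) (auto simp: space_unit_square)

lemma avg_mono:
  assumes "bdd_fun f" "bdd_fun g" "\<And>p. p \<in> space unit_square \<Longrightarrow> f p \<le> g p"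
  shows "avg n f u v \<le> avg n g u v"
  unfolding avg_def set_lebesgue_integral_def
  using assms bdd_fun_set_integral[OF assms(1) cell_rect_sets[OF labelling_block]]
      bdd_fun_set_integral[OF assms(2) cell_rect_sets[OF labelling_block]]
  by (intro mult_left_mono integral_mono) (auto simp: set_integrable_def indicator_def)

lemma avg_const:
  assumes n: "n \<ge> 1"
  shows "avg n (\<lambda>_. c) u v = (if u \<in> {1..n} \<and> v \<in> {1..n} then c else 0)"
proof -
  have "avg n (\<lambda>_. c) u v = c * avg n (\<lambda>_. 1) u v" using avg_cmult[of n c "\<lambda>_. 1"] by simp
  also have "avg n (\<lambda>_. 1) u v = (real n)\<^sup>2 * (leb (cell (block n) u) * leb (cell (block n) v))"
    unfolding avg_def
    using integral_indicator_sq[OF cell_rect_sets[OF labelling_block], of n u v]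
      measure_rect[OF cell_sets[OF labelling_block] cell_sets[OF labelling_block], of n u n v]
    by (simp add: set_lebesgue_integral_def)
  finally show ?thesis unfolding leb_cell_block[OF n] using n by (auto simp: power2_eq_square)
qed

lemma avg_01:
  assumes n: "n \<ge> 1" and f: "bdd_fun f" and f01: "\<And>p. p \<in> space unit_square \<Longrightarrow> f p \<in> {0..1}"
  shows "avg n f u v \<in> {0..1}"
proof -
  have "avg n (\<lambda>_. 0) u v \<le> avg n f u v" "avg n f u v \<le> avg n (\<lambda>_. 1) u v"
    using f01 by (intro avg_mono f bdd_fun_const; force)+
  then show ?thesis using avg_const[OF n, of 0 u v] avg_const[OF n, of 1 u v] by (auto split:
      if_splits)
qed

lemma graphon_avg_01:
  assumes "n \<ge> 1" "W \<in> prob_graphons k" "a \<in> {1..k}"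
  shows "avg n (W a) u v \<in> {0..1}"
  using graphon_01[OF assms(2,3)]
  by (intro avg_01 assms prob_graphons_bdd[OF assms(2,3)]) (auto simp: space_unit_square)

text \<open>The points of \<open>{1..N}\<close> are labelled by the sets of the cut decomposition they belong to.\<close>

lemma label_regularity:
  fixes \<epsilon> :: real
  assumes eps: "\<epsilon> > 0"
  shows "\<exists>L B. B \<ge> 0 \<and> (\<forall>N\<ge>1. \<forall>A :: nat \<Rightarrow> nat \<Rightarrow> nat \<Rightarrow> real.
    (\<forall>a\<in>{1..k}. \<forall>u v. A a u v \<in> {0..1}) \<longrightarrow>
    (\<exists>s F. s 0 = 0 \<and> (\<forall>u. s u \<le> L) \<and> (\<forall>a i j. \<bar>F a i j\<bar> \<le> B) \<and>
      (\<forall>a\<in>{1..k}. \<forall>S\<subseteq>{1..N}. \<forall>T\<subseteq>{1..N}.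
         \<bar>\<Sum>u\<in>S. \<Sum>v\<in>T. A a u v - F a (s u) (s v :: nat)\<bar> \<le> \<epsilon> * (real N)\<^sup>2)))"
proof -
  \<comment> \<open>Entries in the unit interval have square sum at most \<open>N^2\<close>, so
    \<open>m \<ge> 1 / \<epsilon>^2\<close> rounds exhaust the energy for every
    \<open>N\<close>.\<close>
  obtain m where m: "1 / \<epsilon>\<^sup>2 \<le> real m" using real_arch_simple by blast
  then have m: "1 \<le> real m * \<epsilon>\<^sup>2" using eps by (simp add: field_simps)
  \<comment> \<open>A test consists of a colour, an index in the decomposition and a side, rows for
    \<open>True\<close> and columns for \<open>False\<close>. A label codes the set of tests that a
    point passes, so the number of labels depends on \<open>k\<close> and \<open>m\<close>
    only.\<close>
  define U where "U = {1..k} \<times> {..<m} \<times> (UNIV :: bool set)"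
  have finU: "finite (Pow U)" by (simp add: U_def)
  obtain e where e: "bij_betw e (Pow U) {0..<card (Pow U)}" using ex_bij_betw_finite_nat[OF finU]
    by blast
  define L where "L = card (Pow U)"
  define d where "d = inv_into (Pow U) e"
  have d: "d (e X) = X" if "X \<subseteq> U" for X
    using e that by (simp add: d_def bij_betw_def)
  show ?thesis
  proof (intro exI[of _ L] exI[of _ "real m"] conjI allI impI)
    fix N :: nat and A :: "nat \<Rightarrow> nat \<Rightarrow> nat \<Rightarrow> real"
    assume N: "1 \<le> N" and A: "\<forall>a\<in>{1..k}. \<forall>u v. A a u v \<in> {0..1}"
    define P where "P a c S T \<longleftrightarrow> (\<forall>i<m. \<bar>c i\<bar> \<le> 1) \<and> (\<forall>S'\<subseteq>{1..N}. \<forall>T'\<subseteq>{1..N}.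
      \<bar>\<Sum>u\<in>S'. \<Sum>v\<in>T'. A a u v - (\<Sum>i<m. c i * (of_bool (u \<in> S i) * of_bool (v \<in> T i)))\<bar> \<le> \<epsilon> *
          (real (card {1..N}))\<^sup>2)"
      for a c and S T :: "nat \<Rightarrow> nat set"
    have "\<forall>a\<in>{1..k}. \<exists>t. P a (fst t) (fst (snd t)) (snd (snd t))"
    proof
      fix a assume a: "a \<in> {1..k}"
      have sq: "(\<Sum>u\<in>{1..N}. \<Sum>v\<in>{1..N}. (A a u v)\<^sup>2) \<le> (\<Sum>u\<in>{1..N}. \<Sum>v\<in>{1..N}. 1)"
        using A a by (intro sum_mono) (auto simp: power_le_one)
      also have "\<dots> = (real (card {1..N}))\<^sup>2" by (simp add: power2_eq_square)
      finally have 1: "(\<Sum>u\<in>{1..N}. \<Sum>v\<in>{1..N}. (A a u v)\<^sup>2) \<le> 1\<^sup>2 * (real (card {1..N}))\<^sup>2" by simp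
      have "1\<^sup>2 * (real (card {1..N}))\<^sup>2 \<le> real m * \<epsilon>\<^sup>2 * (real (card {1..N}))\<^sup>2" using m
        by (intro mult_right_mono) auto
      note 2 = order_trans[OF 1 this]
      have "\<exists>c S T. P a c S T"
        unfolding P_def by (rule cut_decomposition[OF _ _ eps _ 1 2]) (use N in auto)
      then obtain c S T where "P a c S T" by (elim exE)
      then show "\<exists>t. P a (fst t) (fst (snd t)) (snd (snd t))" by (intro exI[of _ "(c, S, T)"]) simp
    qed
    from bchoice[OF this] obtain f where f: "\<forall>a\<in>{1..k}.
        P a (fst (f a)) (fst (snd (f a))) (snd (snd (f a)))"
      by (elim exE)
    define c where "c a = fst (f a)" for a
    define S where "S a = fst (snd (f a))" for a
    define T where "T a = snd (snd (f a))" for a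
    have P: "P a (c a) (S a) (T a)" if "a \<in> {1..k}" for a using f that
      by (simp add: c_def S_def T_def)
    have c: "\<bar>c a i\<bar> \<le> 1" if "a \<in> {1..k}" "i < m" for a i
      using P[OF that(1)] that(2) unfolding P_def by blast
    have dec: "\<bar>\<Sum>u\<in>S'. \<Sum>v\<in>T'. A a u v - (\<Sum>i<m.
        c a i * (of_bool (u \<in> S a i) * of_bool (v \<in> T a i)))\<bar> \<le> \<epsilon> * (real N)\<^sup>2"
      if "a \<in> {1..k}" "S' \<subseteq> {1..N}" "T' \<subseteq> {1..N}" for a S' T'
      using P[OF that(1), unfolded P_def, THEN conjunct2, rule_format, OF that(2,3)] by simp
    define lab where "lab u = {(a, i, z). (a, i, z) \<in> U \<and> (if z then u \<in> S a i else u \<in> T a i)}"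
        for u
    \<comment> \<open>Index 0 receives the least label by fiat, so that sorted labels remain
      monotone at the point 0.\<close>
    define s where "s u = (if u = 0 then 0 else e (lab u))" for u
    define F where "F a x y = (if a \<in> {1..k} then \<Sum>i<m.
        c a i * (of_bool ((a, i, True) \<in> d x) * of_bool ((a, i, False) \<in> d y)) else 0)" for a x y
    have labU: "lab u \<subseteq> U" for u by (auto simp: lab_def U_def)
    have ds: "d (s u) = lab u" if "u \<noteq> 0" for u using that d[OF labU] by (simp add: s_def)
    have eL: "e (lab u) \<le> L" for u
      using bspec[OF bij_betwE[OF e], of "lab u"] labU[of u] by (simp add: L_def)
    have FA: "F a (s u) (s v) = (\<Sum>i<m. c a i * (of_bool (u \<in> S a i) * of_bool (v \<in> T a i)))"
      if "a \<in> {1..k}" "u \<noteq> 0" "v \<noteq> 0" for a u v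
      using that unfolding F_def ds[OF that(2)] ds[OF that(3)]
      by (auto simp: lab_def U_def intro!: sum.cong)
    have Fb: "\<bar>F a x y\<bar> \<le> real m" for a x y
    proof (cases "a \<in> {1..k}")
      case True
      have "\<bar>F a x y\<bar> \<le> (\<Sum>i<m. \<bar>c a i * (of_bool ((a, i, True) \<in> d x) * of_bool ((a, i,
          False) \<in> d y))\<bar>)"
        using True by (simp add: F_def sum_abs)
      also have "\<dots> \<le> (\<Sum>i<m. 1)" using c True by (intro sum_mono) auto
      finally show ?thesis by simp
    qed (auto simp: F_def)
    have cut: "\<bar>\<Sum>u\<in>S'. \<Sum>v\<in>T'. A a u v - F a (s u) (s v)\<bar> \<le> \<epsilon> * (real N)\<^sup>2"
      if a: "a \<in> {1..k}" and ST: "S' \<subseteq> {1..N}" "T' \<subseteq> {1..N}" for a S' T'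
    proof -
      have nz: "u \<noteq> 0" if "u \<in> S' \<or> u \<in> T'" for u using ST that by force
      have "(\<Sum>u\<in>S'. \<Sum>v\<in>T'. A a u v - F a (s u) (s v)) =
        (\<Sum>u\<in>S'. \<Sum>v\<in>T'. A a u v - (\<Sum>i<m. c a i * (of_bool (u \<in> S a i) * of_bool (v \<in> T a i))))"
        using nz by (intro sum.cong refl) (simp add: FA[OF a])
      then show ?thesis using dec[OF a ST] by (simp only:)
    qed
    show "\<exists>s F. s 0 = 0 \<and> (\<forall>u. s u \<le> L) \<and> (\<forall>a i j. \<bar>F a i j\<bar> \<le> real m) \<and>
      (\<forall>a\<in>{1..k}. \<forall>S\<subseteq>{1..N}. \<forall>T\<subseteq>{1..N}.
         \<bar>\<Sum>u\<in>S. \<Sum>v\<in>T. A a u v - F a (s u) (s v :: nat)\<bar> \<le> \<epsilon> * (real N)\<^sup>2)"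
      by (intro exI[of _ s] exI[of _ F] conjI allI ballI impI Fb cut) (auto simp: s_def eL)
  qed simp
qed

section \<open>Total boundedness\<close>

lemma block_eq_iff:
  assumes "D \<ge> 1" "x \<in> {0..1}" "block D x \<noteq> 0"
  shows "(real (block D x) - 1) / real D < x" "x \<le> real (block D x) / real D" "block D x \<in> {1..D}"
proof -
  show b: "block D x \<in> {1..D}" using assms labelling_block[of D] by (auto simp: labelling_def)
  show "(real (block D x) - 1) / real D < x" "x \<le> real (block D x) / real D"
    using cell_self[OF assms(2), of "block D"] unfolding cell_block[OF b] by auto
qed

lemma block_eq_0: "D \<ge> 1 \<Longrightarrow> x \<in> {0..1} \<Longrightarrow> block D x = 0 \<Longrightarrow> x = 0"
  using block_in[of D x] by force

text \<open>A monotone label with values at most \<open>L\<close> increases by at most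
  \<open>L\<close> in total, so few blocks contain a change. A mismatch in either coordinate costs
  at most \<open>2 * B\<close>, and the two coordinates together give
  \<open>4 * B * L / D\<close>.\<close>

lemma monotone_label_coarsen:
  assumes D: "D \<ge> 1" and t: "labelling L t" and mono: "mono_on {0..1} t"
    and B: "\<And>i j. \<bar>F i j\<bar> \<le> B"
  defines "\<tau> \<equiv> \<lambda>i. t (real i / real D)"
  shows "(LINT p|unit_square. \<bar>step t F p - step (block D) (\<lambda>i j. F (\<tau> i) (\<tau> j)) p\<bar>) \<le>
      4 * B * real L / real D"
proof -
  have B0: "B \<ge> 0" using B[of 0 0] by linarith
  \<comment> \<open>\<open>g i\<close> is the increase of the label across block \<open>i\<close>,
    which telescopes; \<open>w\<close> marks the points whose label differs from the one at the
    right end of their block. Labels are integers, hence a mismatch forces an increase of at least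
    one.\<close>
  define g where "g i = (if i = 0 then 0 else real (\<tau> i) - real (\<tau> (i - 1)))" for i
  define w where "w x = (if t x = \<tau> (block D x) then 0 else 1::real)" for x
  have \<tau>mono: "\<tau> i \<le> \<tau> j" if "i \<le> j" "j \<le> D" for i j
    unfolding \<tau>_def using that D by (intro mono_onD[OF mono]) (auto simp: field_simps)
  have wg: "w x \<le> g (block D x)" if x: "x \<in> {0..1}" for x
  proof (cases "block D x = 0")
    case True
    then show ?thesis using block_eq_0[OF D x True] by (simp add: w_def g_def \<tau>_def)
  next
    case False
    note b = block_eq_iff[OF D x False]
    have m: "t ((real (block D x) - 1) / real D) \<le> t x" "t x \<le> t (real (block D x) / real D)"
      using b x D by (intro mono_onD[OF mono]; auto simp: field_simps)+
    have "real (block D x - 1) = real (block D x) - 1" using False by (simp add: of_nat_diff)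
    then have "\<tau> (block D x - 1) \<le> t x" "t x \<le> \<tau> (block D x)" using m by (simp_all add: \<tau>_def)
    then show ?thesis using False by (simp add: w_def g_def)
  qed
  have "(LINT p|unit_square. \<bar>step t F p - step (block D) (\<lambda>i j. F (\<tau> i) (\<tau> j)) p\<bar>)
      \<le> (LINT p|unit_square. step (block D) (\<lambda>i j. 2 * B * (g i + g j)) p)"
  proof (intro integral_mono bdd_fun_integrable bdd_fun_abs bdd_fun_diff bdd_fun_step_block
      bdd_fun_step[OF t])
    fix p assume "p \<in> space unit_square"
    then obtain x y where p: "p = (x, y)" and xy: "x \<in> {0..1}" "y \<in> {0..1}"
      by (auto simp: space_unit_square)
    have "\<bar>F (t x) (t y) - F (\<tau> (block D x)) (\<tau> (block D y))\<bar> \<le> 2 * B * (w x + w y)"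
    proof (cases "t x = \<tau> (block D x) \<and> t y = \<tau> (block D y)")
      case True
      then show ?thesis by (simp add: w_def)
    next
      case False
      have "\<bar>F (t x) (t y) - F (\<tau> (block D x)) (\<tau> (block D y))\<bar> \<le> 2 * B * 1"
        using B[of "t x" "t y"] B[of "\<tau> (block D x)" "\<tau> (block D y)"] by linarith
      also have "\<dots> \<le> 2 * B * (w x + w y)"
        using False B0 by (intro mult_left_mono) (auto simp: w_def)
      finally show ?thesis .
    qed
    also have "\<dots> \<le> 2 * B * (g (block D x) + g (block D y))"
      using wg xy B0 by (intro mult_left_mono add_mono) auto
    finally show "\<bar>step t F p - step (block D) (\<lambda>i j. F (\<tau> i) (\<tau> j)) p\<bar> \<le>
        step (block D) (\<lambda>i j. 2 * B * (g i + g j)) p"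
      by (simp add: step_def p)
  qed
  also have "\<dots> = (\<Sum>i\<le>D. \<Sum>j\<le>D. 2 * B * (g i + g j) * (leb (cell (block D) i) *
      leb (cell (block D) j)))"
    by (rule integral_step[OF labelling_block])
  also have "\<dots> = (\<Sum>i\<in>{1..D}. \<Sum>j\<in>{1..D}. 2 * B * (g i + g j) * (1 / (real D * real D)))"
    by (simp add: sum_atMost_split leb_cell_block[OF D])
  also have "\<dots> = 2 * B * (1 / (real D * real D)) * (\<Sum>i\<in>{1..D}. \<Sum>j\<in>{1..D}. g i + g j)"
    unfolding sum_distrib_left by (intro sum.cong refl) (simp add: mult_ac)
  also have "(\<Sum>i\<in>{1..D}. \<Sum>j\<in>{1..D}. g i + g j) = 2 * (real D * (\<Sum>i\<in>{1..D}. g i))"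
    by (simp add: sum.distrib sum_distrib_left)
  also have "(\<Sum>i\<in>{1..D}. g i) = real (\<tau> D) - real (\<tau> 0)"
    using sum_telescope''[of 0 D "\<lambda>i. real (\<tau> i)"]
    by (simp add: g_def atLeastSucAtMost_greaterThanAtMost[symmetric])
  also have "2 * B * (1 / (real D * real D)) * (2 * (real D * (real (\<tau> D) - real (\<tau> 0)))) =
      4 * B * (real (\<tau> D) - real (\<tau> 0)) / real D"
    using D by (simp add: field_simps)
  also have "\<dots> \<le> 4 * B * real L / real D"
  proof -
    have "\<tau> D \<le> L" using t D by (auto simp: \<tau>_def labelling_def)
    then have "real (\<tau> D) - real (\<tau> 0) \<le> real L" by linarith
    then show ?thesis using B0 by (intro divide_right_mono mult_left_mono) auto
  qed
  finally show ?thesis .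
qed

lemma labelling_comp:
  assumes "labelling n b" "\<And>i. f i \<le> m" shows "labelling m (\<lambda>x. f (b x))"
  using assms measurable_compose[of b unit_interval "count_space UNIV" f "count_space UNIV"]
  by (auto simp: labelling_def)

lemma cut_norm_cong:
  assumes "\<And>p. p \<in> space unit_square \<Longrightarrow> F p = G p" shows "cut_norm F = cut_norm G"
proof -
  have "(LINT p:E|unit_square. F p) = (LINT p:E|unit_square. G p)" for E
    unfolding set_lebesgue_integral_def
    by (intro Bochner_Integration.integral_cong) (auto simp: assms)
  then show ?thesis by (simp add: cut_norm_def)
qed

text \<open>The point is that \<open>D\<close> and \<open>B\<close> are chosen before
  \<open>W\<close>. The three thirds of \<open>\<epsilon>\<close> pay for averaging \<open>W\<close>
  over a fine grid, for the cut decomposition of the averaged matrix, and for pushing the sorted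
  labels onto the coarse grid.\<close>

theorem grid_approximation:
  fixes \<epsilon> :: real
  assumes eps: "\<epsilon> > 0"
  shows "\<exists>D\<ge>1. \<exists>B. \<forall>W\<in>prob_graphons k. \<exists>\<phi>\<in>mp_bijections. \<exists>H. (\<forall>a i j. \<bar>H a i j\<bar> \<le> B) \<and>
    (\<forall>a\<in>{1..k}. cut_norm (\<lambda>p. pullback \<phi> W a p - step (block D) (H a) p) \<le> \<epsilon>)"
proof -
  have eps3: "\<epsilon> / 3 > 0" using eps by simp
  obtain L B where B: "B \<ge> 0" and reg: "\<forall>N\<ge>1. \<forall>A :: nat \<Rightarrow> nat \<Rightarrow> nat \<Rightarrow> real.
    (\<forall>a\<in>{1..k}. \<forall>u v. A a u v \<in> {0..1}) \<longrightarrow>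
    (\<exists>s F. s 0 = 0 \<and> (\<forall>u. s u \<le> L) \<and> (\<forall>a i j. \<bar>F a i j\<bar> \<le> B) \<and>
      (\<forall>a\<in>{1..k}. \<forall>S\<subseteq>{1..N}. \<forall>T\<subseteq>{1..N}.
         \<bar>\<Sum>u\<in>S. \<Sum>v\<in>T. A a u v - F a (s u) (s v :: nat)\<bar> \<le> \<epsilon> / 3 * (real N)\<^sup>2))"
    using label_regularity[OF eps3, of k] by (elim exE conjE)
  obtain D where D: "4 * B * real L * 3 / \<epsilon> \<le> real D" "D \<ge> 1"
  proof -
    obtain D where "4 * B * real L * 3 / \<epsilon> \<le> real D" using real_arch_simple by blast
    then show ?thesis using that[of "max D 1"] by simp
  qed
  have D': "4 * B * real L / real D \<le> \<epsilon> / 3" using D eps by (simp add: field_simps)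
  show ?thesis
  proof (intro exI[of _ D] exI[of _ B] conjI ballI D(2))
    fix W assume W: "W \<in> prob_graphons k"
    have "\<forall>\<^sub>F n in sequentially. avg_err n (W a) < \<epsilon> / 3" if "a \<in> {1..k}" for a
      using graphon_avg_err[OF W that] eps by (intro order_tendstoD(2)) auto
    then have "\<forall>\<^sub>F n in sequentially. \<forall>a\<in>{1..k}. avg_err n (W a) < \<epsilon> / 3"
      by (intro eventually_ball_finite) auto
    then have "\<forall>\<^sub>F n in sequentially. (\<forall>a\<in>{1..k}. avg_err n (W a) < \<epsilon> / 3) \<and> n \<ge> 1"
      by (intro eventually_conj eventually_ge_at_top)
    \<comment> \<open>The fine grid may depend on \<open>W\<close>: after sorting, its size no
      longer enters the error, only \<open>L\<close>, \<open>B\<close> and \<open>D\<close>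
      do.\<close>
    then obtain N where N: "\<forall>a\<in>{1..k}. avg_err N (W a) < \<epsilon> / 3" "N \<ge> 1"
      by (auto dest: eventually_happens)
    define A where "A a = avg N (W a)" for a
    have A: "\<forall>a\<in>{1..k}. \<forall>u v. A a u v \<in> {0..1}"
      using graphon_avg_01[OF N(2) W] unfolding A_def by blast
    obtain s F where s0: "s 0 = 0" and sL: "\<forall>u. s u \<le> L" and F: "\<forall>a i j. \<bar>F a i j\<bar> \<le> B" and
      cut: "\<forall>a\<in>{1..k}. \<forall>S\<subseteq>{1..N}. \<forall>T\<subseteq>{1..N}.
         \<bar>\<Sum>u\<in>S. \<Sum>v\<in>T. A a u v - F a (s u) (s v :: nat)\<bar> \<le> \<epsilon> / 3 * (real N)\<^sup>2"
      using mp[OF spec[OF mp[OF spec[OF reg, of N] N(2)], of A] A] by (elim exE conjE)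
    obtain \<sigma> where \<sigma>: "\<sigma> permutes {1..N}" "mono_on {1..N} (s \<circ> \<sigma>)"
      using sorting_permutation by blast
    define \<phi> where "\<phi> = block_perm N \<sigma>"
    have \<phi>: "\<phi> \<in> mp_bijections" unfolding \<phi>_def by (rule block_perm_mp[OF N(2) \<sigma>(1)])
    have \<sigma>0: "\<sigma> 0 = 0" using permutes_not_in[OF \<sigma>(1)] by simp
    define t where "t x = s (\<sigma> (block N x))" for x
    have t: "labelling L t"
      unfolding t_def using labelling_comp[OF labelling_block[of N], of "\<lambda>u. s (\<sigma> u)" L] sL by simp
    have mono: "mono_on {0..1} t"
    proof (rule mono_onI)
      fix x y :: real assume xy: "x \<in> {0..1}" "y \<in> {0..1}" "x \<le> y"
      show "t x \<le> t y"
      proof (cases "block N x = 0")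
        case True
        then show ?thesis by (simp add: t_def \<sigma>0 s0)
      next
        case False
        have "block N x \<le> block N y" by (rule block_mono[OF xy(3)])
        moreover have "block N y \<le> N" using labelling_block[of N] xy by (auto simp: labelling_def)
        ultimately show ?thesis using False mono_onD[OF \<sigma>(2), of "block N x" "block N y"]
          by (simp add: t_def)
      qed
    qed
    define H where "H a i j = F a (t (real i / real D)) (t (real j / real D))" for a i j
    have "cut_norm (\<lambda>p. pullback \<phi> W a p - step (block D) (H a) p) \<le> \<epsilon>" if a: "a \<in> {1..k}" for a
    proof -
      let ?P = "\<lambda>f :: real \<times> real \<Rightarrow> real. (\<lambda>(x, y). f (\<phi> x, \<phi> y))"
      let ?b = "block N"
      define G where "G u v = F a (s u) (s v)" for u v
      note Wb = prob_graphons_bdd[OF W a]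
      have b1: "bdd_fun (pullback \<phi> W a)" by (rule pullback_bdd[OF W a \<phi>])
      have b2: "bdd_fun (?P (step ?b (A a)))" "bdd_fun (?P (step ?b G))"
        by (intro bdd_fun_comp bdd_fun_step_block \<phi>)+
      have b3: "bdd_fun (step (block D) (H a))" by (rule bdd_fun_step_block)
      have 1: "cut_norm (\<lambda>p. pullback \<phi> W a p - ?P (step ?b (A a)) p) \<le> \<epsilon> / 3"
      proof -
        have "cut_norm (\<lambda>p. pullback \<phi> W a p - ?P (step ?b (A a)) p) =
            cut_norm (?P (\<lambda>p. W a p - step ?b (A a) p))"
          by (intro cut_norm_cong) (auto simp: pullback_def)
        also have "\<dots> \<le> cut_norm (\<lambda>p. W a p - step ?b (A a) p)"
          by (intro cut_norm_comp_le bdd_fun_diff Wb bdd_fun_step_block \<phi>)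
        also have "\<dots> \<le> (LINT p|unit_square. \<bar>W a p - step ?b (A a) p\<bar>)"
          by (intro cut_norm_le_L1 bdd_fun_diff Wb bdd_fun_step_block)
        also have "\<dots> = avg_err N (W a)" by (simp add: avg_err_def A_def abs_minus_commute)
        finally show ?thesis using N a by force
      qed
      have 2: "cut_norm (\<lambda>p. ?P (step ?b (A a)) p - ?P (step ?b G) p) \<le> \<epsilon> / 3"
      proof -
        have "cut_norm (\<lambda>p. ?P (step ?b (A a)) p - ?P (step ?b G) p) =
            cut_norm (?P (step ?b (\<lambda>u v. A a u v - G u v)))"
          by (intro cut_norm_cong) (auto simp: step_def)
        also have "\<dots> \<le> cut_norm (step ?b (\<lambda>u v. A a u v - G u v))"
          by (intro cut_norm_comp_le bdd_fun_step_block \<phi>)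
        also have "\<dots> \<le> \<epsilon> / 3"
          using cut a by (intro cut_norm_step_le[OF N(2)]) (auto simp: G_def)
        finally show ?thesis .
      qed
      have 3: "cut_norm (\<lambda>p. ?P (step ?b G) p - step (block D) (H a) p) \<le> \<epsilon> / 3"
      proof -
        have bt: "block N (\<phi> x) = \<sigma> (block N x)" if "x \<in> {0..1}" for x
          unfolding \<phi>_def by (rule block_block_perm[OF N(2) \<sigma>(1) that])
        have "cut_norm (\<lambda>p. ?P (step ?b G) p - step (block D) (H a) p) =
            cut_norm (\<lambda>p. step t (F a) p - step (block D) (H a) p)"
          by (intro cut_norm_cong) (auto simp: space_unit_square step_def bt t_def G_def simp del:
              atLeastAtMost_iff)
        also have "\<dots> \<le> (LINT p|unit_square. \<bar>step t (F a) p - step (block D) (H a) p\<bar>)"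
          by (intro cut_norm_le_L1 bdd_fun_diff bdd_fun_step[OF t] bdd_fun_step_block)
        also have "\<dots> \<le> 4 * B * real L / real D"
          unfolding H_def[abs_def] using F by (intro monotone_label_coarsen[OF D(2) t mono]) auto
        finally show ?thesis using D' by linarith
      qed
      show ?thesis
        using cut_norm_triangle[OF b1 b2(1) b3] cut_norm_triangle[OF b2 b3] 1 2 3 by linarith
    qed
    then show "\<exists>\<phi>\<in>mp_bijections. \<exists>H. (\<forall>a i j. \<bar>H a i j\<bar> \<le> B) \<and>
      (\<forall>a\<in>{1..k}. cut_norm (\<lambda>p. pullback \<phi> W a p - step (block D) (H a) p) \<le> \<epsilon>)"
      using \<phi> F by (intro bexI[of _ \<phi>] exI[of _ H]) (auto simp: H_def)
  qed
qed

theorem totally_bounded: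
  fixes \<epsilon> :: real
  assumes eps: "\<epsilon> > 0"
  shows "\<exists>\<F>. finite \<F> \<and> \<F> \<subseteq> prob_graphons k \<and> (\<forall>W\<in>prob_graphons k. \<exists>V\<in>\<F>. cut_dist k V W < \<epsilon>)"
proof -
  \<comment> \<open>Two graphons with the same rounded coefficients differ by at most
    \<open>3 * \<eta>\<close> in each colour after alignment, and
    \<open>3 * k * \<eta> < \<epsilon>\<close>.\<close>
  define \<eta> where "\<eta> = \<epsilon> / (4 * (real k + 1))"
  have \<eta>: "\<eta> > 0" using eps by (simp add: \<eta>_def)
  obtain D B where D: "D \<ge> 1" and B: "\<forall>W\<in>prob_graphons k. \<exists>\<phi>\<in>mp_bijections. \<exists>H.
      (\<forall>a i j. \<bar>H a i j\<bar> \<le> B) \<and>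
    (\<forall>a\<in>{1..k}. cut_norm (\<lambda>p. pullback \<phi> W a p - step (block D) (H a) p) \<le> \<eta>)"
    using grid_approximation[OF \<eta>, of k] by (elim exE conjE)
  define P where "P W t \<longleftrightarrow> fst t \<in> mp_bijections \<and> (\<forall>a i j. \<bar>snd t a i j\<bar> \<le> B) \<and>
    (\<forall>a\<in>{1..k}. cut_norm (\<lambda>p. pullback (fst t) W a p - step (block D) (snd t a) p) \<le> \<eta>)" for W t
  have "\<forall>W\<in>prob_graphons k. \<exists>t. P W t"
  proof
    fix W assume "W \<in> prob_graphons k"
    then obtain \<phi> H where "\<phi> \<in> mp_bijections" "\<forall>a i j. \<bar>H a i j\<bar> \<le> B"
      "\<forall>a\<in>{1..k}. cut_norm (\<lambda>p. pullback \<phi> W a p - step (block D) (H a) p) \<le> \<eta>" using B by blast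
    then show "\<exists>t. P W t" by (intro exI[of _ "(\<phi>, H)"]) (simp add: P_def)
  qed
  from bchoice[OF this] obtain t where t: "\<forall>W\<in>prob_graphons k. P W (t W)" by (elim exE)
  define I where "I = {1..k} \<times> {..D} \<times> {..D}"
  \<comment> \<open>Rounding the coefficients to multiples of \<open>\<eta>\<close> leaves finitely
    many patterns; one graphon for each pattern forms the net.\<close>
  define f where "f W = (\<lambda>(a, i, j)\<in>I. \<lfloor>snd (t W) a i j / \<eta>\<rfloor>)" for W
  have "f ` prob_graphons k \<subseteq> I \<rightarrow>\<^sub>E {\<lfloor>- B / \<eta>\<rfloor>..\<lfloor>B / \<eta>\<rfloor>}"
  proof (intro image_subsetI)
    fix W assume "W \<in> prob_graphons k"
    then have b: "\<bar>snd (t W) a i j\<bar> \<le> B" for a i j using t by (simp add: P_def)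
    have "- B \<le> snd (t W) a i j" "snd (t W) a i j \<le> B" for a i j using b[of a i j] by linarith+
    then show "f W \<in> I \<rightarrow>\<^sub>E {\<lfloor>- B / \<eta>\<rfloor>..\<lfloor>B / \<eta>\<rfloor>}"
      using \<eta> unfolding f_def
      by (auto intro!: floor_mono divide_right_mono simp del: divide_minus_left simp:
          minus_divide_left)
  qed
  moreover have "finite (I \<rightarrow>\<^sub>E {\<lfloor>- B / \<eta>\<rfloor>..\<lfloor>B / \<eta>\<rfloor>})" by (intro finite_PiE) (auto simp: I_def)
  ultimately have fin: "finite (f ` prob_graphons k)" by (rule finite_subset)
  define g where "g = inv_into (prob_graphons k) f"
  have dist: "cut_dist k V W < \<epsilon>" if V: "V \<in> prob_graphons k" and W: "W \<in> prob_graphons k"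
      and eq: "f V = f W" for V W
  proof -
    define \<phi> where "\<phi> = fst (t V)"
    define \<psi> where "\<psi> = fst (t W)"
    define H where "H = snd (t V)"
    define K where "K = snd (t W)"
    have pV: "P V (t V)" and pW: "P W (t W)" using t V W by auto
    have mp: "\<phi> \<in> mp_bijections" "\<psi> \<in> mp_bijections" using pV pW
      by (simp_all add: P_def \<phi>_def \<psi>_def)
    have "cut_norm (\<lambda>p. pullback \<phi> V a p - pullback \<psi> W a p) \<le> 3 * \<eta>" if a: "a \<in> {1..k}" for a
    proof -
      have b: "bdd_fun (pullback \<phi> V a)" "bdd_fun (pullback \<psi> W a)"
        by (rule pullback_bdd[OF V a mp(1)], rule pullback_bdd[OF W a mp(2)])
      have 1: "cut_norm (\<lambda>p. pullback \<phi> V a p - step (block D) (H a) p) \<le> \<eta>"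
        "cut_norm (\<lambda>p. pullback \<psi> W a p - step (block D) (K a) p) \<le> \<eta>"
        using pV pW a unfolding P_def \<phi>_def \<psi>_def H_def K_def by blast+
      have close: "\<bar>H a i j - K a i j\<bar> \<le> \<eta>" if "i \<le> D" "j \<le> D" for i j
      proof -
        have "f V (a, i, j) = f W (a, i, j)" using eq by simp
        then have "\<lfloor>H a i j / \<eta>\<rfloor> = \<lfloor>K a i j / \<eta>\<rfloor>" using that a
          by (simp add: f_def I_def H_def K_def)
        then have "\<bar>H a i j / \<eta> - K a i j / \<eta>\<bar> \<le> 1" by linarith
        then have "\<bar>H a i j - K a i j\<bar> / \<eta> \<le> 1" using \<eta>
          by (simp add: abs_divide flip: diff_divide_distrib)
        then show ?thesis using \<eta> by (simp add: field_simps)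
      qed
      have "cut_norm (\<lambda>p. step (block D) (H a) p - step (block D) (K a) p) \<le>
          (LINT p|unit_square. \<bar>step (block D) (H a) p - step (block D) (K a) p\<bar>)"
        by (intro cut_norm_le_L1 bdd_fun_diff bdd_fun_step_block)
      also have "\<dots> \<le> (LINT p|unit_square. \<eta>)"
      proof (intro integral_mono bdd_fun_integrable bdd_fun_abs bdd_fun_diff bdd_fun_step_block
          bdd_fun_const)
        fix p assume "p \<in> space unit_square"
        then show "\<bar>step (block D) (H a) p - step (block D) (K a) p\<bar> \<le> \<eta>"
          using labelling_block[of D]
          by (auto simp: space_unit_square step_def labelling_def intro!: close)
      qed
      also have "\<dots> = \<eta>" using unit_square.prob_space
        by (subst Bochner_Integration.lebesgue_integral_const) simp
      finally have 2: "cut_norm (\<lambda>p. step (block D) (H a) p - step (block D) (K a) p) \<le> \<eta>" .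
      note s = bdd_fun_step_block[of D]
      show ?thesis
        using cut_norm_triangle[OF b(1) s b(2), of "H a"] cut_norm_triangle[OF s s b(2), of "H a"
            "K a"] 1 2
          cut_norm_minus_commute[of "pullback \<psi> W a" "step (block D) (K a)"] by linarith
    qed
    then have "vec_cut_norm k (\<lambda>a p. pullback \<phi> V a p - pullback \<psi> W a p) \<le> (\<Sum>a=1..k. 3 * \<eta>)"
      unfolding vec_cut_norm_def by (rule sum_mono)
    also have "\<dots> < \<epsilon>"
    proof -
      have "(4 * (real k + 1)) * \<eta> = \<epsilon>" by (simp add: \<eta>_def)
      then have "4 * (real k * \<eta>) + 4 * \<eta> = \<epsilon>" by (simp add: algebra_simps)
      moreover have "real k * \<eta> \<ge> 0" using \<eta> by simp
      moreover have "(\<Sum>a=1..k. 3 * \<eta>) = 3 * (real k * \<eta>)" by simp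
      ultimately show ?thesis using \<eta> by linarith
    qed
    finally show ?thesis using cut_dist_le_pullbacks[OF V W mp] by linarith
  qed
  show ?thesis
  proof (intro exI[of _ "g ` f ` prob_graphons k"] conjI ballI)
    show "finite (g ` f ` prob_graphons k)" by (rule finite_imageI[OF fin])
    show "g ` f ` prob_graphons k \<subseteq> prob_graphons k"
      unfolding g_def using inv_into_into[of _ f "prob_graphons k"] by blast
    fix W assume W: "W \<in> prob_graphons k"
    have "g (f W) \<in> prob_graphons k" "f (g (f W)) = f W"
      unfolding g_def
      using inv_into_into[OF imageI[OF W], of f] f_inv_into_f[OF imageI[OF W], of f] by simp_all
    then have "cut_dist k (g (f W)) W < \<epsilon>" using W by (intro dist)
    then show "\<exists>V\<in>g ` f ` prob_graphons k. cut_dist k V W < \<epsilon>" using W by blast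
  qed
qed

section \<open>Completeness and compactness\<close>

lemma set_integral_unit_bounds:
  assumes f: "bdd_fun f" and f01: "\<And>p. p \<in> space unit_square \<Longrightarrow> f p \<in> {0..1}"
      and E: "E \<in> sets unit_square"
  shows "0 \<le> (LINT p:E|unit_square. f p)" "(LINT p:E|unit_square. f p) \<le> measure unit_square E"
proof -
  show "0 \<le> (LINT p:E|unit_square. f p)"
    unfolding set_lebesgue_integral_def
    by (intro Bochner_Integration.integral_nonneg_AE AE_I2) (use f01 in \<open>auto simp: indicator_def\<close>)
  have "(LINT p:E|unit_square. f p) \<le> (LINT p|unit_square. indicator E p)"
    unfolding set_lebesgue_integral_def
  proof (rule integral_mono)
    show "integrable unit_square (\<lambda>p. indicator E p *\<^sub>R f p)"
      using bdd_fun_set_integral[OF f E] by (simp add: set_integrable_def)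
    show "integrable unit_square (indicat_real E)"
      by (rule bdd_fun_integrable[OF bdd_fun_indicator[OF E]])
  qed (use f01 in \<open>auto simp: indicator_def\<close>)
  then show "(LINT p:E|unit_square. f p) \<le> measure unit_square E"
    by (simp only: integral_indicator_sq[OF E])
qed

lemma set_integral_disjoint_Un:
  assumes f: "bdd_fun f" and "A \<in> sets unit_square" "B \<in> sets unit_square" "A \<inter> B = {}"
  shows "(LINT p:A\<union>B|unit_square. f p) = (LINT p:A|unit_square. f p) + (LINT p:B|unit_square. f p)"
  using assms by (intro set_integral_Un bdd_fun_set_integral) auto

lemma sets_unit_square: "sets unit_square = sigma_sets ({0..1} \<times> {0..1}) {S \<times> T | S T.
    S \<in> sets unit_interval \<and> T \<in> sets unit_interval}"
  by (simp add: sets_pair_measure)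

text \<open>Uniform absolute continuity extends convergence from rectangles to all measurable sets.\<close>

lemma convergent_set_integrals:
  assumes f: "\<And>j. bdd_fun (f j)" and f01: "\<And>j p. p \<in> space unit_square \<Longrightarrow> f j p \<in> {0..1}"
    and rect: "\<And>S T. S \<in> sets unit_interval \<Longrightarrow> T \<in> sets unit_interval \<Longrightarrow>
        convergent (\<lambda>j :: nat. LINT p:S\<times>T|unit_square. f j p)"
    and E: "E \<in> sets unit_square"
  shows "convergent (\<lambda>j. LINT p:E|unit_square. f j p)"
proof -
  let ?G = "{S \<times> T | S T. S \<in> sets unit_interval \<and> T \<in> sets unit_interval}"
  let ?O = "{0..1} \<times> {0..1::real}"
  have int: "Int_stable ?G" by (rule Int_stable_pair_measure_generator)
  have sub: "?G \<subseteq> Pow ?O" using sets_unit_intervalD by blast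
  have top: "{0..1} \<in> sets unit_interval" using sets.top[of unit_interval] by simp
  have O: "?O \<in> sets unit_square" by (rule rect_sets[OF top top])
  have "E \<in> sigma_sets ?O ?G" using E by (subst (asm) sets_unit_square)
  with int sub show ?thesis
  proof (induction rule: sigma_sets_induct_disjoint)
    case (basic A)
    then show ?case using rect by auto
  next
    case empty
    then show ?case by (simp add: set_lebesgue_integral_def convergent_const)
  next
    case (compl A)
    then have A: "A \<in> sets unit_square" by (subst sets_unit_square) simp
    have OA: "?O - A \<in> sets unit_square" using O A by (rule sets.Diff)
    have "A \<subseteq> ?O" using sets.sets_into_space[OF A] by (simp add: space_unit_square)
    then have "(?O - A) \<union> A = ?O" by blast
    then have "(LINT p:?O - A|unit_square. f j p) =
        (LINT p:?O|unit_square. f j p) - (LINT p:A|unit_square. f j p)" for j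
      using set_integral_disjoint_Un[OF f OA A, of j] by (simp add: Diff_disjoint Int_commute)
    then show ?case using convergent_diff[OF rect[OF top top] compl.IH] by simp
  next
    case (union A)
    have "A i \<in> sigma_sets ?O ?G" for i using union(2) by auto
    then have A: "A i \<in> sets unit_square" for i by (subst sets_unit_square)
    then have U: "(\<Union>i. A i) \<in> sets unit_square" by blast
    show ?case
      unfolding Cauchy_convergent_iff[symmetric]
    proof (rule metric_CauchyI)
      fix e :: real assume e: "e > 0"
      have "(\<lambda>i. measure unit_square (A i)) sums measure unit_square (\<Union>i. A i)"
        using union A by (intro unit_square.finite_measure_UNION) auto
      then obtain N where N: "\<bar>(\<Sum>i<N. measure unit_square (A i)) - measure unit_square (\<Union>i. A i)\<bar> <
          e / 3"
        unfolding sums_def using LIMSEQ_D[of _ _ "e/3"] e by fastforce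
      have dis: "disjoint_family_on A {..<N}" using union(1) by (auto simp: disjoint_family_on_def)
      define B where "B = (\<Union>i<N. A i)"
      have B: "B \<in> sets unit_square" unfolding B_def using A by blast
      have mB: "measure unit_square B = (\<Sum>i<N. measure unit_square (A i))"
        unfolding B_def using A dis by (intro unit_square.finite_measure_finite_Union) auto
      have UB: "(\<Union>i. A i) - B \<in> sets unit_square" using U B by (rule sets.Diff)
      have "measure unit_square ((\<Union>i. A i) - B) =
          measure unit_square (\<Union>i. A i) - measure unit_square B"
        by (intro unit_square.finite_measure_Diff U B) (auto simp: B_def)
      then have small: "measure unit_square ((\<Union>i. A i) - B) < e / 3" using N mB by linarith
      have split: "(LINT p:(\<Union>i. A i)|unit_square. f j p) =
          (LINT p:B|unit_square. f j p) + (LINT p:(\<Union>i. A i) - B|unit_square. f j p)" for j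
      proof -
        have "B \<union> ((\<Union>i. A i) - B) = (\<Union>i. A i)" by (auto simp: B_def)
        then show ?thesis using set_integral_disjoint_Un[OF f B UB Diff_disjoint, of j] by simp
      qed
      have "(LINT p:B|unit_square. f j p) = (\<Sum>i<N. LINT p:A i|unit_square. f j p)" for j
        unfolding B_def using A dis by (intro set_integral_finite_Union bdd_fun_set_integral f) auto
      moreover have "convergent (\<lambda>j. \<Sum>i<N. LINT p:A i|unit_square. f j p)"
        by (intro convergent_sum union.IH)
      ultimately have "Cauchy (\<lambda>j. LINT p:B|unit_square. f j p)"
        by (simp add: Cauchy_convergent_iff)
      then obtain M where M: "\<And>i j. i \<ge> M \<Longrightarrow> j \<ge> M \<Longrightarrow>
          dist (LINT p:B|unit_square. f i p) (LINT p:B|unit_square. f j p) < e / 3"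
        unfolding Cauchy_def using e by (meson divide_pos_pos zero_less_numeral)
      have "dist (LINT p:(\<Union>i. A i)|unit_square. f i p) (LINT p:(\<Union>i. A i)|unit_square. f j p) < e"
          if "i \<ge> M" "j \<ge> M" for i j
        using M[OF that] small set_integral_unit_bounds[OF f f01 UB, of i]
            set_integral_unit_bounds[OF f f01 UB, of j]
        unfolding split dist_real_def by linarith
      then show "\<exists>M. \<forall>m\<ge>M. \<forall>n\<ge>M. dist (LINT p:(\<Union>i. A i)|unit_square.
          f m p) (LINT p:(\<Union>i. A i)|unit_square. f n p) < e"
        by blast
    qed
  qed
qed

text \<open>Domination by a finite measure turns finite additivity into continuity at the empty set,
  hence into countable additivity. It also gives absolute continuity, so that Radon-Nikodym
  applies.\<close>

lemma density_of_dominated: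
  assumes L: "\<And>E. E \<in> sets unit_square \<Longrightarrow> 0 \<le> L E \<and> L E \<le> measure unit_square E"
    and add: "\<And>A B. A \<in> sets unit_square \<Longrightarrow> B \<in> sets unit_square \<Longrightarrow> A \<inter> B = {} \<Longrightarrow>
        L (A \<union> B) = L A + L B"
  shows "\<exists>g\<in>borel_measurable unit_square. \<forall>E\<in>sets unit_square.
      (\<integral>\<^sup>+p. g p * indicator E p \<partial>unit_square) = ennreal (L E)"
proof -
  define N where "N = measure_of (space unit_square) (sets unit_square) (\<lambda>E. ennreal (L E))"
  have L0: "L {} = 0" using L[of "{}"] by simp
  have pos: "positive (sets unit_square) (\<lambda>E. ennreal (L E))" using L0 by (simp add: positive_def)
  have "countably_additive (sets unit_square) (\<lambda>E. ennreal (L E))"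
  proof (rule sets.empty_continuous_imp_countably_additive[OF pos])
    show "additive (sets unit_square) (\<lambda>E. ennreal (L E))"
      using add L by (auto simp: additive_def ennreal_plus)
    show "(\<lambda>i. ennreal (L (A i))) \<longlonglongrightarrow> 0" if A: "range A \<subseteq> sets unit_square" "decseq A" "(\<Inter>i. A i) =
        {}" for A
    proof -
      have "(\<lambda>i. measure unit_square (A i)) \<longlonglongrightarrow> measure unit_square (\<Inter>i. A i)"
        by (intro unit_square.finite_Lim_measure_decseq A)
      then have lim: "(\<lambda>i. measure unit_square (A i)) \<longlonglongrightarrow> 0" using A(3) by simp
      have "(\<lambda>i. L (A i)) \<longlonglongrightarrow> 0"
        by (rule tendsto_sandwich[OF always_eventually always_eventually tendsto_const lim])
          (use L A(1) in blast)+
      then have "(\<lambda>i. ennreal (L (A i))) \<longlonglongrightarrow> ennreal 0" by (rule tendsto_ennrealI)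
      then show ?thesis by simp
    qed
  qed simp
  then have N: "emeasure N E = ennreal (L E)" if "E \<in> sets unit_square" for E
    unfolding N_def using pos that
    by (intro emeasure_measure_of_sigma) (auto simp: sets.sigma_algebra_axioms)
  have sN: "sets N = sets unit_square" unfolding N_def by (simp add: sets.sets_measure_of_eq)
  have "absolutely_continuous unit_square N"
    unfolding absolutely_continuous_def
  proof
    fix E assume "E \<in> null_sets unit_square"
    then have E: "E \<in> sets unit_square" "measure unit_square E = 0"
      by (auto simp: null_sets_def measure_def)
    then have "L E = 0" using L[OF E(1)] by linarith
    then show "E \<in> null_sets N" using N[OF E(1)] E(1) sN by (simp add: null_sets_def)
  qed
  then obtain g where g: "g \<in> borel_measurable unit_square" "density unit_square g = N"
    using unit_square.Radon_Nikodym[OF _ sN] by blast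
  have "(\<integral>\<^sup>+p. g p * indicator E p \<partial>unit_square) = ennreal (L E)" if "E \<in> sets unit_square" for E
    using emeasure_density[OF g(1) that] g(2) N[OF that] by simp
  then show ?thesis using g(1) by blast
qed

lemma swap_measurable: "(\<lambda>(x, y). (y, x)) \<in> unit_square \<rightarrow>\<^sub>M unit_square"
  by (rule measurable_pair_swap')

lemma set_integral_swap:
  assumes f: "bdd_fun f" and ST: "S \<in> sets unit_interval" "T \<in> sets unit_interval"
  shows "(LINT p:S\<times>T|unit_square. f (snd p, fst p)) = (LINT p:T\<times>S|unit_square. f p)"
proof -
  have "(LINT p:S\<times>T|unit_square. f (snd p, fst p)) =
      (\<integral>(x, y). (\<lambda>p. indicator (T\<times>S) p *\<^sub>R f p) (y, x) \<partial>unit_square)"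
    unfolding set_lebesgue_integral_def
    by (intro Bochner_Integration.integral_cong) (auto simp: indicator_def)
  also have "\<dots> = (LINT p:T\<times>S|unit_square. f p)"
    unfolding set_lebesgue_integral_def
    by (rule unit_pair.integral_product_swap)
      (intro borel_measurable_scaleR borel_measurable_indicator bdd_fun_measurable f rect_sets ST)
  finally show ?thesis .
qed

lemma AE_swap:
  assumes "AE p in unit_square. P p" shows "AE p in unit_square. P (snd p, fst p)"
proof -
  have "AE p in distr unit_square unit_square (\<lambda>(x, y). (y, x)). P p"
    using assms unfolding unit_pair.distr_pair_swap[symmetric] .
  from AE_distrD[OF swap_measurable this] show ?thesis by (simp add: case_prod_beta)
qed

text \<open>The limits extend from rectangles to all measurable sets and have densities. These sum
  to one only almost everywhere and need not be symmetric at every point, whereas a graphon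
  satisfies both conditions pointwise; the final \<open>W\<close> repairs this without changing any
  rectangle integral.\<close>

lemma limit_graphon:
  assumes k: "k \<ge> 1" and V: "\<And>j :: nat. V j \<in> prob_graphons k"
    and conv: "\<And>a S T. a \<in> {1..k} \<Longrightarrow> S \<in> sets unit_interval \<Longrightarrow> T \<in> sets unit_interval \<Longrightarrow>
      convergent (\<lambda>j. LINT p:S\<times>T|unit_square. V j a p)"
  shows "\<exists>W\<in>prob_graphons k. \<forall>a\<in>{1..k}. \<forall>S\<in>sets unit_interval. \<forall>T\<in>sets unit_interval.
    (\<lambda>j. LINT p:S\<times>T|unit_square. V j a p) \<longlonglongrightarrow> (LINT p:S\<times>T|unit_square. W a p)"
proof -
  have Vb: "bdd_fun (V j a)" if "a \<in> {1..k}" for j a by (rule prob_graphons_bdd[OF V that])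
  have V01: "V j a p \<in> {0..1}" if "a \<in> {1..k}" "p \<in> space unit_square" for j a p
    using graphon_01[OF V that(1)] that(2)
    by (auto simp: space_unit_square simp del: atLeastAtMost_iff)
  define L where "L a E = lim (\<lambda>j. LINT p:E|unit_square. V j a p)" for a E
  have lim: "(\<lambda>j. LINT p:E|unit_square. V j a p) \<longlonglongrightarrow> L a E" if "a \<in> {1..k}" "E \<in> sets unit_square"
      for a E
    unfolding L_def convergent_LIMSEQ_iff[symmetric]
    by (rule convergent_set_integrals[OF Vb[OF that(1)] V01[OF that(1)] conv[OF that(1)] that(2)])
  have L01: "0 \<le> L a E \<and> L a E \<le> measure unit_square E" if "a \<in> {1..k}" "E \<in> sets unit_square"
      for a E
    using LIMSEQ_le_const[OF lim[OF that]] LIMSEQ_le_const2[OF lim[OF that]]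
      set_integral_unit_bounds[OF Vb[OF that(1)] V01[OF that(1)] that(2)] by blast
  have Ladd: "L a (A \<union> B) = L a A + L a B"
    if "a \<in> {1..k}" "A \<in> sets unit_square" "B \<in> sets unit_square" "A \<inter> B = {}" for a A B
  proof (rule LIMSEQ_unique[OF lim[OF that(1)]])
    show "A \<union> B \<in> sets unit_square" using that by blast
    show "(\<lambda>j. LINT p:A \<union> B|unit_square. V j a p) \<longlonglongrightarrow> L a A + L a B"
      unfolding set_integral_disjoint_Un[OF Vb[OF that(1)] that(2-4)]
      by (intro tendsto_add lim that)
  qed
  have Vsum: "(\<Sum>a=1..k. LINT p:E|unit_square. V j a p) = measure unit_square E"
      if E: "E \<in> sets unit_square" for j E
  proof -
    have "(\<Sum>a=1..k. LINT p:E|unit_square. V j a p) =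
        (LINT p|unit_square. (\<Sum>a=1..k. indicator E p * V j a p))"
      unfolding set_lebesgue_integral_def
      using bdd_fun_set_integral[OF Vb E]
      by (subst Bochner_Integration.integral_sum) (auto simp: set_integrable_def)
    also have "\<dots> = (LINT p|unit_square. indicator E p)"
    proof (intro Bochner_Integration.integral_cong refl)
      fix p assume "p \<in> space unit_square"
      then obtain x y where "p = (x, y)" "x \<in> {0..1}" "y \<in> {0..1}" by (auto simp: space_unit_square)
      then have "(\<Sum>a=1..k. V j a p) = 1"
        using V[of j] by (auto simp: prob_graphons_def prob_simplex_def)
      then show "(\<Sum>a=1..k. indicator E p * V j a p) = indicator E p"
        by (simp add: sum_distrib_left[symmetric])
    qed
    finally show ?thesis by (simp only: integral_indicator_sq[OF E])
  qed
  have Lsum: "(\<Sum>a=1..k. L a E) = measure unit_square E" if E: "E \<in> sets unit_square" for E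
  proof (rule LIMSEQ_unique)
    show "(\<lambda>j. \<Sum>a=1..k. LINT p:E|unit_square. V j a p) \<longlonglongrightarrow> (\<Sum>a=1..k. L a E)"
      by (intro tendsto_sum lim E) simp
    show "(\<lambda>j. \<Sum>a=1..k. LINT p:E|unit_square. V j a p) \<longlonglongrightarrow> measure unit_square E"
      unfolding Vsum[OF E] by simp
  qed
  have "\<forall>a\<in>{1..k}. \<exists>g. g \<in> borel_measurable unit_square \<and>
      (\<forall>E\<in>sets unit_square. (\<integral>\<^sup>+p. g p * indicator E p \<partial>unit_square) = ennreal (L a E))"
  proof
    fix a assume a: "a \<in> {1..k}"
    show "\<exists>g. g \<in> borel_measurable unit_square \<and>
      (\<forall>E\<in>sets unit_square. (\<integral>\<^sup>+p. g p * indicator E p \<partial>unit_square) = ennreal (L a E))"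
      by (rule density_of_dominated[unfolded Bex_def, OF L01[OF a] Ladd[OF a]])
  qed
  from bchoice[OF this] obtain g where "\<forall>a\<in>{1..k}. g a \<in> borel_measurable unit_square \<and>
      (\<forall>E\<in>sets unit_square. (\<integral>\<^sup>+p. g a p * indicator E p \<partial>unit_square) = ennreal (L a E))"
    by (elim exE)
  then have g: "g a \<in> borel_measurable unit_square"
    and gL: "\<And>E. E \<in> sets unit_square \<Longrightarrow> (\<integral>\<^sup>+p. g a p * indicator E p \<partial>unit_square) =
        ennreal (L a E)"
    if "a \<in> {1..k}" for a using that by simp_all
  define G where "G p = (\<Sum>a=1..k. g a p)" for p
  have Gm: "G \<in> borel_measurable unit_square" unfolding G_def[abs_def] using g
    by (intro borel_measurable_sum) auto
  \<comment> \<open>The limiting set functions inherit the total mass of the colours, so both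
    densities define the same measure; uniqueness of densities then yields \<open>G = 1\<close>
    almost everywhere.\<close>
  have "density unit_square G = density unit_square (\<lambda>_. 1)"
  proof (rule measure_eqI)
    fix E assume "E \<in> sets (density unit_square G)"
    then have E: "E \<in> sets unit_square" by simp
    have "emeasure (density unit_square G) E =
        (\<integral>\<^sup>+p. (\<Sum>a=1..k. g a p * indicator E p) \<partial>unit_square)"
      using emeasure_density[OF Gm E] by (simp add: G_def sum_distrib_right)
    also have "\<dots> = (\<Sum>a=1..k. \<integral>\<^sup>+p. g a p * indicator E p \<partial>unit_square)"
      using g E
      by (intro nn_integral_sum borel_measurable_times_ennreal borel_measurable_indicator) auto
    also have "\<dots> = (\<Sum>a=1..k. ennreal (L a E))" using gL[OF _ E] by (intro sum.cong) auto
    also have "\<dots> = ennreal (\<Sum>a=1..k. L a E)" using L01[OF _ E] by (intro sum_ennreal) auto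
    also have "\<dots> = emeasure (density unit_square (\<lambda>_. 1)) E"
      by (simp only: Lsum[OF E] density_1 unit_square.emeasure_eq_measure)
    finally show "emeasure (density unit_square G) E = emeasure (density unit_square (\<lambda>_. 1)) E" .
  qed simp
  then have G1: "AE p in unit_square. G p = 1"
    by (rule unit_square.density_unique_iff[THEN iffD1, rotated -1]) (use Gm in auto)
  \<comment> \<open>Where \<open>G = 1\<close> every summand is at most 1 and passes to the reals
    unchanged; elsewhere, on a null set, 0 is a harmless default.\<close>
  define f where "f a p = (if G p = 1 then enn2real (g a p) else 0)" for a p
  have gle: "g a p \<le> 1" if "a \<in> {1..k}" "G p = 1" for a p
  proof -
    have "g a p \<le> G p" unfolding G_def using that(1) by (intro member_le_sum) auto
    then show ?thesis using that(2) by simp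
  qed
  have f01: "0 \<le> f a p" "f a p \<le> 1" if "a \<in> {1..k}" for a p
    using gle[OF that, of p] enn2real_mono[of "g a p" 1] by (auto simp: f_def)
  have fb: "bdd_fun (f a)" if a: "a \<in> {1..k}" for a
  proof (rule bdd_funI[where B=1])
    have "{p \<in> space unit_square. G p = 1} \<in> sets unit_square"
      using Gm by measurable
    then show "f a \<in> borel_measurable unit_square"
      unfolding f_def[abs_def] using g[OF a]
      by (intro measurable_If) (auto intro: borel_measurable_enn2real)
  qed (use f01[OF a] in simp)
  have fL: "(LINT p:E|unit_square. f a p) = L a E" if a: "a \<in> {1..k}" and E: "E \<in> sets unit_square"
      for a E
  proof -
    have "AE p in unit_square. ennreal (indicator E p * f a p) = g a p * indicator E p"
      using G1
    proof eventually_elim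
      case (elim p)
      have "g a p < \<top>" using gle[OF a elim] by (auto intro: le_less_trans)
      then show ?case using elim by (auto simp: f_def indicator_def)
    qed
    then have "(\<integral>\<^sup>+p. ennreal (indicator E p * f a p) \<partial>unit_square) = ennreal (L a E)"
      using nn_integral_cong_AE[of _ _ unit_square] gL[OF a E] by metis
    moreover have "(LINT p:E|unit_square. f a p) =
        enn2real (\<integral>\<^sup>+p. ennreal (indicator E p * f a p) \<partial>unit_square)"
      unfolding set_lebesgue_integral_def real_scaleR_def
      using bdd_fun_mult[OF bdd_fun_indicator[OF E] fb[OF a]] f01[OF a]
      by (intro integral_eq_nn_integral) (auto simp: bdd_fun_def)
    ultimately show ?thesis using L01[OF a E] by simp
  qed
  have fsum: "(\<Sum>a=1..k. f a p) = 1" if "G p = 1" for p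
  proof -
    have "ennreal (\<Sum>a=1..k. f a p) = (\<Sum>a=1..k. ennreal (f a p))" using f01
      by (intro sum_ennreal[symmetric]) auto
    also have "\<dots> = G p" unfolding G_def
    proof (intro sum.cong refl)
      fix a assume "a \<in> {1..k}"
      then have "g a p < \<top>" using gle[OF _ that, of a] ennreal_one_less_top by (meson le_less_trans)
      then show "ennreal (f a p) = g a p" using that by (simp add: f_def)
    qed
    finally show ?thesis using that by (metis ennreal_eq_1)
  qed
  let ?s = "\<lambda>p :: real \<times> real. (snd p, fst p)"
  define ok where "ok p \<longleftrightarrow> G p = 1 \<and> G (?s p) = 1" for p
  \<comment> \<open>Averaging with the transpose enforces symmetry. The condition \<open>ok\<close>
    is invariant under swapping coordinates, and where it fails the uniform law keeps the values in
    the simplex.\<close>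
  define W where "W a p = (if ok p then (f a p + f a (?s p)) / 2 else 1 / real k)" for a p
  have sw: "?s \<in> unit_square \<rightarrow>\<^sub>M unit_square" using swap_measurable by (simp add: case_prod_beta')
  have okm: "{p \<in> space unit_square. ok p} \<in> sets unit_square"
  proof -
    have "(\<lambda>p. G (?s p)) \<in> borel_measurable unit_square" by (rule measurable_compose[OF sw Gm])
    then show ?thesis unfolding ok_def using Gm by measurable
  qed
  have fs: "bdd_fun (\<lambda>p. f a (?s p))" if a: "a \<in> {1..k}" for a
    by (rule bdd_funI[where B=1]) (use measurable_compose[OF sw bdd_fun_measurable[OF fb[OF a]]]
        f01[OF a] in auto)
  have Wm: "W a \<in> borel_measurable unit_square" if "a \<in> {1..k}" for a
    unfolding W_def[abs_def]
    using okm bdd_fun_measurable[OF fb[OF that]] bdd_fun_measurable[OF fs[OF that]]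
    by (intro measurable_If borel_measurable_divide borel_measurable_add) auto
  have W: "W \<in> prob_graphons k"
  proof -
    have "(\<lambda>a. W a p) \<in> prob_simplex k" for p
    proof (cases "ok p")
      case True
      then have "(\<Sum>a=1..k. W a p) = ((\<Sum>a=1..k. f a p) + (\<Sum>a=1..k. f a (?s p))) / 2"
        by (simp add: W_def sum.distrib sum_divide_distrib add_divide_distrib)
      also have "\<dots> = 1" using fsum True by (simp add: ok_def)
      finally have "(\<Sum>a=1..k. W a p) = 1" .
      moreover have "W a p \<in> {0..1}" if "a \<in> {1..k}" for a
        using f01[OF that, of p] f01[OF that, of "?s p"] True by (simp add: W_def)
      ultimately show ?thesis by (simp add: prob_simplex_def)
    next
      case False
      then show ?thesis using k by (simp add: prob_simplex_def W_def)
    qed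
    moreover have "W a (x, y) = W a (y, x)" for a x y by (auto simp: W_def ok_def add.commute)
    ultimately show ?thesis using Wm by (auto simp: prob_graphons_def)
  qed
  have "(\<lambda>j. LINT p:S\<times>T|unit_square. V j a p) \<longlonglongrightarrow> (LINT p:S\<times>T|unit_square. W a p)"
    if a: "a \<in> {1..k}" and ST: "S \<in> sets unit_interval" "T \<in> sets unit_interval" for a S T
  proof -
    note E = rect_sets[OF ST] and E' = rect_sets[OF ST(2,1)]
    have sym: "L a (S \<times> T) = L a (T \<times> S)"
    proof (rule LIMSEQ_unique[OF lim[OF a E]])
      have "(LINT p:S\<times>T|unit_square. V j a p) = (LINT p:S\<times>T|unit_square. V j a (?s p))" for j
        unfolding set_lebesgue_integral_def
        using V[of j] a
        by (intro Bochner_Integration.integral_cong)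
            (auto simp: space_unit_square prob_graphons_def)
      then have "(LINT p:S\<times>T|unit_square. V j a p) = (LINT p:T\<times>S|unit_square. V j a p)" for j
        using set_integral_swap[OF Vb[OF a] ST] by simp
      then show "(\<lambda>j. LINT p:S\<times>T|unit_square. V j a p) \<longlonglongrightarrow> L a (T \<times> S)" using lim[OF a E'] by simp
    qed
    have ok: "AE p in unit_square. ok p"
      using G1 AE_swap[OF G1] unfolding ok_def by eventually_elim simp
    have "(LINT p:S\<times>T|unit_square. W a p) = (LINT p:S\<times>T|unit_square. (1/2) * (f a p + f a (?s p)))"
      unfolding set_lebesgue_integral_def
    proof (rule integral_cong_AE)
      show "AE p in unit_square. indicat_real (S \<times> T) p *\<^sub>R W a p =
          indicat_real (S \<times> T) p *\<^sub>R ((1/2) * (f a p + f a (?s p)))"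
        using ok by eventually_elim (simp add: W_def)
    qed (intro borel_measurable_scaleR borel_measurable_indicator E Wm a bdd_fun_measurable
        bdd_fun_cmult bdd_fun_add fb fs)+
    also have "\<dots> = (1/2) * ((LINT p:S\<times>T|unit_square. f a p) + (LINT p:S\<times>T|unit_square. f a (?s p)))"
      by (simp only: set_integral_mult_right set_integral_add[OF bdd_fun_set_integral[OF fb[OF a]
          E] bdd_fun_set_integral[OF fs[OF a] E]])
    also have "\<dots> = L a (S \<times> T)"
      using fL[OF a E] fL[OF a E'] set_integral_swap[OF fb[OF a] ST] sym by simp
    finally show ?thesis using lim[OF a E] by simp
  qed
  then show ?thesis using W by blast
qed

section \<open>Limits of rapidly Cauchy sequences of graphons\<close>

lemma cut_dist_lessE:
  assumes "cut_dist k U W < c"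
  obtains \<phi> where "\<phi> \<in> mp_bijections" "vec_cut_norm k (\<lambda>a p. U a p - pullback \<phi> W a p) < c"
proof -
  have "(\<lambda>\<phi>. vec_cut_norm k (\<lambda>a p. U a p - pullback \<phi> W a p)) ` mp_bijections \<noteq> {}" using id_mp
    by blast
  from cInf_lessD[OF this assms[unfolded cut_dist_def]] show ?thesis using that by blast
qed

lemma cut_norm_le_vec:
  assumes U: "U \<in> prob_graphons k" and W: "W \<in> prob_graphons k" and a: "a \<in> {1..k}"
  shows "cut_norm (\<lambda>p. U a p - W a p) \<le> vec_cut_norm k (\<lambda>a p. U a p - W a p)"
  unfolding vec_cut_norm_def using a
  by (intro member_le_sum[where f="\<lambda>a. cut_norm (\<lambda>p. U a p -
      W a p)"] cut_norm_nonneg bdd_fun_diff prob_graphons_bdd[OF U] prob_graphons_bdd[OF W]) auto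

lemma rect_integral_diff_le:
  assumes F: "bdd_fun F" and G: "bdd_fun G" and ST: "S \<in> sets unit_interval"
      "T \<in> sets unit_interval"
  shows "\<bar>(LINT p:S\<times>T|unit_square. F p) - (LINT p:S\<times>T|unit_square. G p)\<bar> \<le> cut_norm (\<lambda>p. F p - G p)"
  using cut_norm_upper[OF bdd_fun_diff[OF F G] ST]
  by (simp add: set_integral_diff bdd_fun_set_integral[OF F rect_sets[OF ST]]
      bdd_fun_set_integral[OF G rect_sets[OF ST]])

text \<open>Aligning each graphon with its predecessor and composing the bijections replaces
  closeness up to rearrangement by closeness in cut norm. Rectangle integrals are then Cauchy
  uniformly in the rectangle, so the weak limit is also a limit in cut norm.\<close>

theorem cut_dist_complete:
  assumes k: "k \<ge> 1" and W: "\<And>j. W j \<in> prob_graphons k"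
    and d: "\<And>j. cut_dist k (W j) (W (Suc j)) < (1/2) ^ j"
  shows "\<exists>U\<in>prob_graphons k. (\<lambda>j. cut_dist k (W j) U) \<longlonglongrightarrow> 0"
proof -
  have "\<forall>j. \<exists>\<phi>. \<phi> \<in> mp_bijections \<and> vec_cut_norm k (\<lambda>a p. W j a p - pullback \<phi> (W (Suc j)) a p) <
      (1/2) ^ j"
    using cut_dist_lessE[OF d] by metis
  from choice[OF this] obtain \<psi> where \<psi>: "\<And>j. \<psi> j \<in> mp_bijections"
    and \<psi>d: "\<And>j. vec_cut_norm k (\<lambda>a p. W j a p - pullback (\<psi> j) (W (Suc j)) a p) < (1/2) ^ j"
    by blast
  \<comment> \<open>\<open>\<Phi> (Suc j)\<close> applies \<open>\<Phi> j\<close> and then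
    \<open>\<psi> j\<close>, so pulling the bound for index \<open>j\<close> back along
    \<open>\<Phi> j\<close> compares \<open>V j\<close> with \<open>V (Suc j)\<close>.\<close>
  define \<Phi> where "\<Phi> = rec_nat (\<lambda>x :: real. x) (\<lambda>j f x. \<psi> j (f x))"
  have \<Phi>S: "\<Phi> (Suc j) = (\<lambda>x. \<psi> j (\<Phi> j x))" and \<Phi>0: "\<Phi> 0 = (\<lambda>x. x)" for j by (simp_all add: \<Phi>_def)
  have \<Phi>: "\<Phi> j \<in> mp_bijections" for j
    by (induction j) (simp_all add: \<Phi>S \<Phi>0 id_mp comp_mp \<psi>)
  define V where "V j = pullback (\<Phi> j) (W j)" for j
  have V: "V j \<in> prob_graphons k" for j unfolding V_def by (rule pullback_in[OF W \<Phi>])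
  have Vb: "bdd_fun (V j a)" if "a \<in> {1..k}" for j a by (rule prob_graphons_bdd[OF V that])
  have close1: "cut_norm (\<lambda>p. V j a p - V (Suc j) a p) \<le> (1/2) ^ j" if a: "a \<in> {1..k}" for j a
  proof -
    note P = pullback_in[OF W[of "Suc j"] \<psi>[of j]]
    have "cut_norm (\<lambda>p. V j a p - V (Suc j) a p) =
        cut_norm (\<lambda>(x, y). (\<lambda>p. W j a p - pullback (\<psi> j) (W (Suc j)) a p) (\<Phi> j x, \<Phi> j y))"
      by (rule cut_norm_cong) (auto simp: V_def pullback_def \<Phi>S)
    also have "\<dots> \<le> cut_norm (\<lambda>p. W j a p - pullback (\<psi> j) (W (Suc j)) a p)"
      by (intro cut_norm_comp_le bdd_fun_diff prob_graphons_bdd[OF W a] prob_graphons_bdd[OF P a] \<Phi>)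
    also have "\<dots> \<le> (1/2) ^ j" using cut_norm_le_vec[OF W[of j] P a] \<psi>d[of j] by linarith
    finally show ?thesis .
  qed
  \<comment> \<open>The geometric sum is kept in closed form with its remainder, so that the
    induction adds exactly \<open>(1/2) ^ (i + m)\<close>.\<close>
  have close: "cut_norm (\<lambda>p. V i a p - V (i + m) a p) \<le> 2 * (1/2) ^ i - 2 * (1/2) ^ (i + m)"
      if a: "a \<in> {1..k}" for i m a
  proof (induction m)
    case 0
    then show ?case by (simp add: cut_norm_zero)
  next
    case (Suc m)
    then show ?case
      using cut_norm_triangle[OF Vb[OF a] Vb[OF a] Vb[OF a], of i "i + Suc m"
          "i + m"] close1[OF a, of "i + m"] by simp
  qed
  have close': "\<bar>(LINT p:S\<times>T|unit_square. V i a p) - (LINT p:S\<times>T|unit_square. V j a p)\<bar> \<le>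
      2 * (1/2) ^ i"
    if a: "a \<in> {1..k}" and ST: "S \<in> sets unit_interval" "T \<in> sets unit_interval" and ij: "i \<le> j"
        for a S T i j
  proof -
    have "cut_norm (\<lambda>p. V i a p - V j a p) \<le> 2 * (1/2) ^ i - 2 * (1/2) ^ j"
      using close[OF a, of i "j - i"] ij by simp
    moreover have "0 \<le> 2 * (1/2 :: real) ^ j" by simp
    ultimately show ?thesis using rect_integral_diff_le[OF Vb[OF a] Vb[OF a] ST, of i j] by linarith
  qed
  have half: "(\<lambda>j. (1/2 :: real) ^ j) \<longlonglongrightarrow> 0" by (rule LIMSEQ_realpow_zero) auto
  have conv: "convergent (\<lambda>j. LINT p:S\<times>T|unit_square. V j a p)"
    if a: "a \<in> {1..k}" and ST: "S \<in> sets unit_interval" "T \<in> sets unit_interval" for a S T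
    unfolding Cauchy_convergent_iff[symmetric]
  proof (rule metric_CauchyI)
    fix e :: real assume e: "e > 0"
    have "e / 4 > 0" using e by simp
    from LIMSEQ_D[OF half this] obtain M where "\<forall>j\<ge>M. norm ((1/2 :: real) ^ j - 0) < e / 4"
      by (elim exE)
    then have "norm ((1/2 :: real) ^ M - 0) < e / 4" using order_refl[of M] by blast
    then have M: "2 * (1/2 :: real) ^ M < e / 2" by simp
    show "\<exists>M. \<forall>m\<ge>M. \<forall>n\<ge>M. dist (LINT p:S\<times>T|unit_square. V m a p) (LINT p:S\<times>T|unit_square.
        V n a p) < e"
    proof (intro exI[of _ M] allI impI)
      fix m n assume "M \<le> m" "M \<le> n"
      then show "dist (LINT p:S\<times>T|unit_square. V m a p) (LINT p:S\<times>T|unit_square. V n a p) < e"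
        using close'[OF a ST, of M m] close'[OF a ST, of M n] M unfolding dist_real_def by linarith
    qed
  qed
  have "\<exists>U\<in>prob_graphons k. \<forall>a\<in>{1..k}. \<forall>S\<in>sets unit_interval. \<forall>T\<in>sets unit_interval.
    (\<lambda>j. LINT p:S\<times>T|unit_square. V j a p) \<longlonglongrightarrow> (LINT p:S\<times>T|unit_square. U a p)"
    by (rule limit_graphon[OF k V conv])
  then obtain U where U: "U \<in> prob_graphons k"
      and lim: "\<forall>a\<in>{1..k}. \<forall>S\<in>sets unit_interval. \<forall>T\<in>sets unit_interval.
    (\<lambda>j. LINT p:S\<times>T|unit_square. V j a p) \<longlonglongrightarrow> (LINT p:S\<times>T|unit_square. U a p)"
    by (elim bexE)
  have VU: "cut_norm (\<lambda>p. V j a p - U a p) \<le> 2 * (1/2) ^ j" if a: "a \<in> {1..k}" for j a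
  proof (rule cut_norm_least)
    fix S T assume ST: "S \<in> sets unit_interval" "T \<in> sets unit_interval"
    note E = rect_sets[OF ST]
    have "(\<lambda>i. \<bar>(LINT p:S\<times>T|unit_square. V j a p) - (LINT p:S\<times>T|unit_square. V i a p)\<bar>) \<longlonglongrightarrow>
      \<bar>(LINT p:S\<times>T|unit_square. V j a p) - (LINT p:S\<times>T|unit_square. U a p)\<bar>"
      using lim a ST by (intro tendsto_rabs tendsto_diff tendsto_const) blast
    then have "\<bar>(LINT p:S\<times>T|unit_square. V j a p) - (LINT p:S\<times>T|unit_square. U a p)\<bar> \<le>
        2 * (1/2) ^ j"
      by (rule LIMSEQ_le_const2) (use close'[OF a ST, of j] in blast)
    then show "\<bar>LINT p:S\<times>T|unit_square. V j a p - U a p\<bar> \<le> 2 * (1/2) ^ j"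
      by (simp add: set_integral_diff bdd_fun_set_integral[OF Vb[OF a] E] bdd_fun_set_integral[OF
          prob_graphons_bdd[OF U a] E])
  qed
  have le: "cut_dist k (W j) U \<le> real k * (2 * (1/2) ^ j)" for j
  proof -
    have "cut_dist k (V j) U \<le> vec_cut_norm k (\<lambda>a p. V j a p - U a p)"
      by (rule cut_dist_le_norm[OF V U])
    also have "\<dots> \<le> (\<Sum>a=1..k. 2 * (1/2) ^ j)" unfolding vec_cut_norm_def by (rule sum_mono) (rule VU)
    finally have "cut_dist k (V j) U \<le> real k * (2 * (1/2) ^ j)" by simp
    moreover have "cut_dist k (W j) (V j) = 0"
      using cut_dist_pullback_self[OF W \<Phi>] cut_dist_commute[OF W V] by (simp add: V_def)
    ultimately show ?thesis using cut_dist_triangle[OF W V U, of j j] by linarith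
  qed
  have "(\<lambda>j. real k * (2 * (1/2) ^ j)) \<longlonglongrightarrow> real k * (2 * 0)"
    by (intro tendsto_mult tendsto_const half)
  then have lim0: "(\<lambda>j. real k * (2 * (1/2) ^ j)) \<longlonglongrightarrow> 0" by simp
  have "(\<lambda>j. cut_dist k (W j) U) \<longlonglongrightarrow> 0"
    by (rule tendsto_sandwich[OF always_eventually always_eventually tendsto_const lim0])
      (auto intro: le cut_dist_nonneg W U)
  then show ?thesis using U by blast
qed

section \<open>The compact quotient space\<close>

lemma graphon_class_in: "W \<in> prob_graphons k \<Longrightarrow> graphon_class k W \<in> graphon_space k"
  by (auto simp: graphon_class_def graphon_space_def intro: quotientI)

lemma graphon_class_rep:
  assumes "A \<in> graphon_space k" shows "graphon_class k (graphon_rep A) = A"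
proof -
  obtain W where W: "A = cut_rel k `` {W}" "W \<in> prob_graphons k"
    using assms unfolding graphon_space_def by (rule quotientE)
  have "(W, graphon_rep A) \<in> cut_rel k" using graphon_rep(1)[OF assms] W by simp
  then show ?thesis unfolding graphon_class_def W(1) using equiv_class_eq[OF equiv_cut_rel] by metis
qed

lemma class_dist_class:
  assumes "A \<in> graphon_space k" "W \<in> prob_graphons k"
  shows "class_dist k A (graphon_class k W) = cut_dist k (graphon_rep A) W"
  using class_dist_eq[OF graphon_rep(2)[OF assms(1)] assms(2)]
  by (simp add: graphon_class_rep[OF assms(1)])

lemma compact_graphon_space:
  assumes k: "k \<ge> 1"
  shows "compact_space (Metric_space.mtopology (graphon_space k) (class_dist k))"
proof -
  interpret Metric_space "graphon_space k" "class_dist k" by (rule Metric_space_graphon_space)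
  have "mcomplete"
    unfolding mcomplete_def
  proof (intro allI impI)
    fix \<sigma> assume \<sigma>: "MCauchy \<sigma>"
    then have in_space: "\<sigma> n \<in> graphon_space k" for n by (auto simp: MCauchy_def)
    have "\<forall>j. \<exists>N. \<forall>n n'. N \<le> n \<longrightarrow> N \<le> n' \<longrightarrow> class_dist k (\<sigma> n) (\<sigma> n') < (1/2) ^ j"
      using \<sigma> by (simp add: MCauchy_def)
    from choice[OF this] obtain N where N: "\<And>j n n'. N j \<le> n \<Longrightarrow> N j \<le> n' \<Longrightarrow>
        class_dist k (\<sigma> n) (\<sigma> n') < (1/2) ^ j"
      by blast
    \<comment> \<open>\<open>r j\<close> dominates \<open>N j\<close>, and the summand
      \<open>j\<close> makes it strictly increasing; along it consecutive distances decay
      geometrically.\<close>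
    define r where "r j = (\<Sum>i\<le>j. N i) + j" for j
    have Nr: "N j \<le> r j" for j
      using member_le_sum[of j "{..j}" N] by (simp add: r_def)
    have r: "strict_mono r" unfolding strict_mono_Suc_iff by (simp add: r_def)
    define W where "W j = graphon_rep (\<sigma> (r j))" for j
    have W: "W j \<in> prob_graphons k" for j unfolding W_def by (rule graphon_rep(2)[OF in_space])
    have "cut_dist k (W j) (W (Suc j)) < (1/2) ^ j" for j
    proof -
      have "r j \<le> r (Suc j)" by (simp add: r_def)
      then have "class_dist k (\<sigma> (r j)) (\<sigma> (r (Suc j))) < (1/2) ^ j" using Nr[of j]
        by (intro N) auto
      then show ?thesis using in_space by (simp add: class_dist_def W_def)
    qed
    from cut_dist_complete[OF k W this] obtain U where U: "U \<in> prob_graphons k"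
        and lim: "(\<lambda>j. cut_dist k (W j) U) \<longlonglongrightarrow> 0"
      by (elim bexE)
    have "limitin mtopology (\<sigma> \<circ> r) (graphon_class k U) sequentially"
      unfolding limitin_metric
    proof (intro conjI allI impI)
      show "graphon_class k U \<in> graphon_space k" by (rule graphon_class_in[OF U])
      fix e :: real assume "e > 0"
      then have "\<forall>\<^sub>F j in sequentially. cut_dist k (W j) U < e" using lim
        by (intro order_tendstoD(2))
      then show "\<forall>\<^sub>F j in sequentially. (\<sigma> \<circ> r) j \<in> graphon_space k \<and>
          class_dist k ((\<sigma> \<circ> r) j) (graphon_class k U) < e"
        by eventually_elim (simp add: in_space class_dist_class[OF in_space U] W_def)
    qed
    then show "\<exists>x. limitin mtopology \<sigma> x sequentially" using MCauchy_convergent_subsequence[OF \<sigma> r]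
      by blast
  qed
  moreover have "mtotally_bounded (graphon_space k)"
    unfolding mtotally_bounded_def
  proof (intro allI impI)
    fix e :: real assume "e > 0"
    from totally_bounded[OF this, of k]
    obtain \<F> where \<F>: "finite \<F>" "\<F> \<subseteq> prob_graphons k" "\<forall>W\<in>prob_graphons k. \<exists>V\<in>\<F>. cut_dist k V W <
        e"
      by (elim exE conjE)
    show "\<exists>K. finite K \<and> K \<subseteq> graphon_space k \<and> graphon_space k \<subseteq> (\<Union>x\<in>K. mball x e)"
    proof (intro exI[of _ "graphon_class k ` \<F>"] conjI subsetI)
      fix A assume A: "A \<in> graphon_space k"
      obtain V where V: "V \<in> \<F>" "cut_dist k V (graphon_rep A) < e"
        using bspec[OF \<F>(3) graphon_rep(2)[OF A]] by (elim bexE)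
      then have "class_dist k (graphon_class k V) A < e"
        using class_dist_eq[of V k "graphon_rep A"] \<F>(2) graphon_rep(2)[OF A]
            graphon_class_rep[OF A] by auto
      then show "A \<in> (\<Union>x\<in>graphon_class k ` \<F>. mball x e)"
        using A V(1) \<F>(2) by (auto simp: in_mball intro!: graphon_class_in)
    qed (use \<F> graphon_class_in in auto)
  qed
  ultimately show ?thesis by (simp add: compact_space_eq_mcomplete_mtotally_bounded)
qed

text \<open>The radius may vary with the centre because the counting bounds hold near each class
  only on a ball of uncontrolled size.\<close>

theorem finite_ball_cover:
  assumes k: "k \<ge> 1" and r: "\<And>A. A \<in> graphon_space k \<Longrightarrow> r A > 0"
  shows "\<exists>K. finite K \<and> K \<subseteq> graphon_space k \<and> (\<forall>A\<in>graphon_space k. \<exists>B\<in>K. class_dist k B A < r B)"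
proof -
  interpret Metric_space "graphon_space k" "class_dist k" by (rule Metric_space_graphon_space)
  have "compactin mtopology (graphon_space k)"
    using compact_graphon_space[OF k] by (simp add: compact_space_def)
  moreover have "graphon_space k \<subseteq> \<Union>((\<lambda>A. mball A (r A)) ` graphon_space k)"
    using r by auto
  ultimately obtain \<F> where \<F>: "finite \<F>" "\<F> \<subseteq>
      (\<lambda>A. mball A (r A)) ` graphon_space k" "graphon_space k \<subseteq> \<Union>\<F>"
    unfolding compactin_def by (metis (no_types, lifting) imageE openin_mball)
  from finite_subset_image[OF \<F>(1,2)] obtain K
      where "K \<subseteq> graphon_space k" "finite K" "\<F> = (\<lambda>A. mball A (r A)) ` K"
    by blast
  then show ?thesis using \<F>(3) by (intro exI[of _ K]) (fastforce simp: in_mball)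
qed

section \<open>Random edge colourings\<close>

lemma finite_complete_edges [simp]: "finite (complete_edges n)"
  by (rule finite_subset[of _ "Pow {1..n}"]) (auto simp: complete_edges_def)

lemma edge_Min_Max:
  assumes "e \<in> complete_edges n"
  shows "Min e \<in> {1..n}" "Max e \<in> {1..n}" "Min e < Max e" "{Min e, Max e} = e"
proof -
  obtain u v where e: "e = {u, v}" "u \<noteq> v" "u \<in> {1..n}" "v \<in> {1..n}"
    using assms by (auto simp: complete_edges_def card_2_iff)
  then show "Min e \<in> {1..n}" "Max e \<in> {1..n}" "Min e < Max e" "{Min e, Max e} = e"
    by (auto simp: min_def max_def)
qed

text \<open>An edge is identified with the ordered pair of its endpoints, \<open>Min e\<close> below
  \<open>Max e\<close>; the two triangles of the matrix supply the two orientations.\<close>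

lemma sum_edges:
  fixes F :: "nat \<Rightarrow> nat \<Rightarrow> real"
  shows "(\<Sum>u\<in>{1..n}. \<Sum>v\<in>{1..n}. if u \<noteq> v then F u v else 0) =
    (\<Sum>e\<in>complete_edges n. F (Min e) (Max e) + F (Max e) (Min e))"
proof -
  let ?P = "{p \<in> {1..n} \<times> {1..n}. fst p < snd p}"
  have bij: "bij_betw (\<lambda>e. (Min e, Max e)) (complete_edges n) ?P"
  proof (rule bij_betw_byWitness[where f'="\<lambda>(u, v). {u, v}"])
    show "\<forall>e\<in>complete_edges n. (\<lambda>(u, v). {u, v}) (Min e, Max e) = e"
      using edge_Min_Max(4) by auto
    show "\<forall>p\<in>?P. (Min ((\<lambda>(u, v). {u, v}) p), Max ((\<lambda>(u, v). {u, v}) p)) = p"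
      by (auto simp: min_def max_def)
    show "(\<lambda>e. (Min e, Max e)) ` complete_edges n \<subseteq> ?P"
      using edge_Min_Max by (auto simp del: atLeastAtMost_iff)
    show "(\<lambda>(u, v). {u, v}) ` ?P \<subseteq> complete_edges n"
      by (auto simp: complete_edges_def card_insert_if)
  qed
  have less: "(\<Sum>u\<in>{1..n}. \<Sum>v\<in>{1..n}. if u < v then G u v else 0) =
      (\<Sum>e\<in>complete_edges n. G (Min e) (Max e))" for G :: "nat \<Rightarrow> nat \<Rightarrow> real"
  proof -
    have "(\<Sum>u\<in>{1..n}. \<Sum>v\<in>{1..n}. if u < v then G u v else 0) = (\<Sum>p\<in>{1..n} \<times> {1..n}. if fst p <
        snd p then G (fst p) (snd p) else 0)"
      by (simp add: sum.cartesian_product case_prod_beta)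
    also have "\<dots> = (\<Sum>p\<in>?P. G (fst p) (snd p))" by (rule sum.inter_filter[symmetric]) simp
    also have "\<dots> = (\<Sum>e\<in>complete_edges n. G (Min e) (Max e))"
      using sum.reindex_bij_betw[OF bij, of "\<lambda>p. G (fst p) (snd p)"] by simp
    finally show ?thesis .
  qed
  have "(\<Sum>u\<in>{1..n}. \<Sum>v\<in>{1..n}. if u \<noteq> v then F u v else 0) =
    (\<Sum>u\<in>{1..n}. \<Sum>v\<in>{1..n}. (if u < v then F u v else 0) + (if v < u then F u v else 0))"
    by (intro sum.cong refl) auto
  also have "\<dots> = (\<Sum>u\<in>{1..n}. \<Sum>v\<in>{1..n}. if u < v then F u v else 0) + (\<Sum>v\<in>{1..n}. \<Sum>u\<in>{1..n}. if v <
      u then F u v else 0)"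
    unfolding sum.distrib by (subst (2) sum.swap) (rule refl)
  also have "\<dots> = (\<Sum>e\<in>complete_edges n. F (Min e) (Max e) + F (Max e) (Min e))"
    unfolding less less[of "\<lambda>u v. F v u"] by (rule sum.distrib[symmetric])
  finally show ?thesis .
qed

lemma card_complete_edges_le: "2 * real (card (complete_edges n)) \<le> (real n)\<^sup>2"
proof -
  have "2 * real (card (complete_edges n)) = (\<Sum>u\<in>{1..n}. \<Sum>v\<in>{1..n}. if u \<noteq> v then 1 else 0)"
    unfolding sum_edges[of "\<lambda>_ _. 1"] by simp
  also have "\<dots> \<le> (\<Sum>u\<in>{1..n}. \<Sum>v\<in>{1..n}. 1)" by (intro sum_mono) auto
  also have "\<dots> = (real n)\<^sup>2" by (simp add: power2_eq_square)
  finally show ?thesis .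
qed

lemma finite_colorings [simp]: "finite (colorings n k)"
  unfolding colorings_def by (intro finite_PiE) auto

lemma coloring_in: "c \<in> colorings n k \<Longrightarrow> e \<in> complete_edges n \<Longrightarrow> c e \<in> {1..k}"
  by (auto simp: colorings_def)

section \<open>Exponential weights on colourings\<close>

lemma prod_sum_colorings:
  "(\<Prod>e\<in>complete_edges n. \<Sum>a=1..k. f e a) = (\<Sum>c\<in>colorings n k. \<Prod>e\<in>complete_edges n.
      f e (c e) :: real)"
  unfolding colorings_def by (rule prod_sum_PiE) auto

text \<open>By Jensen's inequality, stochastic averages of log-subprobabilities are log-subprobabilities.\<close>

lemma sum_exp_weights_le_1:
  fixes g :: "nat \<Rightarrow> nat \<Rightarrow> nat \<Rightarrow> real"
  assumes g: "\<And>i j. (\<Sum>a=1..k. exp (g a i j)) \<le> 1"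
    and m: "\<And>i u. u \<in> {1..n} \<Longrightarrow> m i u \<ge> 0" "\<And>u. u \<in> {1..n} \<Longrightarrow> (\<Sum>i\<le>q. m i u) = 1"
  shows "(\<Sum>c\<in>colorings n k. exp (\<Sum>e\<in>complete_edges n. \<Sum>i\<le>q. \<Sum>j\<le>q.
      m i (Min e) * m j (Max e) * g (c e) i j)) \<le> 1"
proof -
  have le: "(\<Sum>a=1..k. exp (\<Sum>i\<le>q. \<Sum>j\<le>q. m i (Min e) * m j (Max e) * g a i j)) \<le> 1"
      if e: "e \<in> complete_edges n" for e
  proof -
    note E = edge_Min_Max[OF e]
    define p where "p x = m (fst x) (Min e) * m (snd x) (Max e)" for x :: "nat \<times> nat"
    have p0: "p x \<ge> 0" for x using m(1) E by (simp add: p_def)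
    have "(\<Sum>x\<in>{..q}\<times>{..q}. p x) = (\<Sum>i\<le>q. m i (Min e)) * (\<Sum>j\<le>q. m j (Max e))"
      by (simp add: p_def sum_product sum.cartesian_product case_prod_beta)
    also have "\<dots> = 1" using m(2) E by simp
    finally have p1: "(\<Sum>x\<in>{..q}\<times>{..q}. p x) = 1" .
    have "exp (\<Sum>i\<le>q. \<Sum>j\<le>q. m i (Min e) * m j (Max e) * g a i j) \<le>
        (\<Sum>x\<in>{..q}\<times>{..q}. p x * exp (g a (fst x) (snd x)))" for a
    proof -
      have "(\<Sum>i\<le>q. \<Sum>j\<le>q. m i (Min e) * m j (Max e) * g a i j) =
          (\<Sum>x\<in>{..q}\<times>{..q}. p x *\<^sub>R g a (fst x) (snd x))"
        by (simp add: p_def sum.cartesian_product case_prod_beta)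
      moreover have "exp (\<Sum>x\<in>{..q}\<times>{..q}. p x *\<^sub>R g a (fst x) (snd x)) \<le>
          (\<Sum>x\<in>{..q}\<times>{..q}. p x * exp (g a (fst x) (snd x)))"
        by (rule convex_on_sum[OF _ _ exp_convex p1]) (auto intro: p0)
      ultimately show ?thesis by simp
    qed
    then have "(\<Sum>a=1..k. exp (\<Sum>i\<le>q. \<Sum>j\<le>q. m i (Min e) * m j (Max e) * g a i j)) \<le>
        (\<Sum>a=1..k. \<Sum>x\<in>{..q}\<times>{..q}. p x * exp (g a (fst x) (snd x)))" by (intro sum_mono)
    also have "\<dots> = (\<Sum>x\<in>{..q}\<times>{..q}. p x * (\<Sum>a=1..k. exp (g a (fst x) (snd x))))"
      by (subst sum.swap) (simp add: sum_distrib_left)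
    also have "\<dots> \<le> (\<Sum>x\<in>{..q}\<times>{..q}. p x * 1)" by (intro sum_mono mult_left_mono g p0)
    finally show ?thesis using p1 by simp
  qed
  have "(\<Sum>c\<in>colorings n k. exp (\<Sum>e\<in>complete_edges n. \<Sum>i\<le>q. \<Sum>j\<le>q.
      m i (Min e) * m j (Max e) * g (c e) i j)) =
      (\<Prod>e\<in>complete_edges n. \<Sum>a=1..k. exp (\<Sum>i\<le>q. \<Sum>j\<le>q. m i (Min e) * m j (Max e) * g a i j))"
    unfolding prod_sum_colorings by (simp add: exp_sum)
  also have "\<dots> \<le> (\<Prod>e\<in>complete_edges n. 1)" using le by (intro prod_mono) (auto intro: sum_nonneg)
  finally show ?thesis by simp
qed

text \<open>Rounding the stochastic matrices to multiples of \<open>1/L\<close> leaves only \<open>(L+1)^((q+1) n)\<close> of them.\<close>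

lemma card_colorings_le:
  fixes g :: "nat \<Rightarrow> nat \<Rightarrow> nat \<Rightarrow> real"
  assumes g: "\<And>i j. (\<Sum>a=1..k. exp (g a i j)) \<le> 1" and G: "\<And>a i j. \<bar>g a i j\<bar> \<le> G" and L: "L \<ge> 1"
    and m0: "\<And>m i u. m \<in> \<Phi> \<Longrightarrow> u \<in> {1..n} \<Longrightarrow> m i u \<ge> 0"
    and m1: "\<And>m u. m \<in> \<Phi> \<Longrightarrow> u \<in> {1..n} \<Longrightarrow> (\<Sum>i\<le>q. m i u) = 1"
  shows "real (card {c \<in> colorings n k. \<exists>m\<in>\<Phi>. t \<le>
      (\<Sum>e\<in>complete_edges n. \<Sum>i\<le>q. \<Sum>j\<le>q. m i (Min e) * m j (Max e) * g (c e) i j)})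
    \<le> (real L + 1) ^ ((q + 1) * n) * exp ((real n)\<^sup>2 * (real q + 1)\<^sup>2 * G / real L - t)"
proof -
  define w where "w m c = (\<Sum>e\<in>complete_edges n. \<Sum>i\<le>q. \<Sum>j\<le>q.
      m i (Min e) * m j (Max e) * g (c e) i j)" for m :: "nat \<Rightarrow> nat \<Rightarrow> real" and c :: "nat set \<Rightarrow> nat"
  \<comment> \<open>Rounding changes each of the \<open>(q + 1)^2\<close> terms of an edge by at
    most \<open>2 * G / L\<close>, and there are at most \<open>n^2 / 2\<close> edges.\<close>
  define err where "err = (real n)\<^sup>2 * (real q + 1)\<^sup>2 * G / real L"
  define \<kappa> where "\<kappa> m = (\<lambda>(i, u)\<in>{..q} \<times> {1..n}. nat \<lfloor>real L * m i u\<rfloor>)" for m :: "nat \<Rightarrow> nat \<Rightarrow> real"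
  have G0: "G \<ge> 0" using G[of 0 0 0] by linarith
  have Lp: "real L > 0" using L by simp
  have mle: "m i u \<le> 1" if "m \<in> \<Phi>" "u \<in> {1..n}" "i \<le> q" for m i u
  proof -
    have "m i u \<le> (\<Sum>i\<le>q. m i u)" using that m0 by (intro member_le_sum) auto
    then show ?thesis using m1[OF that(1,2)] by simp
  qed
  have "\<kappa> ` \<Phi> \<subseteq> ({..q} \<times> {1..n}) \<rightarrow>\<^sub>E {..L}"
  proof (intro image_subsetI)
    fix m assume m: "m \<in> \<Phi>"
    have "nat \<lfloor>real L * m i u\<rfloor> \<le> L" if "u \<in> {1..n}" "i \<le> q" for i u
    proof -
      have "real L * m i u \<le> real L" using mle[OF m that] by (simp add: mult_left_le)
      then show ?thesis by linarith
    qed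
    then show "\<kappa> m \<in> ({..q} \<times> {1..n}) \<rightarrow>\<^sub>E {..L}" by (auto simp: \<kappa>_def)
  qed
  moreover have fin: "finite (({..q} \<times> {1..n}) \<rightarrow>\<^sub>E {..L})" by (intro finite_PiE) auto
  ultimately have fin\<kappa>: "finite (\<kappa> ` \<Phi>)" and card\<kappa>: "card (\<kappa> ` \<Phi>) \<le> (L + 1) ^ ((q + 1) * n)"
    using card_mono[of "({..q} \<times> {1..n}) \<rightarrow>\<^sub>E {..L}" "\<kappa> ` \<Phi>"]
    by (auto simp: finite_subset card_PiE card_cartesian_product)
  have close: "\<bar>w m c - w m' c\<bar> \<le> err" if m: "m \<in> \<Phi>" and m': "m' \<in> \<Phi>" and eq: "\<kappa> m = \<kappa> m'"
      for m m' c
  proof -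
    have d: "\<bar>m i u - m' i u\<bar> \<le> 1 / real L" if u: "u \<in> {1..n}" and i: "i \<le> q" for i u
    proof -
      have "\<kappa> m (i, u) = \<kappa> m' (i, u)" using eq by simp
      then have "nat \<lfloor>real L * m i u\<rfloor> = nat \<lfloor>real L * m' i u\<rfloor>" using u i by (simp add: \<kappa>_def)
      moreover have "0 \<le> \<lfloor>real L * m i u\<rfloor>" "0 \<le> \<lfloor>real L * m' i u\<rfloor>" using m0[OF m u] m0[OF m' u]
        by simp_all
      ultimately have "\<lfloor>real L * m i u\<rfloor> = \<lfloor>real L * m' i u\<rfloor>" by linarith
      then have "\<bar>real L * m i u - real L * m' i u\<bar> \<le> 1" by linarith
      then have "real L * \<bar>m i u - m' i u\<bar> \<le> 1" by (simp add: abs_mult flip: right_diff_distrib)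
      then show ?thesis using Lp by (simp add: field_simps)
    qed
    have e: "\<bar>(\<Sum>i\<le>q. \<Sum>j\<le>q. m i (Min e) * m j (Max e) * g (c e) i j) -
        (\<Sum>i\<le>q. \<Sum>j\<le>q. m' i (Min e) * m' j (Max e) * g (c e) i j)\<bar>
      \<le> (real q + 1)\<^sup>2 * (2 * G / real L)" if e: "e \<in> complete_edges n" for e
    proof -
      note E = edge_Min_Max[OF e]
      have t: "\<bar>m i (Min e) * m j (Max e) * g (c e) i j -
          m' i (Min e) * m' j (Max e) * g (c e) i j\<bar> \<le> 2 * G / real L"
        if ij: "i \<le> q" "j \<le> q" for i j
      proof -
        let ?a = "m i (Min e)" and ?b = "m j (Max e)" and ?a' = "m' i (Min e)"
            and ?b' = "m' j (Max e)"
        have "\<bar>?a * ?b - ?a' * ?b'\<bar> = \<bar>(?a - ?a') * ?b + ?a' * (?b - ?b')\<bar>"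
          by (simp add: algebra_simps)
        also have "\<dots> \<le> \<bar>?a - ?a'\<bar> * ?b + ?a' * \<bar>?b - ?b'\<bar>"
          using abs_triangle_ineq[of "(?a - ?a') * ?b"
              "?a' * (?b - ?b')"] m0[OF m E(2)] m0[OF m' E(1)] by (simp add: abs_mult)
        also have "\<dots> \<le> 1 / real L * 1 + 1 * (1 / real L)"
          using d[OF E(1) ij(1)] d[OF E(2) ij(2)] mle[OF m E(2) ij(2)] mle[OF m' E(1) ij(1)]
              m0[OF m E(2)] m0[OF m' E(1)]
          by (intro add_mono mult_mono) auto
        finally have "\<bar>?a * ?b - ?a' * ?b'\<bar> * \<bar>g (c e) i j\<bar> \<le> (2 / real L) * G"
          using G by (intro mult_mono) auto
        moreover have "?a * ?b * g (c e) i j - ?a' * ?b' * g (c e) i j =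
            (?a * ?b - ?a' * ?b') * g (c e) i j"
          by (simp only: left_diff_distrib)
        ultimately show ?thesis by (simp only: abs_mult) simp
      qed
      have "\<bar>(\<Sum>i\<le>q. \<Sum>j\<le>q. m i (Min e) * m j (Max e) * g (c e) i j) -
          (\<Sum>i\<le>q. \<Sum>j\<le>q. m' i (Min e) * m' j (Max e) * g (c e) i j)\<bar>
        \<le> (\<Sum>i\<le>q. \<bar>\<Sum>j\<le>q. m i (Min e) * m j (Max e) * g (c e) i j - m' i (Min e) * m' j (Max e) * g
            (c e) i j\<bar>)"
        unfolding sum_subtractf[symmetric] by (rule sum_abs)
      also have "\<dots> \<le> (\<Sum>i\<le>q. \<Sum>j\<le>q. \<bar>m i (Min e) * m j (Max e) * g (c e) i j -
          m' i (Min e) * m' j (Max e) * g (c e) i j\<bar>)"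
        by (intro sum_mono sum_abs)
      also have "\<dots> \<le> (\<Sum>i\<le>q. \<Sum>j\<le>q. 2 * G / real L)" using t by (intro sum_mono) auto
      also have "\<dots> = (real q + 1)\<^sup>2 * (2 * G / real L)" by (simp add: power2_eq_square add.commute)
      finally show ?thesis .
    qed
    have "\<bar>w m c - w m' c\<bar> \<le> (\<Sum>e\<in>complete_edges n. (real q + 1)\<^sup>2 * (2 * G / real L))"
      unfolding w_def sum_subtractf[symmetric]
      by (rule order_trans[OF sum_abs sum_mono]) (use e in \<open>simp only: sum_subtractf\<close>)
    also have "\<dots> = (2 * real (card (complete_edges n))) * ((real q + 1)\<^sup>2 * G / real L)" by simp
    also have "\<dots> \<le> (real n)\<^sup>2 * ((real q + 1)\<^sup>2 * G / real L)"
      using G0 by (intro mult_right_mono card_complete_edges_le) auto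
    finally show ?thesis by (simp add: err_def)
  qed
  \<comment> \<open>A rounded matrix need not be stochastic, so a member of \<open>\<Phi>\<close>
    with the same rounding stands in for it.\<close>
  define rep where "rep = inv_into \<Phi> \<kappa>"
  have rep: "rep x \<in> \<Phi>" "\<kappa> (rep x) = x" if "x \<in> \<kappa> ` \<Phi>" for x
    using inv_into_into[OF that] f_inv_into_f[OF that] by (simp_all add: rep_def)
  define B where "B m = {c \<in> colorings n k. t - err \<le> w m c}" for m
  have finB: "finite (B m)" for m by (rule finite_subset[of _ "colorings n k"]) (auto simp: B_def)
  have cardB: "real (card (B m)) \<le> exp (err - t)" if m: "m \<in> \<Phi>" for m
  proof -
    \<comment> \<open>Markov's inequality for the exponential weights, whose total is at most
      1.\<close>
    have "exp (t - err) * real (card (B m)) = (\<Sum>c\<in>B m. exp (t - err))" by simp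
    also have "\<dots> \<le> (\<Sum>c\<in>B m. exp (w m c))" by (intro sum_mono) (auto simp: B_def)
    also have "\<dots> \<le> (\<Sum>c\<in>colorings n k. exp (w m c))" by (intro sum_mono2) (auto simp: B_def)
    also have "\<dots> \<le> 1" unfolding w_def by (rule sum_exp_weights_le_1[OF g m0[OF m] m1[OF m]])
    finally show ?thesis by (simp add: exp_diff field_simps)
  qed
  have "{c \<in> colorings n k. \<exists>m\<in>\<Phi>. t \<le> w m c} \<subseteq> (\<Union>x\<in>\<kappa> ` \<Phi>. B (rep x))"
  proof
    fix c assume "c \<in> {c \<in> colorings n k. \<exists>m\<in>\<Phi>. t \<le> w m c}"
    then obtain m where c: "c \<in> colorings n k" and m: "m \<in> \<Phi>" "t \<le> w m c" by blast
    have x: "\<kappa> m \<in> \<kappa> ` \<Phi>" using m by blast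
    have "\<bar>w m c - w (rep (\<kappa> m)) c\<bar> \<le> err" using rep[OF x] by (intro close m) auto
    then have "c \<in> B (rep (\<kappa> m))" using c m(2) by (simp add: B_def)
    then show "c \<in> (\<Union>x\<in>\<kappa> ` \<Phi>. B (rep x))" using x by blast
  qed
  then have "card {c \<in> colorings n k. \<exists>m\<in>\<Phi>. t \<le> w m c} \<le> card (\<Union>x\<in>\<kappa> ` \<Phi>. B (rep x))"
    by (rule card_mono[OF finite_UN_I[OF fin\<kappa> finB]])
  also have "\<dots> \<le> (\<Sum>x\<in>\<kappa> ` \<Phi>. card (B (rep x)))" by (rule card_UN_le[OF fin\<kappa>])
  finally have "real (card {c \<in> colorings n k. \<exists>m\<in>\<Phi>. t \<le> w m c}) \<le>
      (\<Sum>x\<in>\<kappa> ` \<Phi>. real (card (B (rep x))))"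
    unfolding of_nat_sum[symmetric] of_nat_le_iff .
  also have "\<dots> \<le> (\<Sum>x\<in>\<kappa> ` \<Phi>. exp (err - t))" using rep by (intro sum_mono cardB) auto
  also have "\<dots> = real (card (\<kappa> ` \<Phi>)) * exp (err - t)" by simp
  also have "\<dots> \<le> (real L + 1) ^ ((q + 1) * n) * exp (err - t)"
  proof (intro mult_right_mono)
    have "real (card (\<kappa> ` \<Phi>)) \<le> real ((L + 1) ^ ((q + 1) * n))" using card\<kappa> by (subst of_nat_le_iff)
    then show "real (card (\<kappa> ` \<Phi>)) \<le> (real L + 1) ^ ((q + 1) * n)" by (simp add: add.commute)
  qed simp
  finally show ?thesis unfolding w_def err_def .
qed

section \<open>Independent edge colours\<close>

definition edge_prob :: "nat \<Rightarrow> (nat set \<Rightarrow> nat \<Rightarrow> real) \<Rightarrow> (nat set \<Rightarrow> nat) \<Rightarrow> real" where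
  "edge_prob n q c = (\<Prod>e\<in>complete_edges n. q e (c e))"

locale edge_law =
  fixes n k :: nat and q :: "nat set \<Rightarrow> nat \<Rightarrow> real"
  assumes q_nonneg: "\<And>e a. e \<in> complete_edges n \<Longrightarrow> a \<in> {1..k} \<Longrightarrow> q e a \<ge> 0"
    and q_sum: "\<And>e. e \<in> complete_edges n \<Longrightarrow> (\<Sum>a=1..k. q e a) = 1"
begin

abbreviation "E \<equiv> complete_edges n"
abbreviation "Q \<equiv> edge_prob n q"

lemma Q_nonneg: "c \<in> colorings n k \<Longrightarrow> Q c \<ge> 0"
  unfolding edge_prob_def using coloring_in
  by (intro prod_nonneg) (auto intro!: q_nonneg simp del: atLeastAtMost_iff)

lemma Q_sum: "(\<Sum>c\<in>colorings n k. Q c) = 1"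
  unfolding edge_prob_def prod_sum_colorings[symmetric] using q_sum by simp

lemma Q_exp: "(\<Sum>c\<in>colorings n k. Q c * exp (\<Sum>e\<in>E. f e (c e))) =
    (\<Prod>e\<in>E. \<Sum>a=1..k. q e a * exp (f e a))"
  unfolding prod_sum_colorings by (simp add: edge_prob_def exp_sum prod.distrib)

lemma Q_marginal:
  assumes e0: "e0 \<in> E"
  shows "(\<Sum>c\<in>colorings n k. Q c * f (c e0)) = (\<Sum>a=1..k. q e0 a * f a)"
proof -
  \<comment> \<open>Absorbing \<open>f\<close> into the factor of \<open>e0\<close> keeps the
    product form; each of the remaining factors sums to one.\<close>
  define h where "h e a = (if e = e0 then q e a * f a else q e a)" for e a
  have "Q c * f (c e0) = (\<Prod>e\<in>E. h e (c e))" for c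
  proof -
    have "(\<Prod>e\<in>E. h e (c e)) = h e0 (c e0) * (\<Prod>e\<in>E - {e0}. h e (c e))"
      by (rule prod.remove[OF _ e0]) simp
    also have "(\<Prod>e\<in>E - {e0}. h e (c e)) = (\<Prod>e\<in>E - {e0}. q e (c e))"
      by (intro prod.cong) (auto simp: h_def)
    also have "h e0 (c e0) * (\<Prod>e\<in>E - {e0}. q e (c e)) = f (c e0) * (\<Prod>e\<in>E. q e (c e))"
      by (subst prod.remove[OF _ e0, of "\<lambda>e. q e (c e)"]) (simp_all add: h_def)
    finally show ?thesis by (simp add: edge_prob_def)
  qed
  then have "(\<Sum>c\<in>colorings n k. Q c * f (c e0)) = (\<Prod>e\<in>E. \<Sum>a=1..k. h e a)"
    unfolding prod_sum_colorings by (intro sum.cong refl)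
  also have "\<dots> = (\<Sum>a=1..k. h e0 a) * (\<Prod>e\<in>E - {e0}. \<Sum>a=1..k. h e a)"
    by (rule prod.remove[OF _ e0]) simp
  also have "(\<Prod>e\<in>E - {e0}. \<Sum>a=1..k. h e a) = 1" using q_sum
    by (intro prod.neutral) (auto simp: h_def)
  finally show ?thesis by (simp add: h_def)
qed

lemma Q_expectation: "(\<Sum>c\<in>colorings n k. Q c * (\<Sum>e\<in>E. f e (c e))) = (\<Sum>e\<in>E. \<Sum>a=1..k. q e a * f e a)"
proof -
  have "(\<Sum>c\<in>colorings n k. Q c * (\<Sum>e\<in>E. f e (c e))) = (\<Sum>e\<in>E. \<Sum>c\<in>colorings n k. Q c * f e (c e))"
    by (subst sum.swap) (simp add: sum_distrib_left)
  also have "\<dots> = (\<Sum>e\<in>E. \<Sum>a=1..k. q e a * f e a)" by (intro sum.cong refl Q_marginal)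
  finally show ?thesis .
qed

text \<open>Where \<open>Q c = 0\<close>, the junk value \<open>ln 0 = 0\<close> is harmless: it is multiplied by \<open>Q c\<close>.\<close>

lemma gibbs_variational:
  "exp ((\<Sum>c\<in>colorings n k. Q c * h c) - (\<Sum>e\<in>E. \<Sum>a=1..k. q e a * ln (q e a))) \<le>
      (\<Sum>c\<in>colorings n k. exp (h c))"
proof -
  let ?y = "\<lambda>c. h c - (\<Sum>e\<in>E. ln (q e (c e)))"
  have ne: "colorings n k \<noteq> {}" using Q_sum by force
  have "(\<Sum>c\<in>colorings n k. Q c * h c) - (\<Sum>e\<in>E. \<Sum>a=1..k. q e a * ln (q e a)) =
      (\<Sum>c\<in>colorings n k. Q c *\<^sub>R ?y c)"
    unfolding Q_expectation[symmetric] by (simp add: right_diff_distrib sum_subtractf)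
  also have "exp \<dots> \<le> (\<Sum>c\<in>colorings n k. Q c * exp (?y c))"
    by (rule convex_on_sum[OF _ ne exp_convex Q_sum]) (auto intro: Q_nonneg)
  also have "\<dots> \<le> (\<Sum>c\<in>colorings n k. exp (h c))"
  proof (rule sum_mono)
    fix c assume c: "c \<in> colorings n k"
    show "Q c * exp (?y c) \<le> exp (h c)"
    proof (cases "Q c = 0")
      case False
      then have "q e (c e) > 0" if "e \<in> E" for e
        using q_nonneg[OF that coloring_in[OF c that]] that by (force simp: edge_prob_def)
      then have "exp (\<Sum>e\<in>E. ln (q e (c e))) = Q c" by (simp add: exp_sum edge_prob_def)
      then show ?thesis using False by (simp add: exp_diff)
    qed simp
  qed
  finally show ?thesis .
qed

end

lemma exp_le_quadratic: "exp z \<le> 1 + z + z\<^sup>2" if "\<bar>z\<bar> \<le> 1" for z :: real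
proof (cases "z \<ge> 0")
  case True
  then show ?thesis using that exp_bound[of z] by simp
next
  case False
  define y where "y = - z"
  have y: "0 < y" "y \<le> 1" using False that by (auto simp: y_def)
  have "exp z * (1 + y) \<le> exp z * exp y" by (intro mult_left_mono exp_ge_add_one_self) simp
  also have "\<dots> = 1" by (simp add: y_def flip: exp_add)
  \<comment> \<open>The product expands to \<open>1 + y^3\<close>.\<close>
  also have "1 \<le> (1 - y + y\<^sup>2) * (1 + y)" using y by (simp add: algebra_simps power2_eq_square)
  finally have "exp z \<le> 1 - y + y\<^sup>2" by (rule mult_right_le_imp_le) (use y in simp)
  then show ?thesis by (simp add: y_def)
qed

context edge_law
begin

text \<open>The linear term has mean zero because \<open>q e a0\<close> is the probability of the
  colour \<open>a0\<close>, so \<open>exp_le_quadratic\<close> leaves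
  \<open>1 + x^2\<close>.\<close>

lemma centered_exp_le:
  assumes e: "e \<in> E" and a0: "a0 \<in> {1..k}" and x: "\<bar>x\<bar> \<le> 1"
  shows "(\<Sum>a=1..k. q e a * exp (x * (of_bool (a = a0) - q e a0))) \<le> exp (x\<^sup>2)"
proof -
  have q1: "q e a0 \<le> 1"
    using q_sum[OF e] member_le_sum[of a0 "{1..k}" "q e"] a0 q_nonneg[OF e] by simp
  let ?y = "\<lambda>a. of_bool (a = a0) - q e a0"
  have y: "\<bar>?y a\<bar> \<le> 1" for a using q1 q_nonneg[OF e a0] by (auto simp: of_bool_def)
  have xy: "\<bar>x * ?y a\<bar> \<le> 1" for a unfolding abs_mult using x y[of a] mult_le_one[of "\<bar>x\<bar>" "\<bar>?y a\<bar>"]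
    by simp
  have "(\<Sum>a=1..k. q e a * exp (x * ?y a)) \<le> (\<Sum>a=1..k. q e a * (1 + x * ?y a + x\<^sup>2))"
  proof (intro sum_mono mult_left_mono)
    fix a
    have "(x * ?y a)\<^sup>2 \<le> x\<^sup>2" using y[of a]
      by (simp add: power_mult_distrib mult_left_le abs_square_le_1)
    then show "exp (x * ?y a) \<le> 1 + x * ?y a + x\<^sup>2" using exp_le_quadratic[OF xy, of a] by linarith
  qed (use q_nonneg[OF e] in auto)
  also have "\<dots> = (1 + x\<^sup>2 - x * q e a0) * (\<Sum>a=1..k. q e a) + x * (\<Sum>a=1..k. q e a * of_bool (a =
      a0))"
    unfolding sum_distrib_left sum.distrib[symmetric]
    by (intro sum.cong refl) (simp add: algebra_simps)
  also have "(\<Sum>a=1..k. q e a * of_bool (a = a0)) = q e a0"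
  proof -
    have "(\<Sum>a=1..k. q e a * of_bool (a = a0)) = (\<Sum>a=1..k. if a = a0 then q e a else 0)"
      by (intro sum.cong) auto
    then show ?thesis using a0 by simp
  qed
  also have "(1 + x\<^sup>2 - x * q e a0) * (\<Sum>a=1..k. q e a) + x * q e a0 = 1 + x\<^sup>2"
    unfolding q_sum[OF e] by simp
  also have "\<dots> \<le> exp (x\<^sup>2)" by (rule exp_ge_add_one_self)
  finally show ?thesis .
qed

text \<open>Chernoff bound with parameter \<open>s = r / 4\<close>. Each edge contributes at most
  \<open>exp (4 * s^2)\<close> and there are at most \<open>n^2 / 2\<close> edges, so the exponent
  is \<open>n^2\<close> times \<open>2 * s^2 - s * r = - r^2 / 8\<close>; \<open>r \<le> 2\<close>
  keeps \<open>s * x e\<close> within the range of the quadratic bound.\<close>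

lemma deviation_prob:
  assumes a0: "a0 \<in> {1..k}" and x: "\<And>e. e \<in> E \<Longrightarrow> \<bar>x e\<bar> \<le> 2" and r: "0 < r" "r \<le> 2"
  shows "(\<Sum>c\<in>{c\<in>colorings n k. r * (real n)\<^sup>2 <
      (\<Sum>e\<in>E. x e * (of_bool (c e = a0) - q e a0))}. Q c) \<le> exp (- (r\<^sup>2 / 8) * (real n)\<^sup>2)"
proof -
  define s where "s = r / 4"
  define D where "D c = (\<Sum>e\<in>E. x e * (of_bool (c e = a0) - q e a0))" for c
  let ?B = "{c\<in>colorings n k. r * (real n)\<^sup>2 < D c}"
  have "exp (s * r * (real n)\<^sup>2) * (\<Sum>c\<in>?B. Q c) = (\<Sum>c\<in>?B. Q c * exp (s * r * (real n)\<^sup>2))"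
    by (simp add: sum_distrib_left mult.commute)
  also have "\<dots> \<le> (\<Sum>c\<in>?B. Q c * exp (s * D c))"
    using r by (intro sum_mono mult_left_mono) (auto simp: s_def intro: Q_nonneg)
  also have "\<dots> \<le> (\<Sum>c\<in>colorings n k. Q c * exp (s * D c))"
    by (intro sum_mono2) (auto intro: mult_nonneg_nonneg Q_nonneg)
  also have "\<dots> = (\<Sum>c\<in>colorings n k. Q c * exp (\<Sum>e\<in>E. (\<lambda>e a. s * x e * (of_bool (a =
      a0) - q e a0)) e (c e)))"
    by (simp add: D_def sum_distrib_left mult.assoc)
  also have "\<dots> = (\<Prod>e\<in>E. \<Sum>a=1..k. q e a * exp (s * x e * (of_bool (a = a0) - q e a0)))"
    by (rule Q_exp)
  also have "\<dots> \<le> (\<Prod>e\<in>E. exp (4 * s\<^sup>2))"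
  proof (intro prod_mono conjI)
    fix e assume e: "e \<in> E"
    show "0 \<le> (\<Sum>a=1..k. q e a * exp (s * x e * (of_bool (a = a0) - q e a0)))"
      using q_nonneg[OF e] by (intro sum_nonneg) auto
    have sx: "\<bar>s * x e\<bar> \<le> s * 2" unfolding abs_mult using x[OF e] r
      by (intro mult_mono) (auto simp: s_def)
    have "(s * x e)\<^sup>2 \<le> (s * 2)\<^sup>2" using sx power_mono[of "\<bar>s * x e\<bar>" "s * 2" 2] by simp
    then have "exp ((s * x e)\<^sup>2) \<le> exp (4 * s\<^sup>2)" by (simp add: power_mult_distrib)
    moreover have "\<bar>s * x e\<bar> \<le> 1" using sx r by (simp add: s_def)
    ultimately show "(\<Sum>a=1..k. q e a * exp (s * x e * (of_bool (a = a0) - q e a0))) \<le> exp (4 * s\<^sup>2)"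
      using centered_exp_le[OF e a0, of "s * x e"] by linarith
  qed
  also have "\<dots> = exp (2 * s\<^sup>2 * (2 * real (card E)))"
    by (simp add: exp_of_nat_mult[symmetric] mult_ac)
  also have "\<dots> \<le> exp (2 * s\<^sup>2 * (real n)\<^sup>2)"
    using card_complete_edges_le[of n] by (intro exp_le_cancel_iff[THEN iffD2] mult_left_mono) auto
  finally have "(\<Sum>c\<in>?B. Q c) \<le> exp (2 * s\<^sup>2 * (real n)\<^sup>2) / exp (s * r * (real n)\<^sup>2)"
    by (simp add: field_simps)
  also have "\<dots> = exp (- (r\<^sup>2 / 8) * (real n)\<^sup>2)"
    unfolding exp_diff[symmetric]
    by (rule arg_cong[where f=exp]) (simp add: s_def power2_eq_square field_simps)
  finally show ?thesis by (simp add: D_def)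
qed

end

section \<open>Counting the colourings near a graphon\<close>

definition empirical_matrix :: "nat \<Rightarrow> nat \<Rightarrow> (nat set \<Rightarrow> nat) \<Rightarrow> nat \<Rightarrow> nat \<Rightarrow> nat \<Rightarrow> real" where
  "empirical_matrix n k c a u v = (if u \<in> {1..n} \<and> v \<in> {1..n} \<and> u \<noteq> v then of_bool (c {u, v} =
      a) else 1 / real k)"

lemma empirical_graphon_step: "empirical_graphon n k c a =
    step (block n) (empirical_matrix n k c a)"
  by (rule ext) (simp add: empirical_graphon_def step_def empirical_matrix_def block_def Let_def
      case_prod_beta)

lemma xlnx_ge: "x * ln x \<ge> x - 1" if "x \<ge> 0" for x :: real
proof (cases "x = 0")
  case False
  then have x: "x > 0" using that by simp
  have "- ln x \<le> inverse x - 1" using ln_le_minus_one[of "inverse x"] x by (simp add: ln_inverse)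
  then have "x * (- ln x) \<le> x * (inverse x - 1)" using x by (intro mult_left_mono) auto
  then show ?thesis using x by (simp add: algebra_simps)
qed simp

lemma xlnx_bound: "\<bar>x * ln x\<bar> \<le> 1" if "x \<in> {0..1}" for x :: real
proof -
  have "x * ln x \<le> 0" using that by (cases "x = 0") (auto simp: mult_le_0_iff ln_le_zero_iff)
  then show ?thesis using xlnx_ge[of x] that by (simp add: abs_if)
qed

lemma ln_lipschitz:
  fixes x y m :: real
  assumes "m > 0" "m \<le> x" "m \<le> y" shows "\<bar>ln x - ln y\<bar> \<le> \<bar>x - y\<bar> / m"
proof -
  have le: "ln x - ln y \<le> \<bar>x - y\<bar> / m" if "m \<le> x" "m \<le> y" for x y :: real
  proof -
    have "ln x - ln y \<le> (x - y) / y" using that assms(1) by (intro ln_diff_le) auto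
    also have "\<dots> \<le> \<bar>x - y\<bar> / y" using that assms(1) by (intro divide_right_mono) auto
    also have "\<dots> \<le> \<bar>x - y\<bar> / m" using that assms(1) by (intro divide_left_mono) auto
    finally show ?thesis .
  qed
  show ?thesis using le[of x y] le[of y x] assms by (auto simp: abs_minus_commute abs_le_iff)
qed

lemma bdd_fun_entropy:
  assumes W: "W \<in> prob_graphons k" and a: "a \<in> {1..k}"
  shows "bdd_fun (\<lambda>p. W a p * ln (W a p))"
proof (rule bdd_funI[where B=1])
  have "W a \<in> borel_measurable unit_square" using prob_graphons_bdd[OF W a]
    by (simp add: bdd_fun_def)
  then show "(\<lambda>p. W a p * ln (W a p)) \<in> borel_measurable unit_square"
    by (intro borel_measurable_times borel_measurable_ln)
qed (rule xlnx_bound, rule graphon_01[OF W a])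

lemma graphon_sum:
  assumes "W \<in> prob_graphons k" "p \<in> space unit_square"
  shows "(\<Sum>a=1..k. W a p) = 1"
proof -
  obtain x y where "p = (x, y)" "x \<in> {0..1}" "y \<in> {0..1}" using assms(2)
    by (auto simp: space_unit_square)
  then show ?thesis using assms(1) by (auto simp: prob_graphons_def prob_simplex_def)
qed

lemma avg_sum:
  assumes "finite I" "\<And>a. a \<in> I \<Longrightarrow> bdd_fun (f a)"
  shows "avg n (\<lambda>p. \<Sum>a\<in>I. f a p) u v = (\<Sum>a\<in>I. avg n (f a) u v)"
  using assms
proof (induction I rule: finite_induct)
  case empty
  then show ?case by (simp add: avg_def set_lebesgue_integral_def)
next
  case (insert x I)
  then show ?case by (simp add: avg_add bdd_fun_sum)
qed

lemma avg_cong: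
  assumes "\<And>p. p \<in> space unit_square \<Longrightarrow> f p = g p" shows "avg n f u v = avg n g u v"
proof -
  have "(LINT p:E|unit_square. f p) = (LINT p:E|unit_square. g p)" for E
    unfolding set_lebesgue_integral_def
    by (intro Bochner_Integration.integral_cong) (auto simp: assms)
  then show ?thesis by (simp add: avg_def)
qed

lemma graphon_avg_sum:
  assumes n: "n \<ge> 1" and W: "W \<in> prob_graphons k"
  shows "(\<Sum>a=1..k. avg n (W a) u v) = (if u \<in> {1..n} \<and> v \<in> {1..n} then 1 else 0)"
proof -
  have "(\<Sum>a=1..k. avg n (W a) u v) = avg n (\<lambda>p. \<Sum>a=1..k. W a p) u v"
    by (rule avg_sum[symmetric]) (auto intro: prob_graphons_bdd[OF W])
  also have "\<dots> = avg n (\<lambda>_. 1) u v" by (rule avg_cong) (rule graphon_sum[OF W])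
  finally show ?thesis by (simp only: avg_const[OF n])
qed

lemma graphon_avg_sym:
  assumes W: "W \<in> prob_graphons k" and a: "a \<in> {1..k}"
  shows "avg n (W a) u v = avg n (W a) v u"
proof -
  let ?c = "cell (block n)"
  have "(LINT p:?c u \<times> ?c v|unit_square. W a p) =
      (LINT p:?c u \<times> ?c v|unit_square. W a (snd p, fst p))"
    unfolding set_lebesgue_integral_def
    using W a
    by (intro Bochner_Integration.integral_cong) (auto simp: space_unit_square prob_graphons_def)
  also have "\<dots> = (LINT p:?c v \<times> ?c u|unit_square. W a p)"
    by (intro set_integral_swap prob_graphons_bdd[OF W a] cell_sets[OF labelling_block])
  finally show ?thesis by (simp add: avg_def)
qed

text \<open>The Gibbs inequality is nearly attained by step functions: mix \<open>W\<close> with the uniform law to keep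
  the logarithm Lipschitz, and average over a fine grid.\<close>

lemma entropy_dual_steps:
  assumes k: "k \<ge> 1" and W: "W \<in> prob_graphons k" and eps: "\<epsilon> > 0"
  shows "\<exists>q\<ge>1. \<exists>g G. (\<forall>i j. (\<Sum>a=1..k. exp (g a i j)) \<le> 1) \<and> (\<forall>a i j. \<bar>g a i j\<bar> \<le> G \<and> g a i j \<le> 0 \<and>
      g a i j = g a j i) \<and>
    graphon_entropy k W - \<epsilon> \<le> (\<Sum>a=1..k. LINT p|unit_square. W a p * step (block q) (g a) p)"
proof -
  \<comment> \<open>This choice makes \<open>ln (1 - \<eta>)\<close> equal to
    \<open>- \<epsilon> / 2\<close>, the loss that mixing causes in the logarithm.\<close>
  define \<eta> where "\<eta> = 1 - exp (- \<epsilon> / 2)"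
  have \<eta>: "0 < \<eta>" "\<eta> < 1" using eps by (simp_all add: \<eta>_def)
  have ln\<eta>: "ln (1 - \<eta>) = - \<epsilon> / 2" by (simp add: \<eta>_def)
  \<comment> \<open>The mass that the uniform part gives to each colour; above it \<open>ln\<close>
    is Lipschitz with constant \<open>1/m\<close>.\<close>
  define m where "m = \<eta> / real k"
  have m: "m > 0" "m \<le> 1" "real k * m = \<eta>" using \<eta> k by (auto simp: m_def divide_simps)
  \<comment> \<open>The factor \<open>m\<close> cancels the Lipschitz constant, and the sum over the
    \<open>k\<close> colours is \<open>\<epsilon> / 2\<close>.\<close>
  have "\<forall>\<^sub>F n in sequentially. avg_err n (W a) < \<epsilon> * m / (2 * real k)" if "a \<in> {1..k}" for a
    using graphon_avg_err[OF W that] eps m k by (intro order_tendstoD(2)) auto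
  then have "\<forall>\<^sub>F n in sequentially. \<forall>a\<in>{1..k}. avg_err n (W a) < \<epsilon> * m / (2 * real k)"
    by (intro eventually_ball_finite) auto
  then have "\<forall>\<^sub>F n in sequentially. (\<forall>a\<in>{1..k}. avg_err n (W a) < \<epsilon> * m / (2 * real k)) \<and> n \<ge> 1"
    by (intro eventually_conj eventually_ge_at_top)
  then obtain q where q: "\<forall>a\<in>{1..k}. avg_err q (W a) < \<epsilon> * m / (2 * real k)" "q \<ge> 1"
    by (auto dest: eventually_happens)
  define P where "P a i j = (1 - \<eta>) * avg q (W a) i j + m" for a i j
  \<comment> \<open>The value 0 outside the colours keeps the bound, the sign and the symmetry true
    at every index.\<close>
  define g where "g a i j = (if a \<in> {1..k} then ln (P a i j) else 0)" for a i j
  have P: "m \<le> P a i j" "P a i j \<le> 1" if "a \<in> {1..k}" for a i j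
  proof -
    have av: "0 \<le> avg q (W a) i j" "avg q (W a) i j \<le> 1"
      using graphon_avg_01[OF q(2) W that, of i j] by auto
    show "m \<le> P a i j" using av \<eta> by (simp add: P_def)
    have "m \<le> \<eta>" using k \<eta> by (simp add: m_def field_simps)
    moreover have "(1 - \<eta>) * avg q (W a) i j \<le> 1 - \<eta>" using av \<eta> by (intro mult_left_le) auto
    ultimately show "P a i j \<le> 1" by (simp add: P_def)
  qed
  have sum_le: "(\<Sum>a=1..k. exp (g a i j)) \<le> 1" for i j
  proof -
    have "(\<Sum>a=1..k. exp (g a i j)) = (\<Sum>a=1..k. P a i j)"
      using P m(1) by (intro sum.cong refl) (auto simp: g_def intro!: exp_ln intro: less_le_trans)
    also have "\<dots> = (1 - \<eta>) * (\<Sum>a=1..k. avg q (W a) i j) + real k * m"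
      by (simp add: P_def sum.distrib sum_distrib_left)
    also have "\<dots> \<le> (1 - \<eta>) * 1 + \<eta>"
      unfolding graphon_avg_sum[OF q(2) W] m(3) using \<eta> by (intro add_mono mult_left_mono) auto
    finally show ?thesis by simp
  qed
  have bnd: "\<bar>g a i j\<bar> \<le> - ln m \<and> g a i j \<le> 0 \<and> g a i j = g a j i" for a i j
  proof (cases "a \<in> {1..k}")
    case True
    have "ln m \<le> ln (P a i j)" "ln (P a i j) \<le> 0"
      using P[OF True, of i j] m by (auto simp: ln_le_zero_iff)
    moreover have "P a i j = P a j i" unfolding P_def using graphon_avg_sym[OF W True] by metis
    ultimately show ?thesis using True by (simp add: g_def)
  next
    case False
    then show ?thesis using m by (auto simp: g_def ln_le_zero_iff)
  qed
  have main: "(LINT p|unit_square. W a p * step (block q) (g a) p) \<ge>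
      (LINT p|unit_square. W a p * ln (W a p)) - \<epsilon> / 2 * (LINT p|unit_square. W a p) - \<epsilon> /
          (2 * real k)" if a: "a \<in> {1..k}" for a
  proof -
    note Wb = prob_graphons_bdd[OF W a]
    let ?e = "\<lambda>p. \<bar>step (block q) (avg q (W a)) p - W a p\<bar>"
    have eb: "bdd_fun ?e" by (intro bdd_fun_abs bdd_fun_diff bdd_fun_step_block Wb)
    have "(LINT p|unit_square. W a p * ln (W a p) + (- \<epsilon> / 2) * W a p - (1 / m) * ?e p) \<le>
        (LINT p|unit_square. W a p * step (block q) (g a) p)"
    proof (intro integral_mono bdd_fun_integrable)
      show "bdd_fun (\<lambda>p. W a p * ln (W a p) + (- \<epsilon> / 2) * W a p - (1 / m) * ?e p)"
        by (intro bdd_fun_add bdd_fun_diff bdd_fun_cmult bdd_fun_entropy[OF W a] Wb eb)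
      show "bdd_fun (\<lambda>p. W a p * step (block q) (g a) p)"
        by (intro bdd_fun_mult Wb bdd_fun_step_block)
      fix p assume p: "p \<in> space unit_square"
      then obtain x y where xy: "p = (x, y)" "x \<in> {0..1}" "y \<in> {0..1}"
        by (auto simp: space_unit_square)
      define w where "w = W a p"
      define A where "A = step (block q) (avg q (W a)) p"
      have w: "0 \<le> w" "w \<le> 1" using graphon_01[OF W a xy(2,3)] by (auto simp: w_def xy(1))
      have A: "step (block q) (g a) p = ln ((1 - \<eta>) * A + m)" using a
        by (simp add: A_def xy(1) step_def g_def P_def)
      have Am: "m \<le> (1 - \<eta>) * A + m" using P(1)[OF a] by (simp add: A_def xy(1) step_def P_def)
      have wm: "m \<le> (1 - \<eta>) * w + m" using w \<eta> by simp
      have "\<bar>ln ((1 - \<eta>) * A + m) - ln ((1 - \<eta>) * w + m)\<bar> \<le>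
          \<bar>((1 - \<eta>) * A + m) - ((1 - \<eta>) * w + m)\<bar> / m"
        by (rule ln_lipschitz[OF m(1) Am wm])
      also have "\<bar>((1 - \<eta>) * A + m) - ((1 - \<eta>) * w + m)\<bar> = (1 - \<eta>) * \<bar>A - w\<bar>"
        using \<eta> by (simp add: abs_mult right_diff_distrib[symmetric])
      also have "(1 - \<eta>) * \<bar>A - w\<bar> / m \<le> 1 * \<bar>A - w\<bar> / m"
        using \<eta> m by (intro divide_right_mono mult_right_mono) auto
      finally have lip: "ln ((1 - \<eta>) * A + m) \<ge> ln ((1 - \<eta>) * w + m) - \<bar>A - w\<bar> / m" by linarith
      \<comment> \<open>For \<open>w = 0\<close> both sides vanish; for \<open>w > 0\<close>
        dropping \<open>m\<close> inside the logarithm splits off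
        \<open>ln (1 - \<eta>)\<close>.\<close>
      have "w * ln ((1 - \<eta>) * w + m) \<ge> w * ln w + w * (- \<epsilon> / 2)"
      proof (cases "w = 0")
        case False
        then have w0: "w > 0" using w by simp
        have "ln ((1 - \<eta>) * w) \<le> ln ((1 - \<eta>) * w + m)" using w0 \<eta> m by (intro ln_mono) auto
        moreover have "ln ((1 - \<eta>) * w) = ln (1 - \<eta>) + ln w" using w0 \<eta> by (intro ln_mult_pos) auto
        ultimately have "ln w + (- \<epsilon> / 2) \<le> ln ((1 - \<eta>) * w + m)" using ln\<eta> by linarith
        then have "w * (ln w + (- \<epsilon> / 2)) \<le> w * ln ((1 - \<eta>) * w + m)" using w
          by (intro mult_left_mono)
        then show ?thesis by (simp only: distrib_left)
      qed simp
      moreover have "w * (\<bar>A - w\<bar> / m) \<le> 1 * (\<bar>A - w\<bar> / m)" using w m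
        by (intro mult_right_mono) auto
      moreover have "w * (ln ((1 - \<eta>) * w + m) - \<bar>A - w\<bar> / m) \<le> w * ln ((1 - \<eta>) * A + m)"
        using w lip by (intro mult_left_mono)
      ultimately have "w * ln w + w * (- \<epsilon> / 2) - \<bar>A - w\<bar> / m \<le> w * ln ((1 - \<eta>) * A + m)"
        by (simp add: right_diff_distrib)
      then show "W a p * ln (W a p) + (- \<epsilon> / 2) * W a p - (1 / m) * ?e p \<le>
          W a p * step (block q) (g a) p"
        unfolding A by (simp add: w_def A_def mult.commute)
    qed
    moreover have "(LINT p|unit_square. W a p * ln (W a p) + (- \<epsilon> / 2) * W a p - (1 / m) * ?e p) =
      (LINT p|unit_square. W a p * ln (W a p)) + (- \<epsilon> / 2) * (LINT p|unit_square. W a p) - (1 / m)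
          * avg_err q (W a)"
      unfolding avg_err_def
      by (subst Bochner_Integration.integral_diff Bochner_Integration.integral_add;
          (intro bdd_fun_integrable bdd_fun_add bdd_fun_cmult bdd_fun_entropy[OF W a] Wb eb)?)+ simp
    moreover have "(1 / m) * avg_err q (W a) \<le> \<epsilon> / (2 * real k)"
    proof -
      have "avg_err q (W a) \<le> \<epsilon> * m / (2 * real k)" using q a by force
      then have "(1 / m) * avg_err q (W a) \<le> (1 / m) * (\<epsilon> * m / (2 * real k))" using m
        by (intro mult_left_mono) auto
      also have "\<dots> = \<epsilon> / (2 * real k)" using m by simp
      finally show ?thesis .
    qed
    ultimately show ?thesis by simp
  qed
  have sumW: "(\<Sum>a=1..k. LINT p|unit_square. W a p) = 1"
  proof -
    have "(\<Sum>a=1..k. LINT p|unit_square. W a p) = (LINT p|unit_square. (\<Sum>a=1..k. W a p))"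
      by (rule Bochner_Integration.integral_sum[symmetric])
          (intro bdd_fun_integrable prob_graphons_bdd[OF W])
    also have "\<dots> = (LINT p|unit_square. 1)"
      by (intro Bochner_Integration.integral_cong refl graphon_sum[OF W])
    finally show ?thesis using unit_square.prob_space by simp
  qed
  have "(\<Sum>a=1..k. (LINT p|unit_square. W a p * ln (W a p)) - \<epsilon> / 2 * (LINT p|unit_square. W a p) -
      \<epsilon> / (2 * real k)) \<le>
     (\<Sum>a=1..k. LINT p|unit_square. W a p * step (block q) (g a) p)"
    by (intro sum_mono main)
  moreover have "(\<Sum>a=1..k. (LINT p|unit_square. W a p * ln (W a p)) - \<epsilon> / 2 * (LINT p|unit_square.
      W a p) - \<epsilon> / (2 * real k)) =
     graphon_entropy k W - \<epsilon>"
    unfolding sum_subtractf sum_distrib_left[symmetric] sumW graphon_entropy_def using k by simp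
  ultimately show ?thesis using q(2) sum_le bnd
    by (intro exI[of _ q] conjI exI[of _ g] exI[of _ "- ln m"] allI) (blast | simp)+
qed

section \<open>Pairing empirical graphons with rearranged step functions\<close>

lemma integral_mp:
  assumes F: "bdd_fun F" and \<phi>: "\<phi> \<in> mp_bijections"
  shows "(LINT p|unit_square. (\<lambda>(x, y). F (\<phi> x, \<phi> y)) p) = (LINT p|unit_square. F p)"
proof -
  have "(LINT p|unit_square. F p) = (LINT p|distr unit_square unit_square (\<lambda>(x, y). (\<phi> x, \<phi> y)).
      F p)"
    by (simp add: mp_square(2)[OF \<phi>])
  also have "\<dots> = (LINT p|unit_square. F ((\<lambda>(x, y). (\<phi> x, \<phi> y)) p))"
    by (rule integral_distr[OF mp_square(1)[OF \<phi>] bdd_fun_measurable[OF F]])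
  finally show ?thesis by (simp add: case_prod_beta')
qed

lemma labelling_mp:
  assumes b: "labelling q b" and \<phi>: "\<phi> \<in> mp_bijections" shows "labelling q (\<lambda>x. b (\<phi> x))"
  using b measurable_compose[OF mp_bijectionsD(2)[OF \<phi>], of b "count_space UNIV"] mp_in[OF \<phi>]
  by (auto simp: labelling_def simp del: atLeastAtMost_iff)

text \<open>The fraction of vertex block \<open>u\<close> occupied by cell \<open>i\<close>; for a
  labelling, every column with \<open>u \<in> {1..n}\<close> is a probability vector.\<close>

definition overlap :: "nat \<Rightarrow> (real \<Rightarrow> nat) \<Rightarrow> nat \<Rightarrow> nat \<Rightarrow> real" where
  "overlap n b i u = real n * leb (cell b i \<inter> cell (block n) u)"

lemma overlap_nonneg: "overlap n b i u \<ge> 0"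
  by (simp add: overlap_def)

lemma overlap_sum:
  assumes b: "labelling q b" and u: "u \<in> {1..n}"
  shows "(\<Sum>i\<le>q. overlap n b i u) = 1"
proof -
  have n: "n \<ge> 1" using u by simp
  have "(\<Sum>i\<le>q. leb (cell (block n) u \<inter> cell b i)) = leb (cell (block n) u)"
    by (rule leb_sum_cells[OF b cell_sets[OF labelling_block]])
  also have "\<dots> = 1 / real n" unfolding leb_cell_block[OF n] using u by simp
  finally show ?thesis using n by (simp add: overlap_def sum_distrib_left[symmetric] Int_commute)
qed

lemma sum_rotate3:
  "(\<Sum>j\<in>C. \<Sum>u\<in>A. \<Sum>v\<in>B. F j u v) = (\<Sum>u\<in>A. \<Sum>v\<in>B. \<Sum>j\<in>C. F j u v)"
proof -
  have "(\<Sum>j\<in>C. \<Sum>u\<in>A. \<Sum>v\<in>B. F j u v) = (\<Sum>u\<in>A. \<Sum>j\<in>C. \<Sum>v\<in>B. F j u v)"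
    by (rule sum.swap)
  also have "\<dots> = (\<Sum>u\<in>A. \<Sum>v\<in>B. \<Sum>j\<in>C. F j u v)"
    by (rule sum.cong[OF refl]) (rule sum.swap)
  finally show ?thesis .
qed

text \<open>Only an inequality, because the diagonal blocks pair the uniform value
  \<open>1/k\<close> with \<open>g \<le> 0\<close> and are dropped. The symmetry of \<open>g\<close>
  merges the two orientations of an edge, whence the factor 2.\<close>

lemma empirical_pairing:
  assumes k: "k \<ge> 1" and n: "n \<ge> 1" and c: "c \<in> colorings n k" and b: "labelling q b"
    and g: "\<And>a i j. g a i j \<le> 0" and sym: "\<And>a i j. g a i j = g a j i"
  shows "(real n)\<^sup>2 * (\<Sum>a=1..k. LINT p|unit_square. empirical_graphon n k c a p * step b (g a) p) \<le>
    2 * (\<Sum>e\<in>complete_edges n. \<Sum>i\<le>q. \<Sum>j\<le>q. overlap n b i (Min e) * overlap n b j (Max e) * g (c e) i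
        j)"
proof -
  let ?o = "overlap n b"
  define w where "w u v a = (\<Sum>i\<le>q. \<Sum>j\<le>q. ?o i u * ?o j v * g a i j)" for u v a
  have w0: "w u v a \<le> 0" for u v a
    unfolding w_def using g overlap_nonneg
    by (intro sum_nonpos mult_nonneg_nonpos mult_nonneg_nonneg) auto
  have wsym: "w u v a = w v u a" for u v a
  proof -
    have "w u v a = (\<Sum>j\<le>q. \<Sum>i\<le>q. ?o i u * ?o j v * g a i j)" unfolding w_def by (rule sum.swap)
    also have "\<dots> = w v u a" unfolding w_def
      by (intro sum.cong refl) (simp add: sym[of a] mult.commute)
    finally show ?thesis .
  qed
  have rect: "(real n)\<^sup>2 * (LINT p:cell b i \<times> cell b j|unit_square. empirical_graphon n k c a p) =
      (\<Sum>u\<in>{1..n}. \<Sum>v\<in>{1..n}. empirical_matrix n k c a u v * (?o i u * ?o j v))" for a i j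
  proof -
    note cb = cell_sets[OF b]
    have z: "leb (cell b i \<inter> cell (block n) 0) = 0" for i
    proof -
      have "leb (cell b i \<inter> cell (block n) 0) \<le> leb (cell (block n) 0)"
        by (intro unit_interval.finite_measure_mono cell_sets[OF labelling_block]) auto
      then show ?thesis using leb_cell_block[OF n, of 0] by (simp add: measure_le_0_iff)
    qed
    have "(LINT p:cell b i \<times> cell b j|unit_square. empirical_graphon n k c a p) =
      (\<Sum>u\<le>n. \<Sum>v\<le>n. empirical_matrix n k c a u v * (leb (cell b i \<inter> cell (block n) u) * leb (cell b
          j \<inter> cell (block n) v)))"
      unfolding empirical_graphon_step by (rule set_integral_step[OF labelling_block cb cb])
    also have "\<dots> = (\<Sum>u\<in>{1..n}. \<Sum>v\<in>{1..n}. empirical_matrix n k c a u v *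
        (leb (cell b i \<inter> cell (block n) u) * leb (cell b j \<inter> cell (block n) v)))"
      by (simp add: sum_atMost_split z)
    finally show ?thesis
      by (simp add: overlap_def sum_distrib_left power2_eq_square mult_ac)
  qed
  have eb: "bdd_fun (empirical_graphon n k c a)" for a
    unfolding empirical_graphon_step by (rule bdd_fun_step_block)
  have "(real n)\<^sup>2 * (\<Sum>a=1..k. LINT p|unit_square. empirical_graphon n k c a p * step b (g a) p) =
     (\<Sum>a=1..k. \<Sum>i\<le>q. \<Sum>j\<le>q. g a i j * ((real n)\<^sup>2 * (LINT p:cell b i \<times> cell b j|unit_square.
         empirical_graphon n k c a p)))"
    unfolding integral_mult_step[OF eb b] by (simp add: sum_distrib_left mult_ac)
  also have "\<dots> = (\<Sum>a=1..k. \<Sum>i\<le>q. \<Sum>j\<le>q. \<Sum>u\<in>{1..n}. \<Sum>v\<in>{1..n}.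
      empirical_matrix n k c a u v * (?o i u * ?o j v * g a i j))"
    unfolding rect sum_distrib_left by (intro sum.cong refl) (simp add: mult_ac)
  also have "\<dots> = (\<Sum>a=1..k. \<Sum>u\<in>{1..n}. \<Sum>v\<in>{1..n}. empirical_matrix n k c a u v * w u v a)"
  proof (rule sum.cong[OF refl])
    fix a
    have "(\<Sum>i\<le>q. \<Sum>j\<le>q. \<Sum>u\<in>{1..n}. \<Sum>v\<in>{1..n}. empirical_matrix n k c a u v *
        (?o i u * ?o j v * g a i j)) =
      (\<Sum>i\<le>q. \<Sum>u\<in>{1..n}. \<Sum>v\<in>{1..n}. \<Sum>j\<le>q. empirical_matrix n k c a u v * (?o i u * ?o j v * g a i
          j))"
      by (rule sum.cong[OF refl]) (rule sum_rotate3)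
    also have "\<dots> = (\<Sum>u\<in>{1..n}. \<Sum>v\<in>{1..n}. \<Sum>i\<le>q. \<Sum>j\<le>q.
        empirical_matrix n k c a u v * (?o i u * ?o j v * g a i j))"
      by (rule sum_rotate3)
    also have "\<dots> = (\<Sum>u\<in>{1..n}. \<Sum>v\<in>{1..n}. empirical_matrix n k c a u v * w u v a)"
      unfolding w_def sum_distrib_left by (rule refl)
    finally show "(\<Sum>i\<le>q. \<Sum>j\<le>q. \<Sum>u\<in>{1..n}. \<Sum>v\<in>{1..n}.
        empirical_matrix n k c a u v * (?o i u * ?o j v * g a i j)) = \<dots>" .
  qed
  also have "\<dots> = (\<Sum>u\<in>{1..n}. \<Sum>v\<in>{1..n}. \<Sum>a=1..k. empirical_matrix n k c a u v * w u v a)"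
    by (rule sum_rotate3)
  also have "\<dots> \<le> (\<Sum>u\<in>{1..n}. \<Sum>v\<in>{1..n}. if u \<noteq> v then w u v (c {u, v}) else 0)"
  proof (intro sum_mono)
    fix u v assume uv: "u \<in> {1..n}" "v \<in> {1..n}"
    show "(\<Sum>a=1..k. empirical_matrix n k c a u v * w u v a) \<le>
        (if u \<noteq> v then w u v (c {u, v}) else 0)"
    proof (cases "u = v")
      case True
      then show ?thesis using w0
        by (auto simp: empirical_matrix_def intro!: sum_nonpos divide_nonpos_nonneg)
    next
      case False
      then have "c {u, v} \<in> {1..k}" using uv
        by (intro coloring_in[OF c]) (auto simp: complete_edges_def)
      moreover have "(\<Sum>a=1..k. empirical_matrix n k c a u v * w u v a) =
          (\<Sum>a=1..k. if a = c {u, v} then w u v a else 0)"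
        using uv False by (intro sum.cong refl) (auto simp: empirical_matrix_def)
      ultimately show ?thesis using False by simp
    qed
  qed
  also have "\<dots> = (\<Sum>e\<in>complete_edges n. w (Min e) (Max e) (c {Min e, Max e}) +
      w (Max e) (Min e) (c {Max e, Min e}))"
    by (rule sum_edges)
  also have "\<dots> = (\<Sum>e\<in>complete_edges n. 2 * w (Min e) (Max e) (c e))"
  proof (rule sum.cong[OF refl])
    fix e assume "e \<in> complete_edges n"
    then have "{Min e, Max e} = e" "{Max e, Min e} = e" using edge_Min_Max(4)
      by (auto simp: insert_commute)
    then show "w (Min e) (Max e) (c {Min e, Max e}) + w (Max e) (Min e) (c {Max e, Min e}) =
        2 * w (Min e) (Max e) (c e)"
      using wsym[of "Max e"] by simp
  qed
  finally show ?thesis by (simp add: w_def sum_distrib_left[symmetric])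
qed

text \<open>Transporting the pairing with \<open>W\<close> along \<open>\<phi>\<close> turns the
  difference into a pairing of \<open>U - pullback \<phi> W\<close> with a single step function,
  that is into \<open>(q + 1)^2\<close> rectangle integrals per colour, each bounded by the cut norm
  and weighted by at most \<open>G\<close>.\<close>

lemma pairing_stability:
  assumes U: "U \<in> prob_graphons k" and W: "W \<in> prob_graphons k" and \<phi>: "\<phi> \<in> mp_bijections"
    and d: "vec_cut_norm k (\<lambda>a p. U a p - pullback \<phi> W a p) \<le> r" and G: "\<And>a i j. \<bar>g a i j\<bar> \<le> G"
  shows "(\<Sum>a=1..k. LINT p|unit_square. W a p * step (block q) (g a) p) - (real q + 1)\<^sup>2 * G * r \<le>
    (\<Sum>a=1..k. LINT p|unit_square. U a p * step (\<lambda>x. block q (\<phi> x)) (g a) p)"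
proof -
  let ?b = "\<lambda>x. block q (\<phi> x)"
  have b: "labelling q ?b" by (rule labelling_mp[OF labelling_block \<phi>])
  have G0: "G \<ge> 0" using G[of 0 0 0] by linarith
  have one: "(LINT p|unit_square. W a p * step (block q) (g a) p) -
      (LINT p|unit_square. U a p * step ?b (g a) p)
     \<le> (real q + 1)\<^sup>2 * G * cut_norm (\<lambda>p. U a p - pullback \<phi> W a p)" if a: "a \<in> {1..k}" for a
  proof -
    note Ub = prob_graphons_bdd[OF U a] and Wb = prob_graphons_bdd[OF W a]
        and Pb = pullback_bdd[OF W a \<phi>]
    let ?D = "\<lambda>p. U a p - pullback \<phi> W a p"
    have Db: "bdd_fun ?D" by (rule bdd_fun_diff[OF Ub Pb])
    have "(LINT p|unit_square. W a p * step (block q) (g a) p) =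
        (LINT p|unit_square. pullback \<phi> W a p * step ?b (g a) p)"
      unfolding integral_mp[OF bdd_fun_mult[OF Wb bdd_fun_step_block] \<phi>, symmetric]
      by (intro Bochner_Integration.integral_cong refl) (auto simp: pullback_def step_def)
    moreover have "(LINT p|unit_square. U a p * step ?b (g a) p) -
        (LINT p|unit_square. pullback \<phi> W a p * step ?b (g a) p)
      = (LINT p|unit_square. ?D p * step ?b (g a) p)"
      unfolding left_diff_distrib
      by (rule Bochner_Integration.integral_diff[symmetric])
          (intro bdd_fun_integrable bdd_fun_mult Ub Pb bdd_fun_step[OF b])+
    moreover have "\<bar>LINT p|unit_square. ?D p * step ?b (g a) p\<bar> \<le> (real q + 1)\<^sup>2 * G * cut_norm ?D"
    proof -
      have "\<bar>LINT p|unit_square. ?D p * step ?b (g a) p\<bar> \<le>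
          (\<Sum>i\<le>q. \<Sum>j\<le>q. \<bar>g a i j * (LINT p:cell ?b i \<times> cell ?b j|unit_square. ?D p)\<bar>)"
        unfolding integral_mult_step[OF Db b]
        by (rule order_trans[OF sum_abs]) (intro sum_mono sum_abs)
      also have "\<dots> \<le> (\<Sum>i\<le>q. \<Sum>j\<le>q. G * cut_norm ?D)"
        unfolding abs_mult using G0
        by (intro sum_mono mult_mono G cut_norm_upper[OF Db] cell_sets[OF b]) auto
      also have "\<dots> = (real q + 1)\<^sup>2 * G * cut_norm ?D" by (simp add: power2_eq_square add.commute)
      finally show ?thesis .
    qed
    ultimately show ?thesis by linarith
  qed
  have "(\<Sum>a=1..k. LINT p|unit_square. W a p * step (block q) (g a) p) -
      (\<Sum>a=1..k. LINT p|unit_square. U a p * step ?b (g a) p)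
     \<le> (\<Sum>a=1..k. (real q + 1)\<^sup>2 * G * cut_norm (\<lambda>p. U a p - pullback \<phi> W a p))"
    unfolding sum_subtractf[symmetric] by (intro sum_mono one)
  also have "\<dots> = (real q + 1)\<^sup>2 * G * vec_cut_norm k (\<lambda>a p. U a p - pullback \<phi> W a p)"
    by (simp add: vec_cut_norm_def sum_distrib_left)
  also have "\<dots> \<le> (real q + 1)\<^sup>2 * G * r" using d G0 by (intro mult_left_mono) auto
  finally show ?thesis by linarith
qed

text \<open>Budget: duality and misalignment cost \<open>\<epsilon> / 2\<close> each in the pairing,
  together \<open>\<epsilon> / 2\<close> after passing from the square to the edges; the rounding
  and the number of rounded overlap matrices cost \<open>\<epsilon> / 4\<close> each.\<close>

theorem ball_count_le:
  assumes k: "k \<ge> 1" and W: "W \<in> prob_graphons k" and eps: "\<epsilon> > 0"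
  shows "\<exists>r>0. \<forall>\<^sub>F n in sequentially.
    real (card {c \<in> colorings n k. cut_dist k W (empirical_graphon n k c) < r}) \<le> exp
        ((real n)\<^sup>2 * (\<epsilon> - graphon_entropy k W / 2))"
proof -
  let ?I = "graphon_entropy k W"
  have "\<epsilon> / 2 > 0" using eps by simp
  from entropy_dual_steps[OF k W this] obtain q g G where q: "q \<ge> 1"
    and g1: "\<forall>i j. (\<Sum>a=1..k. exp (g a i j)) \<le> 1"
        and g2: "\<forall>a i j. \<bar>g a i j\<bar> \<le> G \<and> g a i j \<le> 0 \<and> g a i j = g a j i"
    and dual: "?I - \<epsilon> / 2 \<le> (\<Sum>a=1..k. LINT p|unit_square. W a p * step (block q) (g a) p)"
    by (elim exE conjE)
  have gG: "\<bar>g a i j\<bar> \<le> G" and g0: "g a i j \<le> 0" and gs: "g a i j = g a j i" for a i j using g2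
    by blast+
  define K where "K = (real q + 1)\<^sup>2 * G + 1"
  have G0: "G \<ge> 0" using gG[of 0 0 0] by linarith
  have K: "K > 0" "(real q + 1)\<^sup>2 * G \<le> K" using G0 by (auto simp: K_def add_nonneg_pos)
  \<comment> \<open>The radius comes after the step function, whose size \<open>K\<close> it has to
    beat: misalignment then costs at most \<open>K * r = \<epsilon> / 2\<close>.\<close>
  define r where "r = \<epsilon> / (2 * K)"
  have r: "r > 0" "K * r = \<epsilon> / 2" using eps K by (auto simp: r_def)
  obtain L where "4 * K / \<epsilon> \<le> real L" using real_arch_simple by blast
  then have L': "4 * K / \<epsilon> \<le> real (max L 1)" by simp
  define L1 where "L1 = max L 1"
  have L1: "L1 \<ge> 1" by (simp add: L1_def)
  have "4 * K / \<epsilon> \<le> real L1" using L' by (simp only: L1_def)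
  then have KL: "K / real L1 \<le> \<epsilon> / 4" using eps L1 by (simp add: field_simps)
  \<comment> \<open>Half of \<open>n^2\<close>, because \<open>empirical_pairing\<close> carries a
    factor 2 in front of the sum over edges.\<close>
  define t where "t n = (real n)\<^sup>2 / 2 * (?I - \<epsilon>)" for n
  \<comment> \<open>From this \<open>N\<close> on, the bound on the number of rounded matrices is
    below \<open>exp (n^2 * \<epsilon> / 4)\<close>.\<close>
  obtain N where N: "4 * (real q + 1) * ln (real L1 + 1) / \<epsilon> \<le> real N" using real_arch_simple
    by blast
  have "real (card {c \<in> colorings n k. cut_dist k W (empirical_graphon n k c) < r}) \<le>
      exp ((real n)\<^sup>2 * (\<epsilon> - ?I / 2))"
    if nN: "n \<ge> max N 1" for n
  proof -
    have n: "n \<ge> 1" "n \<ge> N" using nN by auto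
    \<comment> \<open>All overlap matrices that bijections can produce; the aligning bijection of a
      colouring enters only through one of them.\<close>
    define \<Phi> where "\<Phi> = (\<lambda>\<phi>. overlap n (\<lambda>x. block q (\<phi> x))) ` mp_bijections"
    have lab: "labelling q (\<lambda>x. block q (\<phi> x))" if "\<phi> \<in> mp_bijections" for \<phi>
      by (rule labelling_mp[OF labelling_block that])
    let ?B = "{c \<in> colorings n k. \<exists>m\<in>\<Phi>. t n \<le>
        (\<Sum>e\<in>complete_edges n. \<Sum>i\<le>q. \<Sum>j\<le>q. m i (Min e) * m j (Max e) * g (c e) i j)}"
    have sub: "{c \<in> colorings n k. cut_dist k W (empirical_graphon n k c) < r} \<subseteq> ?B"
    proof
      fix c assume "c \<in> {c \<in> colorings n k. cut_dist k W (empirical_graphon n k c) < r}"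
      then have c: "c \<in> colorings n k" and d: "cut_dist k W (empirical_graphon n k c) < r" by auto
      have E: "empirical_graphon n k c \<in> prob_graphons k" by (rule empirical_graphon_in[OF k c])
      have "cut_dist k (empirical_graphon n k c) W < r" using d cut_dist_commute[OF E W] by simp
      then obtain \<phi> where \<phi>: "\<phi> \<in> mp_bijections"
          and dd: "vec_cut_norm k (\<lambda>a p. empirical_graphon n k c a p - pullback \<phi> W a p) < r"
        by (rule cut_dist_lessE)
      let ?b = "\<lambda>x. block q (\<phi> x)"
      let ?S = "\<Sum>e\<in>complete_edges n. \<Sum>i\<le>q. \<Sum>j\<le>q.
          overlap n ?b i (Min e) * overlap n ?b j (Max e) * g (c e) i j"
      have st: "(\<Sum>a=1..k. LINT p|unit_square. W a p * step (block q) (g a) p) -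
          (real q + 1)\<^sup>2 * G * r \<le>
          (\<Sum>a=1..k. LINT p|unit_square. empirical_graphon n k c a p * step ?b (g a) p)"
        by (rule pairing_stability[OF E W \<phi> less_imp_le[OF dd] gG])
      have "(real q + 1)\<^sup>2 * G * r \<le> K * r" using K r by (intro mult_right_mono) auto
      then have "?I - \<epsilon> \<le> (\<Sum>a=1..k. LINT p|unit_square.
          empirical_graphon n k c a p * step ?b (g a) p)"
        using st dual r(2) by linarith
      then have "(real n)\<^sup>2 * (?I - \<epsilon>) \<le> (real n)\<^sup>2 * (\<Sum>a=1..k. LINT p|unit_square.
          empirical_graphon n k c a p * step ?b (g a) p)"
        by (intro mult_left_mono) auto
      also have "\<dots> \<le> 2 * ?S" by (rule empirical_pairing[OF k n(1) c lab[OF \<phi>] g0 gs])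
      finally have "t n \<le> ?S" by (simp add: t_def)
      then show "c \<in> ?B" using c \<phi> by (auto simp: \<Phi>_def)
    qed
    have "real (card {c \<in> colorings n k. cut_dist k W (empirical_graphon n k c) < r}) \<le>
        real (card ?B)"
      using sub by (intro of_nat_mono card_mono) auto
    also have "\<dots> \<le> (real L1 + 1) ^ ((q + 1) * n) * exp ((real n)\<^sup>2 * (real q + 1)\<^sup>2 * G / real L1 -
        t n)"
      by (rule card_colorings_le[OF _ gG L1])
        (use g1 in \<open>auto simp: \<Phi>_def overlap_nonneg intro!: overlap_sum lab simp del:
            atLeastAtMost_iff\<close>)
    also have "(real L1 + 1) ^ ((q + 1) * n) = exp (real ((q + 1) * n) * ln (real L1 + 1))"
      unfolding exp_of_nat_mult using L1 by (subst exp_ln) auto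
    also have "\<dots> * exp ((real n)\<^sup>2 * (real q + 1)\<^sup>2 * G / real L1 - t n) =
      exp (real ((q + 1) * n) * ln (real L1 + 1) + ((real n)\<^sup>2 * (real q + 1)\<^sup>2 * G / real L1 - t
          n))"
      by (simp only: exp_add)
    also have "\<dots> \<le> exp ((real n)\<^sup>2 * (\<epsilon> - ?I / 2))"
    proof (intro exp_le_cancel_iff[THEN iffD2])
      have "4 * (real q + 1) * ln (real L1 + 1) / \<epsilon> \<le> real n" using N n(2) by linarith
      then have "(real q + 1) * ln (real L1 + 1) \<le> real n * (\<epsilon> / 4)" using eps
        by (simp add: field_simps)
      then have "real n * ((real q + 1) * ln (real L1 + 1)) \<le> real n * (real n * (\<epsilon> / 4))"
        by (intro mult_left_mono) auto
      then have 1: "real ((q + 1) * n) * ln (real L1 + 1) \<le> (real n)\<^sup>2 * (\<epsilon> / 4)"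
        by (simp add: power2_eq_square algebra_simps)
      have "(real q + 1)\<^sup>2 * G / real L1 \<le> K / real L1" using K by (intro divide_right_mono) auto
      then have "(real q + 1)\<^sup>2 * G / real L1 \<le> \<epsilon> / 4" using KL by linarith
      then have "(real n)\<^sup>2 * ((real q + 1)\<^sup>2 * G / real L1) \<le> (real n)\<^sup>2 * (\<epsilon> / 4)"
        by (rule mult_left_mono) simp
      then have 2: "(real n)\<^sup>2 * (real q + 1)\<^sup>2 * G / real L1 \<le> (real n)\<^sup>2 * (\<epsilon> / 4)"
        by (simp only: times_divide_eq_right mult.assoc)
      have 3: "(real n)\<^sup>2 * (\<epsilon> / 4) + (real n)\<^sup>2 * (\<epsilon> / 4) - t n = (real n)\<^sup>2 * (\<epsilon> - ?I / 2)"
        by (simp add: t_def field_simps)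
      show "real ((q + 1) * n) * ln (real L1 + 1) + ((real n)\<^sup>2 * (real q + 1)\<^sup>2 * G / real L1 -
          t n) \<le> (real n)\<^sup>2 * (\<epsilon> - ?I / 2)"
        using 1 2 3 by linarith
    qed
    finally show ?thesis .
  qed
  then show ?thesis using r(1) by (intro exI[of _ r] conjI eventually_sequentiallyI[of
      "max N 1"]) auto
qed

section \<open>Lower bound for the partition function\<close>

text \<open>The lower bound is the tangent at \<open>y\<close> of the convex function
  \<open>w * ln w\<close>.\<close>

lemma xlnx_tangent: "w * ln w \<ge> w * ln y + w - y" if "w \<ge> 0" "y > 0" for w y :: real
proof (cases "w = 0")
  case False
  then have w: "w > 0" using that by simp
  have "ln (y / w) \<le> y / w - 1" using w that by (intro ln_le_minus_one) auto
  then have "w * (ln y - ln w) \<le> w * (y / w - 1)" using w that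
    by (intro mult_left_mono) (auto simp: ln_div)
  then show ?thesis using w by (simp add: algebra_simps)
qed (use that in simp)

text \<open>Jensen's inequality on a block: average the tangent at \<open>y\<close>, then let
  \<open>y\<close> be the block mean.\<close>

lemma avg_xlnx_ge:
  assumes n: "n \<ge> 1" and W: "W \<in> prob_graphons k" and a: "a \<in> {1..k}"
      and uv: "u \<in> {1..n}" "v \<in> {1..n}"
  shows "avg n (W a) u v * ln (avg n (W a) u v) \<le> avg n (\<lambda>p. W a p * ln (W a p)) u v"
proof -
  note Wb = prob_graphons_bdd[OF W a] and Eb = bdd_fun_entropy[OF W a]
  let ?q = "avg n (W a) u v"
  have q: "?q \<ge> 0" using graphon_avg_01[OF n W a, of u v] by simp
  have tan: "?q * ln y + ?q - y \<le> avg n (\<lambda>p. W a p * ln (W a p)) u v" if y: "y > 0" for y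
  proof -
    have "avg n (\<lambda>p. (ln y + 1) * W a p - y) u v \<le> avg n (\<lambda>p. W a p * ln (W a p)) u v"
    proof (rule avg_mono)
      fix p assume "p \<in> space unit_square"
      then have "W a p \<ge> 0" using graphon_01[OF W a] by (auto simp: space_unit_square)
      then show "(ln y + 1) * W a p - y \<le> W a p * ln (W a p)"
        using xlnx_tangent[OF _ y, of "W a p"] by (simp add: algebra_simps)
    qed (intro bdd_fun_diff bdd_fun_cmult Wb bdd_fun_const Eb)+
    moreover have "avg n (\<lambda>p. (ln y + 1) * W a p - y) u v = (ln y + 1) * ?q - y"
      using avg_const[OF n, of y u v] uv
      by (simp add: avg_diff[OF bdd_fun_cmult[OF Wb] bdd_fun_const] avg_cmult)
    ultimately show ?thesis by (simp add: algebra_simps)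
  qed
  show ?thesis
  proof (cases "?q = 0")
    case True
    \<comment> \<open>At mean 0 there is no tangent; small positive \<open>y\<close> give the bound
      in the limit.\<close>
    have "0 \<le> avg n (\<lambda>p. W a p * ln (W a p)) u v + y" if "y > 0" for y using tan[OF that] True
      by simp
    then have "0 \<le> avg n (\<lambda>p. W a p * ln (W a p)) u v" by (rule field_le_epsilon)
    then show ?thesis unfolding True by simp
  next
    case False
    then show ?thesis using tan[of ?q] q by simp
  qed
qed

lemma sum_avg:
  assumes n: "n \<ge> 1" and f: "bdd_fun f"
  shows "(\<Sum>u\<in>{1..n}. \<Sum>v\<in>{1..n}. avg n f u v) = (real n)\<^sup>2 * (LINT p|unit_square. f p)"
proof -
  \<comment> \<open>Constants average to 0 over the null blocks of index 0, so bounds above and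
    below by constants squeeze the average of \<open>f\<close>.\<close>
  have z: "avg n f u v = 0" if "u = 0 \<or> v = 0" for u v
  proof -
    obtain B where B: "B \<ge> 0" "\<And>x y. x \<in> {0..1} \<Longrightarrow> y \<in> {0..1} \<Longrightarrow> \<bar>f (x, y)\<bar> \<le> B" using bdd_funE[OF f]
      by blast
    have "f p \<le> B \<and> - B \<le> f p" if "p \<in> space unit_square" for p
      using that B(2)
      by (auto simp: space_unit_square abs_le_iff) (metis abs_le_D2 atLeastAtMost_iff minus_le_iff)
    then have "avg n (\<lambda>_. - B) u v \<le> avg n f u v" "avg n f u v \<le> avg n (\<lambda>_. B) u v"
      by (intro avg_mono f bdd_fun_const; blast)+
    then show ?thesis using that avg_const[OF n, of B u v] avg_const[OF n, of "- B" u v] by auto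
  qed
  have "(real n)\<^sup>2 * (LINT p|unit_square. f p) = (\<Sum>u\<le>n. \<Sum>v\<le>n. avg n f u v)"
    unfolding integral_cells[OF f labelling_block[of n], symmetric] avg_def sum_distrib_left
    by (rule refl)
  then show ?thesis by (simp add: sum_atMost_split z)
qed

definition graphon_law :: "nat \<Rightarrow> graphon \<Rightarrow> nat set \<Rightarrow> nat \<Rightarrow> real" where
  "graphon_law n W e a = avg n (W a) (Min e) (Max e)"

lemma edge_law_graphon:
  assumes n: "n \<ge> 1" and W: "W \<in> prob_graphons k"
  shows "edge_law n k (graphon_law n W)"
proof
  fix e assume e: "e \<in> complete_edges n"
  show "(\<Sum>a=1..k. graphon_law n W e a) = 1"
    unfolding graphon_law_def graphon_avg_sum[OF n W] using edge_Min_Max[OF e] by simp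
  fix a assume a: "a \<in> {1..k}"
  show "0 \<le> graphon_law n W e a" using graphon_avg_01[OF n W a] by (simp add: graphon_law_def)
qed

text \<open>Jensen's inequality on each off-diagonal block, read once per orientation of an edge.
  Restoring the \<open>n\<close> missing diagonal blocks costs at most \<open>k\<close> each, as
  \<open>x * ln x\<close> is at least \<open>-1\<close> on the unit interval.\<close>

lemma law_entropy_le:
  assumes n: "n \<ge> 1" and W: "W \<in> prob_graphons k"
  shows "2 * (\<Sum>e\<in>complete_edges n. \<Sum>a=1..k. graphon_law n W e a * ln (graphon_law n W e a)) \<le>
    (real n)\<^sup>2 * graphon_entropy k W + real n * real k"
proof -
  define F where "F u v = (\<Sum>a=1..k. avg n (\<lambda>p. W a p * ln (W a p)) u v)" for u v
  have diag: "F u u \<ge> - real k" if u: "u \<in> {1..n}" for u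
  proof -
    have "-1 \<le> avg n (\<lambda>p. W a p * ln (W a p)) u u" if a: "a \<in> {1..k}" for a
    proof -
      have "avg n (\<lambda>_. -1) u u \<le> avg n (\<lambda>p. W a p * ln (W a p)) u u"
      proof (rule avg_mono[OF bdd_fun_const bdd_fun_entropy[OF W a]])
        fix p assume "p \<in> space unit_square"
        then obtain x y where "p = (x, y)" "x \<in> {0..1}" "y \<in> {0..1}"
          by (auto simp: space_unit_square)
        then show "- 1 \<le> W a p * ln (W a p)" using xlnx_bound[OF graphon_01[OF W a], of x y]
          by (simp add: abs_le_iff)
      qed
      then show ?thesis using avg_const[OF n, of "-1" u u] u by simp
    qed
    then have "(\<Sum>a=1..k. -1) \<le> F u u" unfolding F_def by (intro sum_mono)
    then show ?thesis by simp
  qed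
  have "2 * (\<Sum>e\<in>complete_edges n. \<Sum>a=1..k. graphon_law n W e a * ln (graphon_law n W e a)) =
    (\<Sum>e\<in>complete_edges n. (\<Sum>a=1..k. graphon_law n W e a * ln (graphon_law n W e a)) + (\<Sum>a=1..k.
        graphon_law n W e a * ln (graphon_law n W e a)))"
    by (simp only: sum.distrib mult_2)
  also have "\<dots> \<le> (\<Sum>e\<in>complete_edges n. F (Min e) (Max e) + F (Max e) (Min e))"
  proof (intro sum_mono add_mono)
    fix e assume e: "e \<in> complete_edges n"
    note E = edge_Min_Max[OF e]
    show "(\<Sum>a=1..k. graphon_law n W e a * ln (graphon_law n W e a)) \<le> F (Min e) (Max e)"
      unfolding F_def graphon_law_def by (intro sum_mono avg_xlnx_ge[OF n W] E)
    have "(\<Sum>a=1..k. graphon_law n W e a * ln (graphon_law n W e a)) =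
        (\<Sum>a=1..k. avg n (W a) (Max e) (Min e) * ln (avg n (W a) (Max e) (Min e)))"
      unfolding graphon_law_def
    proof (rule sum.cong[OF refl])
      fix a assume a: "a \<in> {1..k}"
      show "avg n (W a) (Min e) (Max e) * ln (avg n (W a) (Min e) (Max e)) =
          avg n (W a) (Max e) (Min e) * ln (avg n (W a) (Max e) (Min e))"
        by (simp only: graphon_avg_sym[OF W a, of n "Min e" "Max e"])
    qed
    also have "\<dots> \<le> F (Max e) (Min e)" unfolding F_def by (intro sum_mono avg_xlnx_ge[OF n W] E)
    finally show "(\<Sum>a=1..k. graphon_law n W e a * ln (graphon_law n W e a)) \<le> F (Max e) (Min e)" .
  qed
  also have "\<dots> = (\<Sum>u\<in>{1..n}. \<Sum>v\<in>{1..n}. if u \<noteq> v then F u v else 0)" by (rule sum_edges[symmetric])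
  also have "\<dots> = (\<Sum>u\<in>{1..n}. (\<Sum>v\<in>{1..n}. F u v) - F u u)"
  proof (rule sum.cong[OF refl])
    fix u assume u: "u \<in> {1..n}"
    have "(\<Sum>v\<in>{1..n}. if u \<noteq> v then F u v else 0) =
        (\<Sum>v\<in>{1..n}. F u v - (if v = u then F u v else 0))"
      by (intro sum.cong) auto
    also have "\<dots> = (\<Sum>v\<in>{1..n}. F u v) - F u u" using u by (simp add: sum_subtractf)
    finally show "(\<Sum>v\<in>{1..n}. if u \<noteq> v then F u v else 0) = (\<Sum>v\<in>{1..n}. F u v) - F u u" .
  qed
  also have "\<dots> \<le> (\<Sum>u\<in>{1..n}. (\<Sum>v\<in>{1..n}. F u v) + real k)" using diag by (intro sum_mono) fastforce
  also have "\<dots> = (\<Sum>u\<in>{1..n}. \<Sum>v\<in>{1..n}. F u v) + real n * real k" by (simp add: sum.distrib)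
  also have "(\<Sum>u\<in>{1..n}. \<Sum>v\<in>{1..n}. F u v) = (\<Sum>a=1..k. \<Sum>u\<in>{1..n}. \<Sum>v\<in>{1..n}.
      avg n (\<lambda>p. W a p * ln (W a p)) u v)"
    unfolding F_def by (rule sum_rotate3[symmetric])
  also have "\<dots> = (\<Sum>a=1..k. (real n)\<^sup>2 * (LINT p|unit_square. W a p * ln (W a p)))"
    by (intro sum.cong refl sum_avg n bdd_fun_entropy[OF W])
  also have "\<dots> = (real n)\<^sup>2 * graphon_entropy k W"
    by (simp add: graphon_entropy_def sum_distrib_left)
  finally show ?thesis .
qed

text \<open>For vertex sets \<open>S\<close> and \<open>T\<close>, this is the empirical matrix
  minus the block means, summed over the off-diagonal entries of \<open>S \<times> T\<close>. In
  edge form an edge counts once for each orientation that lies in \<open>S \<times> T\<close>, so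
  its weight is 0, 1 or 2.\<close>

definition discrepancy :: "nat \<Rightarrow> graphon \<Rightarrow> (nat set \<Rightarrow> nat) \<Rightarrow> nat \<Rightarrow> nat set \<Rightarrow> nat set \<Rightarrow> real" where
  "discrepancy n W c a S T = (\<Sum>e\<in>complete_edges n.
     (of_bool (Min e \<in> S \<and> Max e \<in> T) + of_bool (Max e \<in> S \<and> Min e \<in> T)) *
         (of_bool (c e = a) - graphon_law n W e a))"

text \<open>The identity already aligns the two graphons well enough. The distance splits into the
  averaging error of \<open>W\<close> and the matrix cut norm of the difference from the block
  means. Off the diagonal the latter is \<open>discrepancy\<close>; the diagonal adds at most
  \<open>n\<close>, which is \<open>1/n\<close> relative to \<open>n^2\<close>.\<close>

lemma empirical_close:
  assumes k: "k \<ge> 1" and n: "n \<ge> 1" and W: "W \<in> prob_graphons k" and c: "c \<in> colorings n k"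
    and \<rho>: "\<And>a S T. a \<in> {1..k} \<Longrightarrow> S \<subseteq> {1..n} \<Longrightarrow> T \<subseteq> {1..n} \<Longrightarrow>
        \<bar>discrepancy n W c a S T\<bar> \<le> \<rho> * (real n)\<^sup>2"
  shows "cut_dist k W (empirical_graphon n k c) \<le>
      (\<Sum>a=1..k. avg_err n (W a)) + real k * (\<rho> + 1 / real n)"
proof -
  have E: "empirical_graphon n k c \<in> prob_graphons k" by (rule empirical_graphon_in[OF k c])
  have one: "cut_norm (\<lambda>p. W a p - empirical_graphon n k c a p) \<le>
      avg_err n (W a) + (\<rho> + 1 / real n)" if a: "a \<in> {1..k}" for a
  proof -
    let ?A = "avg n (W a)"
    note Wb = prob_graphons_bdd[OF W a] and Eb = prob_graphons_bdd[OF E a]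
    have "cut_norm (\<lambda>p. W a p - step (block n) ?A p) \<le>
        (LINT p|unit_square. \<bar>W a p - step (block n) ?A p\<bar>)"
      by (intro cut_norm_le_L1 bdd_fun_diff Wb bdd_fun_step_block)
    then have 1: "cut_norm (\<lambda>p. W a p - step (block n) ?A p) \<le> avg_err n (W a)"
      by (simp add: avg_err_def abs_minus_commute)
    have "cut_norm (step (block n) (\<lambda>u v. ?A u v - empirical_matrix n k c a u v)) \<le> \<rho> + 1 / real n"
    proof (rule cut_norm_step_le[OF n])
      fix S T assume ST: "S \<subseteq> {1..n}" "T \<subseteq> {1..n}"
      define D where "D u v = ?A u v - empirical_matrix n k c a u v" for u v
      have D1: "\<bar>D u v\<bar> \<le> 1" for u v
      proof -
        have "0 \<le> 1 / real k" "1 / real k \<le> 1" using k by auto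
        then have "0 \<le> empirical_matrix n k c a u v" "empirical_matrix n k c a u v \<le> 1"
          by (simp_all add: empirical_matrix_def)
        moreover have "0 \<le> ?A u v" "?A u v \<le> 1" using graphon_avg_01[OF n W a, of u v] by simp_all
        ultimately show ?thesis unfolding D_def by linarith
      qed
      have fin: "finite S" "finite T" using ST finite_subset by blast+
      have "(\<Sum>u\<in>S. \<Sum>v\<in>T. D u v) = (\<Sum>u\<in>S. \<Sum>v\<in>T. if u \<noteq> v then D u v else 0) + (\<Sum>u\<in>S. \<Sum>v\<in>T. if v =
          u then D u v else 0)"
        unfolding sum.distrib[symmetric] by (intro sum.cong refl) auto
      also have "(\<Sum>u\<in>S. \<Sum>v\<in>T. if u \<noteq> v then D u v else 0) = - discrepancy n W c a S T"
      proof -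
        define F where "F u v = of_bool (u \<in> S \<and> v \<in> T) * D u v" for u v
        have "(\<Sum>u\<in>S. \<Sum>v\<in>T. if u \<noteq> v then D u v else 0) = (\<Sum>u\<in>{1..n} \<inter> S. \<Sum>v\<in>{1..n} \<inter> T. if u \<noteq>
            v then D u v else 0)"
          using ST by (simp only: Int_absorb1)
        also have "\<dots> = (\<Sum>u\<in>{1..n}. \<Sum>v\<in>{1..n}. if u \<noteq> v then F u v else 0)"
          by (simp only: sum.inter_restrict finite_atLeastAtMost)
            (intro sum.cong refl, auto simp: F_def intro!: sum.cong sum.neutral)
        also have "\<dots> = (\<Sum>e\<in>complete_edges n. F (Min e) (Max e) + F (Max e) (Min e))"
          by (rule sum_edges)
        also have "\<dots> = (\<Sum>e\<in>complete_edges n. - ((of_bool (Min e \<in> S \<and>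
            Max e \<in> T) + of_bool (Max e \<in> S \<and> Min e \<in> T)) * (of_bool (c e = a) - graphon_law n W e
            a)))"
        proof (rule sum.cong[OF refl])
          fix e assume e: "e \<in> complete_edges n"
          note M = edge_Min_Max[OF e]
          have "{Max e, Min e} = e" using M(4) by (simp add: insert_commute)
          then have "D (Min e) (Max e) = graphon_law n W e a - of_bool (c e =
              a)" "D (Max e) (Min e) = graphon_law n W e a - of_bool (c e = a)"
            using M graphon_avg_sym[OF W a, of n "Max e" "Min e"]
            unfolding D_def empirical_matrix_def graphon_law_def by auto
          then show "F (Min e) (Max e) + F (Max e) (Min e) =
              - ((of_bool (Min e \<in> S \<and> Max e \<in> T) + of_bool (Max e \<in> S \<and> Min e \<in> T)) * (of_bool (c
              e = a) - graphon_law n W e a))"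
            by (simp add: F_def algebra_simps)
        qed
        also have "\<dots> = - discrepancy n W c a S T" by (simp add: discrepancy_def sum_negf)
        finally show ?thesis .
      qed
      finally have "\<bar>\<Sum>u\<in>S. \<Sum>v\<in>T. D u v\<bar> \<le> \<bar>discrepancy n W c a S T\<bar> + \<bar>\<Sum>u\<in>S. \<Sum>v\<in>T. if v =
          u then D u v else 0\<bar>" by linarith
      also have "\<bar>\<Sum>u\<in>S. \<Sum>v\<in>T. if v = u then D u v else 0\<bar> \<le>
          (\<Sum>u\<in>S. \<bar>\<Sum>v\<in>T. if v = u then D u v else 0\<bar>)" by (rule sum_abs)
      \<comment> \<open>Each row contains at most one diagonal entry, of absolute value at most
        1.\<close>
      also have "\<dots> \<le> (\<Sum>u\<in>S. 1)" using fin D1 by (intro sum_mono) simp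
      also have "\<dots> \<le> real n" using card_mono[OF _ ST(1)] by simp
      also have "real n = 1 / real n * (real n)\<^sup>2" using n by (simp add: power2_eq_square)
      finally have "\<bar>\<Sum>u\<in>S. \<Sum>v\<in>T. D u v\<bar> \<le> \<rho> * (real n)\<^sup>2 + 1 / real n * (real n)\<^sup>2"
        using \<rho>[OF a ST] by linarith
      then show "\<bar>\<Sum>u\<in>S. \<Sum>v\<in>T. ?A u v - empirical_matrix n k c a u v\<bar> \<le>
          (\<rho> + 1 / real n) * (real n)\<^sup>2"
        unfolding D_def by (simp only: distrib_right)
    qed
    moreover have "cut_norm (step (block n) (\<lambda>u v. ?A u v - empirical_matrix n k c a u v)) =
        cut_norm (\<lambda>p. step (block n) ?A p - empirical_graphon n k c a p)"
      unfolding empirical_graphon_step by (intro cut_norm_cong) (auto simp: step_def)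
    ultimately show ?thesis using cut_norm_triangle[OF Wb bdd_fun_step_block Eb, of n ?A] 1
      by linarith
  qed
  have "cut_dist k W (empirical_graphon n k c) \<le>
      (\<Sum>a=1..k. cut_norm (\<lambda>p. W a p - empirical_graphon n k c a p))"
    using cut_dist_le_norm[OF W E] by (simp add: vec_cut_norm_def)
  also have "\<dots> \<le> (\<Sum>a=1..k. avg_err n (W a) + (\<rho> + 1 / real n))" by (intro sum_mono one)
  also have "\<dots> = (\<Sum>a=1..k. avg_err n (W a)) + real k * (\<rho> + 1 / real n)" by (simp add: sum.distrib)
  finally show ?thesis .
qed

lemma sum_UN_le:
  fixes f :: "'b \<Rightarrow> real"
  assumes "finite I" "\<And>i. i \<in> I \<Longrightarrow> finite (B i)" "\<And>i x. i \<in> I \<Longrightarrow> x \<in> B i \<Longrightarrow> f x \<ge> 0"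
  shows "(\<Sum>x\<in>(\<Union>i\<in>I. B i). f x) \<le> (\<Sum>i\<in>I. \<Sum>x\<in>B i. f x)"
  using assms
proof (induction I rule: finite_induct)
  case (insert j I)
  have fin: "finite (B j)" "finite (\<Union>i\<in>I. B i)" using insert by auto
  have "(\<Sum>x\<in>B j \<union> (\<Union>i\<in>I. B i). f x) + (\<Sum>x\<in>B j \<inter> (\<Union>i\<in>I. B i). f x) =
      (\<Sum>x\<in>B j. f x) + (\<Sum>x\<in>(\<Union>i\<in>I. B i). f x)"
    by (rule sum.union_inter[OF fin])
  moreover have "(\<Sum>x\<in>B j \<inter> (\<Union>i\<in>I. B i). f x) \<ge> 0" using insert.prems(2) by (intro sum_nonneg) auto
  moreover have "(\<Sum>x\<in>(\<Union>i\<in>I. B i). f x) \<le> (\<Sum>i\<in>I. \<Sum>x\<in>B i. f x)" using insert by auto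
  ultimately show ?case using insert.hyps by simp
qed simp

text \<open>Union bound over \<open>k\<close> colours, \<open>2 ^ n\<close> choices for each vertex
  set and two signs. Every single event is a Chernoff deviation with edge weights at most 2 in
  absolute value.\<close>

lemma discrepancy_prob:
  assumes n: "n \<ge> 1" and W: "W \<in> prob_graphons k" and \<rho>: "0 < \<rho>" "\<rho> \<le> 2"
  shows "(\<Sum>c\<in>{c\<in>colorings n k. \<exists>a\<in>{1..k}. \<exists>S\<subseteq>{1..n}. \<exists>T\<subseteq>{1..n}. \<rho> * (real n)\<^sup>2 <
      \<bar>discrepancy n W c a S T\<bar>}. edge_prob n (graphon_law n W) c)
    \<le> 2 * real k * 4 ^ n * exp (- (\<rho>\<^sup>2 / 8) * (real n)\<^sup>2)"
proof -
  interpret edge_law n k "graphon_law n W" by (rule edge_law_graphon[OF n W])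
  define I where "I = {1..k} \<times> Pow {1..n} \<times> Pow {1..n} \<times> {1, -1 :: real}"
  define x where "x s S T e = s * (of_bool (Min e \<in> S \<and> Max e \<in> T) + of_bool (Max e \<in> S \<and>
      Min e \<in> T))" for s :: real and S T :: "nat set" and e :: "nat set"
  define B where "B = (\<lambda>(a, S, T, s). {c\<in>colorings n k. \<rho> * (real n)\<^sup>2 <
      (\<Sum>e\<in>E. x s S T e * (of_bool (c e = a) - graphon_law n W e a))})"
  have fI: "finite I" by (simp add: I_def)
  have eq: "(\<Sum>e\<in>E. x s S T e * (of_bool (c e = a) - graphon_law n W e a)) =
      s * discrepancy n W c a S T" for s S T c a
    by (simp add: x_def discrepancy_def sum_distrib_left mult.assoc)
  have "{c\<in>colorings n k. \<exists>a\<in>{1..k}. \<exists>S\<subseteq>{1..n}. \<exists>T\<subseteq>{1..n}. \<rho> * (real n)\<^sup>2 <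
      \<bar>discrepancy n W c a S T\<bar>} \<subseteq> (\<Union>i\<in>I. B i)"
  proof
    fix c assume "c \<in> {c\<in>colorings n k. \<exists>a\<in>{1..k}. \<exists>S\<subseteq>{1..n}. \<exists>T\<subseteq>{1..n}. \<rho> * (real n)\<^sup>2 <
        \<bar>discrepancy n W c a S T\<bar>}"
    then obtain a S T where c: "c \<in> colorings n k"
        and h: "a \<in> {1..k}" "S \<subseteq> {1..n}" "T \<subseteq> {1..n}" "\<rho> * (real n)\<^sup>2 < \<bar>discrepancy n W c a S T\<bar>"
      by (elim CollectE conjE bexE exE)
    define s :: real where "s = (if discrepancy n W c a S T \<ge> 0 then 1 else -1)"
    have "s * discrepancy n W c a S T = \<bar>discrepancy n W c a S T\<bar>" by (simp add: s_def)
    then have "c \<in> B (a, S, T, s)" using c h(4) by (simp add: B_def eq)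
    moreover have "(a, S, T, s) \<in> I" using h by (simp add: I_def s_def)
    ultimately show "c \<in> (\<Union>i\<in>I. B i)" by blast
  qed
  moreover have "finite (\<Union>i\<in>I. B i)" using fI
    by (intro finite_UN_I finite_subset[OF _ finite_colorings[of n k]]) (auto simp: B_def)
  moreover have Bc: "B i \<subseteq> colorings n k" for i by (auto simp: B_def split: prod.splits)
  ultimately have "(\<Sum>c\<in>{c\<in>colorings n k. \<exists>a\<in>{1..k}. \<exists>S\<subseteq>{1..n}. \<exists>T\<subseteq>{1..n}. \<rho> * (real n)\<^sup>2 <
      \<bar>discrepancy n W c a S T\<bar>}. Q c)
    \<le> (\<Sum>c\<in>(\<Union>i\<in>I. B i). Q c)"
    by (intro sum_mono2) (auto intro!: Q_nonneg dest: subsetD[OF Bc])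
  also have "\<dots> \<le> (\<Sum>i\<in>I. \<Sum>c\<in>B i. Q c)"
    by (rule sum_UN_le[OF fI finite_subset[OF Bc finite_colorings]])
        (rule Q_nonneg[OF subsetD[OF Bc]])
  also have "\<dots> \<le> (\<Sum>i\<in>I. exp (- (\<rho>\<^sup>2 / 8) * (real n)\<^sup>2))"
  proof (rule sum_mono)
    fix i assume "i \<in> I"
    then obtain a S T s where i: "i = (a, S, T, s)" "a \<in> {1..k}" "s \<in> {1, -1}" by (auto simp: I_def)
    have "\<bar>x s S T e\<bar> \<le> 2" for e using i(3) by (auto simp: x_def of_bool_def)
    then show "(\<Sum>c\<in>B i. Q c) \<le> exp (- (\<rho>\<^sup>2 / 8) * (real n)\<^sup>2)"
      unfolding i(1) B_def prod.case by (intro deviation_prob i(2) \<rho>)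
  qed
  also have "\<dots> = real (card I) * exp (- (\<rho>\<^sup>2 / 8) * (real n)\<^sup>2)" by simp
  also have "real (card I) = 2 * real k * 4 ^ n"
    by (simp add: I_def card_cartesian_product card_Pow power_mult_distrib[symmetric])
  finally show ?thesis .
qed

lemma eventually_exp_square_gt:
  assumes "c > 0" shows "\<forall>\<^sub>F n in sequentially. K < exp ((real n)\<^sup>2 * c)"
proof -
  obtain N where N: "K / c \<le> real N" using real_arch_simple by blast
  have "K < exp ((real n)\<^sup>2 * c)" if "n \<ge> N" for n
  proof -
    have "K \<le> real n * c" using N that assms
      by (simp add: field_simps) (meson le_trans mult_left_mono of_nat_mono order_less_imp_le
        order_trans)
    also have "real n * c \<le> (real n)\<^sup>2 * c" using assms
      by (intro mult_right_mono) (auto simp: power2_eq_square mult_le_cancel_left1)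
    also have "\<dots> < exp ((real n)\<^sup>2 * c)" using exp_ge_add_one_self[of "(real n)\<^sup>2 * c"] by linarith
    finally show ?thesis .
  qed
  then show ?thesis by (intro eventually_sequentiallyI)
qed

lemma union_bound_tendsto_0:
  assumes "c > 0" shows "(\<lambda>n. K * 4 ^ n * exp (- c * (real n)\<^sup>2)) \<longlonglongrightarrow> (0 :: real)"
proof -
  \<comment> \<open>From \<open>N\<close> on, \<open>c * n\<close> exceeds \<open>ln 4\<close> by at
    least 1, which makes the exponent at most \<open>- n\<close>.\<close>
  obtain N where N: "(ln 4 + 1) / c \<le> real N" using real_arch_simple by blast
  have le: "4 ^ n * exp (- c * (real n)\<^sup>2) \<le> 1 / real n" if n: "n \<ge> max N 1" for n
  proof -
    have "(ln 4 + 1) / c \<le> real n" using N n by linarith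
    then have "ln 4 + 1 \<le> real n * c" using assms by (simp add: field_simps)
    then have "real n * (ln 4 + 1) \<le> real n * (real n * c)" by (intro mult_left_mono) auto
    then have ex: "real n * ln 4 + - c * (real n)\<^sup>2 \<le> - real n"
      by (simp add: power2_eq_square algebra_simps)
    have "(4::real) ^ n = exp (real n * ln 4)" by (simp add: exp_of_nat_mult)
    then have "4 ^ n * exp (- c * (real n)\<^sup>2) = exp (real n * ln 4 + - c * (real n)\<^sup>2)"
      by (simp only: exp_add)
    also have "\<dots> \<le> exp (- real n)" using ex by simp
    also have "\<dots> \<le> 1 / real n"
    proof -
      have "real n \<le> exp (real n)" using exp_ge_add_one_self[of "real n"] by linarith
      then have "inverse (exp (real n)) \<le> inverse (real n)" using n
        by (intro le_imp_inverse_le) auto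
      then show ?thesis by (simp add: exp_minus inverse_eq_divide)
    qed
    finally show ?thesis .
  qed
  have "(\<lambda>n. 4 ^ n * exp (- c * (real n)\<^sup>2)) \<longlonglongrightarrow> 0"
    by (rule tendsto_sandwich[OF always_eventually eventually_sequentiallyI[of
        "max N 1"] tendsto_const lim_1_over_n])
      (use le in auto)
  from tendsto_mult_right_zero[OF this, of K] show ?thesis by (simp add: mult.assoc)
qed

text \<open>The mean of \<open>t\<close> under the product law of block means is nearly
  \<open>t W\<close>: good colourings lie in the ball given by continuity at \<open>W\<close>, and
  bad ones are so rare that boundedness of \<open>t\<close> controls their share. The variational
  bound then needs only the entropy of that law.\<close>

theorem partition_function_ge:
  fixes t :: "graphon \<Rightarrow> real"
  assumes k: "k \<ge> 1" and W: "W \<in> prob_graphons k" and B: "\<And>U. U \<in> prob_graphons k \<Longrightarrow> \<bar>t U\<bar> \<le> B"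
    and cont: "\<And>e. e > 0 \<Longrightarrow> \<exists>r>0. \<forall>U\<in>prob_graphons k. cut_dist k W U < r \<longrightarrow> \<bar>t U - t W\<bar> < e"
    and eps: "\<epsilon> > 0"
  shows "\<forall>\<^sub>F n in sequentially. exp ((real n)\<^sup>2 * (t W - graphon_entropy k W / 2 - \<epsilon>)) \<le>
    (\<Sum>c\<in>colorings n k. exp ((real n)\<^sup>2 * t (empirical_graphon n k c)))"
proof -
  let ?I = "graphon_entropy k W"
  have B0: "B \<ge> 0" using B[OF W] by linarith
  have "\<epsilon> / 4 > 0" using eps by simp
  from cont[OF this] obtain r where r: "r > 0"
      and rt: "\<forall>U\<in>prob_graphons k. cut_dist k W U < r \<longrightarrow> \<bar>t U - t W\<bar> < \<epsilon> / 4"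
    by (elim exE conjE)
  \<comment> \<open>Distance budget: averaging error, deviations and diagonal take at most
    \<open>r / 4\<close> each, together less than \<open>r\<close>. The cap 2 is the range of the
    Chernoff bound.\<close>
  define \<rho> where "\<rho> = min (r / (4 * real k)) 2"
  have \<rho>: "0 < \<rho>" "\<rho> \<le> 2" "\<rho> \<le> r / (4 * real k)" using r k by (auto simp: \<rho>_def)
  define \<beta> where "\<beta> n = 2 * real k * 4 ^ n * exp (- (\<rho>\<^sup>2 / 8) * (real n)\<^sup>2)" for n
  have \<beta>0: "\<beta> \<longlonglongrightarrow> 0" unfolding \<beta>_def by (rule union_bound_tendsto_0) (use \<rho> in simp)
  have "(\<lambda>n. \<Sum>a=1..k. avg_err n (W a)) \<longlonglongrightarrow> (\<Sum>a=1..k. 0)"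
    by (intro tendsto_sum graphon_avg_err[OF W])
  then have "(\<lambda>n. \<Sum>a=1..k. avg_err n (W a)) \<longlonglongrightarrow> 0" by simp
  then have ev1: "\<forall>\<^sub>F n in sequentially. (\<Sum>a=1..k. avg_err n (W a)) < r / 4"
    by (rule order_tendstoD(2)) (use r in simp)
  have ev2: "\<forall>\<^sub>F n in sequentially. 1 / real n < r / (4 * real k)"
    using lim_1_over_n by (rule order_tendstoD(2)) (use r k in simp)
  \<comment> \<open>Bad colourings lower the mean by at most \<open>2 * B\<close> times their
    probability, hence by at most \<open>\<epsilon> / 4\<close>.\<close>
  have ev3: "\<forall>\<^sub>F n in sequentially. \<beta> n < \<epsilon> / (8 * (B + 1))"
    using \<beta>0 by (rule order_tendstoD(2)) (use eps B0 in simp)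
  have ev4: "\<forall>\<^sub>F n in sequentially. 1 / real n < \<epsilon> / (4 * real k)"
    using lim_1_over_n by (rule order_tendstoD(2)) (use eps k in simp)
  show ?thesis
    using ev1 ev2 ev3 ev4 eventually_ge_at_top[of 1]
  proof eventually_elim
    case (elim n)
    note n = elim(5)
    interpret edge_law n k "graphon_law n W" by (rule edge_law_graphon[OF n W])
    define h where "h c = (real n)\<^sup>2 * t (empirical_graphon n k c)" for c
    define Bad where "Bad = {c\<in>colorings n k. \<exists>a\<in>{1..k}. \<exists>S\<subseteq>{1..n}. \<exists>T\<subseteq>{1..n}. \<rho> * (real n)\<^sup>2 <
        \<bar>discrepancy n W c a S T\<bar>}"
    have E: "empirical_graphon n k c \<in> prob_graphons k" if "c \<in> colorings n k" for c
      by (rule empirical_graphon_in[OF k that])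
    have good: "t W - \<epsilon> / 4 \<le> t (empirical_graphon n k c)" if c: "c \<in> colorings n k - Bad" for c
    proof -
      have c': "c \<in> colorings n k" using c by simp
      have disc: "\<bar>discrepancy n W c a S T\<bar> \<le> \<rho> * (real n)\<^sup>2"
          if "a \<in> {1..k}" "S \<subseteq> {1..n}" "T \<subseteq> {1..n}" for a S T
      proof (rule ccontr)
        assume "\<not> \<bar>discrepancy n W c a S T\<bar> \<le> \<rho> * (real n)\<^sup>2"
        then have "\<rho> * (real n)\<^sup>2 < \<bar>discrepancy n W c a S T\<bar>" by linarith
        then have "c \<in> Bad" unfolding Bad_def using c' that by blast
        then show False using c by simp
      qed
      have "cut_dist k W (empirical_graphon n k c) \<le>
          (\<Sum>a=1..k. avg_err n (W a)) + real k * (\<rho> + 1 / real n)"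
        by (rule empirical_close[OF k n W c' disc])
      moreover have "real k * (\<rho> + 1 / real n) \<le> real k * (r / (4 * real k) + r / (4 * real k))"
        using \<rho>(3) elim(2) by (intro mult_left_mono add_mono) auto
      moreover have "real k * (r / (4 * real k) + r / (4 * real k)) = r / 2" using k
        by (simp add: field_simps)
      ultimately have "cut_dist k W (empirical_graphon n k c) < r" using elim(1) r by linarith
      then have "\<bar>t (empirical_graphon n k c) - t W\<bar> < \<epsilon> / 4" using rt E[OF c'] by blast
      then show ?thesis by linarith
    qed
    define b where "b = (\<Sum>c\<in>Bad. Q c)"
    have b: "b \<le> \<beta> n" unfolding b_def Bad_def \<beta>_def by (rule discrepancy_prob[OF n W \<rho>(1,2)])
    have BadC: "Bad \<subseteq> colorings n k" by (auto simp: Bad_def)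
    have b0: "b \<ge> 0" unfolding b_def using BadC by (intro sum_nonneg Q_nonneg) auto
    have split: "(\<Sum>c\<in>colorings n k. F c) = (\<Sum>c\<in>colorings n k - Bad. F c) + (\<Sum>c\<in>Bad. F c)"
        for F :: "(nat set \<Rightarrow> nat) \<Rightarrow> real"
      by (rule sum.subset_diff[OF BadC finite_colorings])
    have g: "(\<Sum>c\<in>colorings n k - Bad. Q c) = 1 - b" using split[of Q] Q_sum by (simp add: b_def)
    have mean: "t W - \<epsilon> / 2 \<le> (\<Sum>c\<in>colorings n k. Q c * t (empirical_graphon n k c))"
    proof -
      have "(\<Sum>c\<in>colorings n k - Bad. Q c * (t W - \<epsilon> / 4)) \<le>
          (\<Sum>c\<in>colorings n k - Bad. Q c * t (empirical_graphon n k c))"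
        by (intro sum_mono mult_left_mono good Q_nonneg) auto
      then have 1: "(1 - b) * (t W - \<epsilon> / 4) \<le>
          (\<Sum>c\<in>colorings n k - Bad. Q c * t (empirical_graphon n k c))"
        by (simp only: sum_distrib_right[symmetric] g)
      have "(\<Sum>c\<in>Bad. Q c * (- B)) \<le> (\<Sum>c\<in>Bad. Q c * t (empirical_graphon n k c))"
      proof (intro sum_mono mult_left_mono)
        fix c assume "c \<in> Bad"
        then have c: "c \<in> colorings n k" using BadC by blast
        show "- B \<le> t (empirical_graphon n k c)" using B[OF E[OF c]] by linarith
        show "0 \<le> Q c" by (rule Q_nonneg[OF c])
      qed
      then have 2: "b * (- B) \<le> (\<Sum>c\<in>Bad. Q c * t (empirical_graphon n k c))"
        by (simp only: sum_distrib_right[symmetric] b_def)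
      have "b * (2 * B) \<le> \<epsilon> / (8 * (B + 1)) * (2 * (B + 1))"
        using b b0 elim(3) B0 by (intro mult_mono) auto
      also have "\<dots> = \<epsilon> / 4" using B0 by (simp add: field_simps)
      finally have 3: "b * (2 * B) \<le> \<epsilon> / 4" .
      have "b * t W \<le> b * B" using b0 B[OF W] by (intro mult_left_mono) linarith+
      moreover have "b * (\<epsilon> / 4) \<ge> 0" using b0 eps by simp
      moreover have "(1 - b) * (t W - \<epsilon> / 4) + b * (- B) =
          t W - \<epsilon> / 4 - b * t W + b * (\<epsilon> / 4) - b * B"
        by (simp only: left_diff_distrib right_diff_distrib mult_1 mult_minus_right)
      moreover have "b * (2 * B) = b * B + b * B" by simp
      ultimately have "t W - \<epsilon> / 2 \<le> (1 - b) * (t W - \<epsilon> / 4) + b * (- B)" using 3 by linarith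
      then show ?thesis unfolding split[of "\<lambda>c. Q c * t (empirical_graphon n k c)"] using 1 2
        by linarith
    qed
    have "(real n)\<^sup>2 * (t W - \<epsilon> / 2) \<le> (real n)\<^sup>2 * (\<Sum>c\<in>colorings n k.
        Q c * t (empirical_graphon n k c))"
      using mean by (intro mult_left_mono) auto
    also have "\<dots> = (\<Sum>c\<in>colorings n k. Q c * h c)" by (simp add: h_def sum_distrib_left mult_ac)
    finally have hh: "(real n)\<^sup>2 * (t W - \<epsilon> / 2) \<le> (\<Sum>c\<in>colorings n k. Q c * h c)" .
    have "real n * real k \<le> (real n)\<^sup>2 * (\<epsilon> / 4)"
    proof -
      have "real k < real n * (\<epsilon> / 4)" using elim(4) k n eps by (simp add: field_simps)
      then have "real n * real k \<le> real n * (real n * (\<epsilon> / 4))" by (intro mult_left_mono) auto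
      then show ?thesis by (simp add: power2_eq_square mult.assoc)
    qed
    then have ent: "(\<Sum>e\<in>E. \<Sum>a=1..k. graphon_law n W e a * ln (graphon_law n W e a)) \<le>
        (real n)\<^sup>2 * (?I / 2) + (real n)\<^sup>2 * (\<epsilon> / 8)"
      using law_entropy_le[OF n W] by (simp add: field_simps)
    have e0: "(real n)\<^sup>2 * \<epsilon> \<ge> 0" using eps by simp
    have "(real n)\<^sup>2 * (t W - ?I / 2 - \<epsilon>) = (real n)\<^sup>2 * (t W - \<epsilon> / 2) - (real n)\<^sup>2 * (?I / 2) -
        (real n)\<^sup>2 * \<epsilon> / 2"
      by (simp add: algebra_simps)
    then have "(real n)\<^sup>2 * (t W - ?I / 2 - \<epsilon>) \<le>
        (\<Sum>c\<in>colorings n k. Q c * h c) - (\<Sum>e\<in>E. \<Sum>a=1..k. graphon_law n W e a * ln (graphon_law n W e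
        a))"
      using hh ent e0 by linarith
    then have "exp ((real n)\<^sup>2 * (t W - ?I / 2 - \<epsilon>)) \<le>
        exp ((\<Sum>c\<in>colorings n k. Q c * h c) - (\<Sum>e\<in>E. \<Sum>a=1..k. graphon_law n W e a * ln (graphon_law
        n W e a)))"
      by simp
    also have "\<dots> \<le> (\<Sum>c\<in>colorings n k. exp (h c))" by (rule gibbs_variational)
    finally show ?case by (simp add: h_def)
  qed
qed

section \<open>Concentration\<close>

locale graphon_model =
  fixes k :: nat and T :: "graphon set \<Rightarrow> real"
  assumes k1: "k \<ge> 1" and bdd: "bounded (T ` graphon_space k)"
    and cont: "continuous_map (Metric_space.mtopology (graphon_space k) (class_dist k))
        euclideanreal T"
begin

sublocale GS: Metric_space "graphon_space k" "class_dist k"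
  by (rule Metric_space_graphon_space)

definition J :: "graphon set \<Rightarrow> real" where
  "J A = T A - 1/2 * class_entropy k A"

definition Z :: "nat \<Rightarrow> real" where
  "Z n = (\<Sum>c\<in>colorings n k. gibbs_weight k T n c)"

lemma continuous_at:
  assumes A: "A \<in> graphon_space k" and e: "e > 0"
  shows "\<exists>r>0. \<forall>B\<in>graphon_space k. class_dist k A B < r \<longrightarrow> \<bar>T B - T A\<bar> < e"
proof -
  let ?U = "{B \<in> topspace GS.mtopology. T B \<in> ball (T A) e}"
  have "openin GS.mtopology ?U" by (rule openin_continuous_map_preimage[OF cont]) simp
  moreover have "A \<in> ?U" using A e by simp
  ultimately obtain r where r: "r > 0" "GS.mball A r \<subseteq> ?U" unfolding GS.openin_mtopology by blast
  have "\<bar>T B - T A\<bar> < e" if "B \<in> graphon_space k" "class_dist k A B < r" for B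
  proof -
    have "B \<in> GS.mball A r" using A that by simp
    then have "T B \<in> ball (T A) e" using r(2) by blast
    then show ?thesis by (simp add: dist_real_def abs_minus_commute)
  qed
  then show ?thesis using r(1) by blast
qed

lemma empirical_class_in: "c \<in> colorings n k \<Longrightarrow> empirical_class n k c \<in> graphon_space k"
  unfolding empirical_class_def by (intro graphon_class_in empirical_graphon_in[OF k1])

lemma class_dist_empirical:
  "A \<in> graphon_space k \<Longrightarrow> c \<in> colorings n k \<Longrightarrow> class_dist k A (empirical_class n k c) =
      cut_dist k (graphon_rep A) (empirical_graphon n k c)"
  unfolding empirical_class_def by (intro class_dist_class empirical_graphon_in[OF k1])

definition ball_weight :: "nat \<Rightarrow> graphon set \<Rightarrow> real \<Rightarrow> real" where
  "ball_weight n A r = (\<Sum>c\<in>{c\<in>colorings n k. class_dist k A (empirical_class n k c) <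
      r}. gibbs_weight k T n c)"

text \<open>Number of colourings in the ball times the largest weight on it: the count spends
  \<open>\<epsilon> / 2\<close>, the oscillation of \<open>T\<close> on the ball the other
  half.\<close>

lemma local_upper_bound:
  assumes A: "A \<in> graphon_space k" and eps: "\<epsilon> > 0"
  shows "\<exists>r>0. \<forall>\<^sub>F n in sequentially. ball_weight n A r \<le> exp ((real n)\<^sup>2 * (J A + \<epsilon>))"
proof -
  have eps2: "\<epsilon> / 2 > 0" using eps by simp
  from ball_count_le[OF k1 graphon_rep(2)[OF A] eps2] obtain r1 where r1: "r1 > 0" and
    count: "\<forall>\<^sub>F n in sequentially. real (card {c \<in> colorings n k.
        cut_dist k (graphon_rep A) (empirical_graphon n k c) < r1}) \<le>
      exp ((real n)\<^sup>2 * (\<epsilon> / 2 - graphon_entropy k (graphon_rep A) / 2))" by (elim exE conjE)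
  from continuous_at[OF A eps2] obtain r2 where r2: "r2 > 0" and
    T: "\<forall>B\<in>graphon_space k. class_dist k A B < r2 \<longrightarrow> \<bar>T B - T A\<bar> < \<epsilon> / 2" by (elim exE conjE)
  define r where "r = min r1 r2"
  have "\<forall>\<^sub>F n in sequentially. ball_weight n A r \<le> exp ((real n)\<^sup>2 * (J A + \<epsilon>))"
    using count
  proof eventually_elim
    case (elim n)
    let ?S = "{c\<in>colorings n k. class_dist k A (empirical_class n k c) < r}"
    have "ball_weight n A r \<le> (\<Sum>c\<in>?S. exp ((real n)\<^sup>2 * (T A + \<epsilon> / 2)))"
      unfolding ball_weight_def
    proof (rule sum_mono)
      fix c assume c: "c \<in> ?S"
      then have "class_dist k A (empirical_class n k c) < r2" by (simp add: r_def)
      then have "\<bar>T (empirical_class n k c) - T A\<bar> < \<epsilon> / 2" using T empirical_class_in c by blast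
      then have "T (empirical_class n k c) \<le> T A + \<epsilon> / 2" by linarith
      then show "gibbs_weight k T n c \<le> exp ((real n)\<^sup>2 * (T A + \<epsilon> / 2))"
        unfolding gibbs_weight_def by (simp add: mult_left_mono)
    qed
    also have "\<dots> = real (card ?S) * exp ((real n)\<^sup>2 * (T A + \<epsilon> / 2))" by simp
    also have "\<dots> \<le> exp ((real n)\<^sup>2 * (\<epsilon> / 2 - graphon_entropy k (graphon_rep A) / 2)) *
        exp ((real n)\<^sup>2 * (T A + \<epsilon> / 2))"
    proof (rule mult_right_mono)
      have "?S \<subseteq> {c \<in> colorings n k. cut_dist k (graphon_rep A) (empirical_graphon n k c) < r1}"
        using class_dist_empirical[OF A] by (auto simp: r_def)
      then have "real (card ?S) \<le> real (card {c \<in> colorings n k.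
          cut_dist k (graphon_rep A) (empirical_graphon n k c) < r1})"
        by (intro of_nat_mono card_mono) auto
      then show "real (card ?S) \<le> exp ((real n)\<^sup>2 * (\<epsilon> / 2 -
          graphon_entropy k (graphon_rep A) / 2))" using elim by linarith
    qed simp
    also have "\<dots> = exp ((real n)\<^sup>2 * (J A + \<epsilon>))"
      unfolding exp_add[symmetric]
      by (rule arg_cong[where f=exp]) (simp add: J_def class_entropy_def algebra_simps)
    finally show ?case .
  qed
  then show ?thesis using r1 r2 by (intro exI[of _ r]) (simp add: r_def)
qed

lemma global_lower_bound:
  assumes A: "A \<in> graphon_space k" and eps: "\<epsilon> > 0"
  shows "\<forall>\<^sub>F n in sequentially. exp ((real n)\<^sup>2 * (J A - \<epsilon>)) \<le> Z n"
proof -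
  define t where "t U = T (graphon_class k U)" for U
  obtain B where B: "\<And>A. A \<in> graphon_space k \<Longrightarrow> \<bar>T A\<bar> \<le> B"
    using bdd unfolding bounded_iff by auto
  have tA: "t (graphon_rep A) = T A" by (simp add: t_def graphon_class_rep[OF A])
  have "\<forall>\<^sub>F n in sequentially. exp ((real n)\<^sup>2 * (t (graphon_rep A) -
      graphon_entropy k (graphon_rep A) / 2 - \<epsilon>)) \<le>
    (\<Sum>c\<in>colorings n k. exp ((real n)\<^sup>2 * t (empirical_graphon n k c)))"
  proof (rule partition_function_ge[OF k1 graphon_rep(2)[OF A] _ _ eps])
    show "\<bar>t U\<bar> \<le> B" if "U \<in> prob_graphons k" for U unfolding t_def
      by (intro B graphon_class_in that)
    fix e :: real assume "e > 0"
    from continuous_at[OF A this] obtain r where r: "r > 0" "\<forall>B\<in>graphon_space k. class_dist k A B <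
        r \<longrightarrow> \<bar>T B - T A\<bar> < e"
      by (elim exE conjE)
    have "\<bar>t U - t (graphon_rep A)\<bar> < e" if U: "U \<in> prob_graphons k"
        "cut_dist k (graphon_rep A) U < r" for U
      using r(2) graphon_class_in[OF U(1)] class_dist_class[OF A U(1)] U(2) unfolding tA
      unfolding t_def by auto
    then show "\<exists>r>0. \<forall>U\<in>prob_graphons k. cut_dist k (graphon_rep A) U < r \<longrightarrow>
        \<bar>t U - t (graphon_rep A)\<bar> < e"
      using r(1) by blast
  qed
  then show ?thesis
    unfolding tA
    by (simp add: J_def class_entropy_def Z_def gibbs_weight_def empirical_class_def t_def)
qed

lemma gibbs_weight_pos: "gibbs_weight k T n c > 0"
  by (simp add: gibbs_weight_def)

lemma weight_cover_le:
  assumes K: "finite K" and S: "S \<subseteq> colorings n k"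
    and cov: "\<And>c. c \<in> S \<Longrightarrow> \<exists>B\<in>K. class_dist k B (empirical_class n k c) < r B"
  shows "(\<Sum>c\<in>S. gibbs_weight k T n c) \<le> (\<Sum>B\<in>K. ball_weight n B (r B))"
proof -
  let ?D = "\<lambda>B. {c\<in>colorings n k. class_dist k B (empirical_class n k c) < r B}"
  have "(\<Sum>c\<in>S. gibbs_weight k T n c) \<le> (\<Sum>c\<in>(\<Union>B\<in>K. ?D B). gibbs_weight k T n c)"
  proof (rule sum_mono2)
    show "finite (\<Union>B\<in>K. ?D B)" using K by simp
    show "S \<subseteq> (\<Union>B\<in>K. ?D B)" using S cov by blast
  qed (use gibbs_weight_pos less_imp_le in blast)
  also have "\<dots> \<le> (\<Sum>B\<in>K. \<Sum>c\<in>?D B. gibbs_weight k T n c)"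
    by (rule sum_UN_le) (use K gibbs_weight_pos less_imp_le in auto)
  finally show ?thesis by (simp add: ball_weight_def)
qed

lemma eventually_sum_balls_le:
  assumes K: "finite K" and ev: "\<And>B. B \<in> K \<Longrightarrow> \<forall>\<^sub>F n in sequentially. ball_weight n B (r B) \<le>
      exp ((real n)\<^sup>2 * a B)"
    and a: "\<And>B. B \<in> K \<Longrightarrow> a B \<le> b"
  shows "\<forall>\<^sub>F n in sequentially. (\<Sum>B\<in>K. ball_weight n B (r B)) \<le>
      real (card K) * exp ((real n)\<^sup>2 * b)"
proof -
  have "\<forall>\<^sub>F n in sequentially. \<forall>B\<in>K. ball_weight n B (r B) \<le> exp ((real n)\<^sup>2 * a B)"
    using K ev by (intro eventually_ball_finite) auto
  then show ?thesis
  proof eventually_elim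
    case (elim n)
    have "(\<Sum>B\<in>K. ball_weight n B (r B)) \<le> (\<Sum>B\<in>K. exp ((real n)\<^sup>2 * b))"
    proof (rule sum_mono)
      fix B assume B: "B \<in> K"
      have "exp ((real n)\<^sup>2 * a B) \<le> exp ((real n)\<^sup>2 * b)" using a[OF B]
        by (simp add: mult_left_mono)
      then show "ball_weight n B (r B) \<le> exp ((real n)\<^sup>2 * b)" using bspec[OF elim B] by linarith
    qed
    then show ?case by simp
  qed
qed

lemma graphon_space_nonempty: "graphon_space k \<noteq> {}"
proof -
  \<comment> \<open>One vertex has no edges, so this is the empty colouring.\<close>
  have "(\<lambda>e. if e \<in> complete_edges 1 then 1 else undefined) \<in> colorings 1 k"
    using k1 by (auto simp: colorings_def)
  then show ?thesis using empirical_class_in by blast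
qed

text \<open>No semicontinuity of the entropy is needed for a maximiser to exist: otherwise every class would be
  beaten by another one, and the upper bounds over a finite cover would contradict the lower bound at the
  best of the beating classes.\<close>

lemma maximizers_nonempty: "maximizers k T \<noteq> {}"
proof
  assume empty: "maximizers k T = {}"
  have "\<forall>A\<in>graphon_space k. \<exists>B. B \<in> graphon_space k \<and> J A < J B"
  proof
    fix A assume A: "A \<in> graphon_space k"
    have "A \<notin> maximizers k T" using empty by simp
    then show "\<exists>B. B \<in> graphon_space k \<and> J A < J B"
      using A unfolding maximizers_def is_arg_max_def J_def by auto
  qed
  from bchoice[OF this] obtain \<beta> where "\<forall>A\<in>graphon_space k. \<beta> A \<in> graphon_space k \<and> J A < J (\<beta> A)"
    by (elim exE)
  then have \<beta>: "\<beta> A \<in> graphon_space k" "J A < J (\<beta> A)" if "A \<in> graphon_space k" for A using that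
    by auto
  \<comment> \<open>A third of the gap: the upper exponent at \<open>A\<close> stays two thirds
    below \<open>J (\<beta> A)\<close>, while the lower bound at the best \<open>\<beta> A\<close>
    gives up at most one third of any gap in the cover. What remains beats the number of
    balls.\<close>
  define \<epsilon> where "\<epsilon> A = (J (\<beta> A) - J A) / 3" for A
  have \<epsilon>: "\<epsilon> A > 0" if "A \<in> graphon_space k" for A using \<beta>(2)[OF that] by (simp add: \<epsilon>_def)
  have "\<forall>A\<in>graphon_space k. \<exists>r. r > 0 \<and> (\<forall>\<^sub>F n in sequentially. ball_weight n A r \<le>
      exp ((real n)\<^sup>2 * (J A + \<epsilon> A)))"
  proof
    fix A assume A: "A \<in> graphon_space k"
    show "\<exists>r. r > 0 \<and> (\<forall>\<^sub>F n in sequentially. ball_weight n A r \<le> exp ((real n)\<^sup>2 * (J A + \<epsilon> A)))"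
      by (rule local_upper_bound[OF A \<epsilon>[OF A]])
  qed
  from bchoice[OF this] obtain r where "\<forall>A\<in>graphon_space k. r A > 0 \<and>
      (\<forall>\<^sub>F n in sequentially. ball_weight n A (r A) \<le> exp ((real n)\<^sup>2 * (J A + \<epsilon> A)))"
    by (elim exE)
  then have r: "r A > 0" "\<forall>\<^sub>F n in sequentially. ball_weight n A (r A) \<le>
      exp ((real n)\<^sup>2 * (J A + \<epsilon> A))" if "A \<in> graphon_space k" for A
    using that by auto
  have "\<exists>K. finite K \<and> K \<subseteq> graphon_space k \<and> (\<forall>A\<in>graphon_space k. \<exists>B\<in>K. class_dist k B A < r B)"
    by (rule finite_ball_cover[OF k1 r(1)])
  then obtain K where K: "finite K" "K \<subseteq> graphon_space k"
    and cov: "\<forall>A\<in>graphon_space k. \<exists>B\<in>K. class_dist k B A < r B" by (elim exE conjE)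
  have "K \<noteq> {}" using cov graphon_space_nonempty by blast
  define m where "m = Max ((\<lambda>A. J (\<beta> A)) ` K)"
  have "m \<in> (\<lambda>A. J (\<beta> A)) ` K" unfolding m_def using K \<open>K \<noteq> {}\<close> by (intro Max_in) auto
  then obtain A0 where A0: "A0 \<in> K" "m = J (\<beta> A0)" by blast
  define \<epsilon>0 where "\<epsilon>0 = Min (\<epsilon> ` K)"
  have \<epsilon>0: "\<epsilon>0 > 0" unfolding \<epsilon>0_def using K \<open>K \<noteq> {}\<close> \<epsilon> by (subst Min_gr_iff) auto
  have aB: "J A + \<epsilon> A \<le> m - 2 * \<epsilon>0" if A: "A \<in> K" for A
  proof -
    have "J (\<beta> A) \<le> m" "\<epsilon>0 \<le> \<epsilon> A" unfolding m_def \<epsilon>0_def using K A by auto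
    moreover have "3 * \<epsilon> A = J (\<beta> A) - J A" by (simp add: \<epsilon>_def)
    ultimately show ?thesis by linarith
  qed
  have up: "\<forall>\<^sub>F n in sequentially. (\<Sum>B\<in>K. ball_weight n B (r B)) \<le>
      real (card K) * exp ((real n)\<^sup>2 * (m - 2 * \<epsilon>0))"
    by (rule eventually_sum_balls_le[OF K(1) _ aB]) (use r(2) K(2) in blast)+
  have low: "\<forall>\<^sub>F n in sequentially. exp ((real n)\<^sup>2 * (m - \<epsilon>0)) \<le> Z n"
    unfolding A0(2) by (rule global_lower_bound[OF \<beta>(1) \<epsilon>0]) (use A0 K in blast)
  have "\<forall>\<^sub>F n in sequentially. False"
    using up low eventually_exp_square_gt[OF \<epsilon>0, of "real (card K)"]
  proof eventually_elim
    case (elim n)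
    have "Z n \<le> (\<Sum>B\<in>K. ball_weight n B (r B))"
      unfolding Z_def
      by (rule weight_cover_le[OF K(1) order_refl]) (use cov empirical_class_in in blast)
    then have "exp ((real n)\<^sup>2 * (m - \<epsilon>0)) \<le> real (card K) * exp ((real n)\<^sup>2 * (m - 2 * \<epsilon>0))"
      using elim by linarith
    also have "\<dots> < exp ((real n)\<^sup>2 * \<epsilon>0) * exp ((real n)\<^sup>2 * (m - 2 * \<epsilon>0))" using elim(3)
      by (intro mult_strict_right_mono) auto
    also have "\<dots> = exp ((real n)\<^sup>2 * (m - \<epsilon>0))"
      unfolding exp_add[symmetric] by (rule arg_cong[where f=exp]) (simp add: algebra_simps)
    finally show False by simp
  qed
  then show False by simp
qed

text \<open>Maximisers get balls of radius \<open>\<delta>\<close>, all other classes the balls of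
  \<open>local_upper_bound\<close>. A colouring farther than \<open>\<delta>\<close> from the
  maximisers can only be covered by a ball of the second kind, whose weight is exponentially below
  the partition function.\<close>

lemma concentration:
  assumes \<delta>: "\<delta> > 0"
  shows "\<exists>C>0. \<forall>\<^sub>F n in sequentially.
    (\<Sum>c\<in>{c\<in>colorings n k. class_dist_set k (empirical_class n k c) (maximizers k T) > \<delta>}.
        gibbs_weight k T n c) / Z n \<le> exp (- C * real n ^ 2)"
proof -
  let ?S = "maximizers k T"
  have Sub: "?S \<subseteq> graphon_space k" by (auto simp: maximizers_def is_arg_max_def)
  obtain A0 where A0: "A0 \<in> ?S" using maximizers_nonempty by blast
  define m where "m = J A0"
  have less: "J A < m" if A: "A \<in> graphon_space k - ?S" for A
  proof -
    have "\<exists>B. B \<in> graphon_space k \<and> J A < J B"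
      using A unfolding maximizers_def is_arg_max_def J_def by auto
    then obtain B where B: "B \<in> graphon_space k" "J A < J B" by blast
    have "\<not> m < J B" using A0 B(1) unfolding maximizers_def is_arg_max_def m_def J_def by auto
    then show ?thesis using B(2) by linarith
  qed
  define \<epsilon> where "\<epsilon> A = (m - J A) / 3" for A
  have "\<forall>A\<in>graphon_space k. \<exists>r. r > 0 \<and> (if A \<in> ?S then r =
      \<delta> else \<forall>\<^sub>F n in sequentially. ball_weight n A r \<le> exp ((real n)\<^sup>2 * (J A + \<epsilon> A)))"
  proof
    fix A assume A: "A \<in> graphon_space k"
    show "\<exists>r. r > 0 \<and> (if A \<in> ?S then r = \<delta> else \<forall>\<^sub>F n in sequentially. ball_weight n A r \<le>
        exp ((real n)\<^sup>2 * (J A + \<epsilon> A)))"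
    proof (cases "A \<in> ?S")
      case True
      then show ?thesis using \<delta> by auto
    next
      case False
      then have "\<epsilon> A > 0" using less[of A] A by (simp add: \<epsilon>_def)
      then show ?thesis using local_upper_bound[OF A] False by simp
    qed
  qed
  from bchoice[OF this] obtain r where "\<forall>A\<in>graphon_space k. r A > 0 \<and>
      (if A \<in> ?S then r A = \<delta> else \<forall>\<^sub>F n in sequentially. ball_weight n A (r A) \<le> exp ((real n)\<^sup>2 *
      (J A + \<epsilon> A)))"
    by (elim exE)
  then have r: "r A > 0" and rS: "A \<in> ?S \<Longrightarrow> r A = \<delta>"
    and rN: "A \<notin> ?S \<Longrightarrow> \<forall>\<^sub>F n in sequentially. ball_weight n A (r A) \<le>
        exp ((real n)\<^sup>2 * (J A + \<epsilon> A))" if "A \<in> graphon_space k" for A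
    using that by auto
  have "\<exists>K. finite K \<and> K \<subseteq> graphon_space k \<and> (\<forall>A\<in>graphon_space k. \<exists>B\<in>K. class_dist k B A < r B)"
    by (rule finite_ball_cover[OF k1 r])
  then obtain K where K: "finite K" "K \<subseteq> graphon_space k"
    and cov: "\<forall>A\<in>graphon_space k. \<exists>B\<in>K. class_dist k B A < r B" by (elim exE conjE)
  define K' where "K' = K - ?S"
  have K': "finite K'" using K by (simp add: K'_def)
  \<comment> \<open>The 1 keeps the minimum defined when every centre of the cover is a
    maximiser.\<close>
  define \<eta> where "\<eta> = Min (insert 1 (\<epsilon> ` K'))"
  have \<epsilon>K: "\<epsilon> A > 0" if "A \<in> K'" for A using less[of A] that K(2) by (auto simp: K'_def \<epsilon>_def)
  have \<eta>: "\<eta> > 0" unfolding \<eta>_def using K' \<epsilon>K by (subst Min_gr_iff) auto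
  have aB: "J A + \<epsilon> A \<le> m - 2 * \<eta>" if A: "A \<in> K'" for A
  proof -
    have "\<eta> \<le> \<epsilon> A" unfolding \<eta>_def using K' A by auto
    moreover have "3 * \<epsilon> A = m - J A" by (simp add: \<epsilon>_def)
    ultimately show ?thesis by linarith
  qed
  have up: "\<forall>\<^sub>F n in sequentially. (\<Sum>B\<in>K'. ball_weight n B (r B)) \<le>
      real (card K') * exp ((real n)\<^sup>2 * (m - 2 * \<eta>))"
    by (rule eventually_sum_balls_le[OF K' _ aB]) (use rN K(2) K'_def in blast)+
  have \<eta>2: "\<eta> / 2 > 0" using \<eta> by simp
  have low: "\<forall>\<^sub>F n in sequentially. exp ((real n)\<^sup>2 * (m - \<eta> / 2)) \<le> Z n"
    unfolding m_def by (rule global_lower_bound[OF _ \<eta>2]) (use A0 Sub in blast)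
  \<comment> \<open>Exponents per \<open>n^2\<close>: \<open>m - 2 * \<eta>\<close> for a ball and
    \<open>\<eta> / 2\<close> for the number of balls, against \<open>m - \<eta> / 2\<close> for the
    partition function. The balance is \<open>- \<eta>\<close>, so \<open>C\<close> is
    \<open>\<eta>\<close>.\<close>
  have "\<forall>\<^sub>F n in sequentially.
    (\<Sum>c\<in>{c\<in>colorings n k. class_dist_set k (empirical_class n k c) ?S > \<delta>}. gibbs_weight k T n c) /
        Z n \<le> exp (- \<eta> * real n ^ 2)"
    using up low eventually_exp_square_gt[OF \<eta>2, of "real (card K')"]
  proof eventually_elim
    case (elim n)
    let ?Bad = "{c\<in>colorings n k. class_dist_set k (empirical_class n k c) ?S > \<delta>}"
    have "(\<Sum>c\<in>?Bad. gibbs_weight k T n c) \<le> (\<Sum>B\<in>K'. ball_weight n B (r B))"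
    proof (rule weight_cover_le[OF K'])
      fix c assume c: "c \<in> ?Bad"
      then have E: "empirical_class n k c \<in> graphon_space k" using empirical_class_in by blast
      obtain B where B: "B \<in> K" "class_dist k B (empirical_class n k c) < r B"
        using bspec[OF cov E] by (elim bexE)
      have "B \<notin> ?S"
      proof
        assume BS: "B \<in> ?S"
        have "class_dist_set k (empirical_class n k c) ?S \<le> class_dist k (empirical_class n k c) B"
          unfolding class_dist_set_def using BS by (intro cINF_lower bdd_belowI2[where m=0]) auto
        also have "\<dots> = class_dist k B (empirical_class n k c)" by (rule GS.commute)
        finally show False using B(2) rS[OF _ BS] BS Sub c by auto
      qed
      then show "\<exists>B\<in>K'. class_dist k B (empirical_class n k c) < r B" using B by (auto simp: K'_def)
    qed auto
    also have "\<dots> \<le> real (card K') * exp ((real n)\<^sup>2 * (m - 2 * \<eta>))" by (rule elim(1))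
    also have "\<dots> \<le> exp ((real n)\<^sup>2 * (\<eta> / 2)) * exp ((real n)\<^sup>2 * (m - 2 * \<eta>))" using elim(3)
      by (intro mult_right_mono) auto
    also have "\<dots> = exp (- \<eta> * real n ^ 2) * exp ((real n)\<^sup>2 * (m - \<eta> / 2))"
      unfolding exp_add[symmetric] by (rule arg_cong[where f=exp]) (simp add: algebra_simps)
    also have "\<dots> \<le> exp (- \<eta> * real n ^ 2) * Z n" using elim(2) by (intro mult_left_mono) auto
    finally have le: "(\<Sum>c\<in>?Bad. gibbs_weight k T n c) \<le> exp (- \<eta> * real n ^ 2) * Z n" .
    have "0 < exp ((real n)\<^sup>2 * (m - \<eta> / 2))" by simp
    then have "Z n > 0" using elim(2) by linarith
    then show ?case using le by (simp add: divide_le_eq)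
  qed
  then show ?thesis using \<eta> by blast
qed

section \<open>Transfer to random colourings\<close>

lemma measure_gibbs_law:
  assumes "S \<subseteq> colorings n k"
  shows "measure (gibbs_law k T n) S = (\<Sum>c\<in>S. gibbs_weight k T n c) / Z n"
proof -
  have Z0: "Z n \<ge> 0" unfolding Z_def by (intro sum_nonneg less_imp_le gibbs_weight_pos)
  have nn: "gibbs_weight k T n c / Z n \<ge> 0" for c using Z0 gibbs_weight_pos[of n c]
    by (intro divide_nonneg_nonneg) auto
  have "emeasure (gibbs_law k T n) S = (\<Sum>c\<in>S. ennreal (gibbs_weight k T n c / Z n))"
    unfolding gibbs_law_def Z_def by (rule emeasure_point_measure_finite[OF finite_colorings assms])
  also have "\<dots> = ennreal (\<Sum>c\<in>S. gibbs_weight k T n c / Z n)" using nn by (intro sum_ennreal) auto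
  finally have "measure (gibbs_law k T n) S = (\<Sum>c\<in>S. gibbs_weight k T n c / Z n)"
    using nn by (simp add: measure_def sum_nonneg)
  then show ?thesis by (simp add: sum_divide_distrib)
qed

end

theorem corollary3p4:
  fixes k :: nat
    and T :: "graphon set \<Rightarrow> real"
    and M :: "nat \<Rightarrow> 'w measure"
    and X :: "nat \<Rightarrow> 'w \<Rightarrow> (nat set \<Rightarrow> nat)"
  assumes "k \<ge> 2"
    and "bounded (T ` graphon_space k)"
    and "continuous_map (Metric_space.mtopology (graphon_space k) (class_dist k)) euclideanreal T"
    and "\<And>n. n \<ge> 1 \<Longrightarrow> prob_space (M n)"
    and "\<And>n. n \<ge> 1 \<Longrightarrow> X n \<in> M n \<rightarrow>\<^sub>M count_space (colorings n k)"
    and "\<And>n. n \<ge> 1 \<Longrightarrow> distr (M n) (count_space (colorings n k)) (X n) = gibbs_law k T n"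
  shows "\<forall>\<delta>>0. \<exists>C>0. \<forall>\<^sub>F n in sequentially.
    measure (M n) {\<omega> \<in> space (M n).
      class_dist_set k (empirical_class n k (X n \<omega>)) (maximizers k T) > \<delta>}
    \<le> exp (- C * real n ^ 2)"
proof (intro allI impI)
  fix \<delta> :: real assume \<delta>: "\<delta> > 0"
  interpret graphon_model k T using assms(1-3) by unfold_locales auto
  define Bad where "Bad n = {c\<in>colorings n k.
      class_dist_set k (empirical_class n k c) (maximizers k T) > \<delta>}" for n
  from concentration[OF \<delta>] obtain C where C: "C > 0" and
    ev: "\<forall>\<^sub>F n in sequentially. (\<Sum>c\<in>Bad n. gibbs_weight k T n c) / Z n \<le> exp (- C * real n ^ 2)"
    unfolding Bad_def by (elim exE conjE)
  have "\<forall>\<^sub>F n in sequentially. measure (M n) {\<omega> \<in> space (M n).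
      class_dist_set k (empirical_class n k (X n \<omega>)) (maximizers k T) > \<delta>} \<le> exp (- C * real n ^ 2)"
    using ev eventually_ge_at_top[of 1]
  proof eventually_elim
    case (elim n)
    note X = assms(5)[OF elim(2)]
    \<comment> \<open>\<open>X n\<close> takes its values in \<open>colorings n k\<close>, so the
      event is a preimage and its probability depends on the law of \<open>X n\<close> only.\<close>
    have "{\<omega> \<in> space (M n). class_dist_set k (empirical_class n k (X n \<omega>)) (maximizers k T) > \<delta>} =
        X n -` Bad n \<inter> space (M n)"
      using measurable_space[OF X] by (auto simp: Bad_def)
    then have "measure (M n) {\<omega> \<in> space (M n).
        class_dist_set k (empirical_class n k (X n \<omega>)) (maximizers k T) > \<delta>} =
        measure (distr (M n) (count_space (colorings n k)) (X n)) (Bad n)"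
      by (simp add: measure_distr[OF X] Bad_def)
    also have "\<dots> = (\<Sum>c\<in>Bad n. gibbs_weight k T n c) / Z n"
      unfolding assms(6)[OF elim(2)] by (rule measure_gibbs_law) (auto simp: Bad_def)
    finally show ?case using elim(1) by simp
  qed
  then show "\<exists>C>0. \<forall>\<^sub>F n in sequentially. measure (M n) {\<omega> \<in> space (M n).
      class_dist_set k (empirical_class n k (X n \<omega>)) (maximizers k T) > \<delta>} \<le> exp (- C * real n ^ 2)"
    using C by blast
qed

end
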